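(* Let $\mathfrak{C}(\alpha)$ denote the expected running time of the subroutine TS described in the context. Then: (i) for $t>0$, the running time of Procedure P$(t)$ has finite moments of all orders, with expected value bounded by $$\lceil t/r\rceil\,(\mathfrak{C}(\alpha)+9)\,\mathrm{const}(\zeta);$$ (ii) for time points $t_0<t_1<\dots<t_n$, the running time of the remaining-lifetime-path procedure, when Procedure P is used as its single-time sampling subroutine, has finite moments of all orders, with expected value bounded by $$4n+\mathrm{const}(\zeta)\,(\mathfrak{C}(\alpha)+9)\sum_{i=1}^n\left\lceil\frac{t_i-t_{i-1}}{r}\right\rceil.$$ In both expressions $\mathrm{const}(\zeta)$ is the same positive constant, which depends only on the measure $\zeta$.
   Context: Let $\sigma$ be a driftless subordinator, $\sigma_0=0$, with Lévy measure $$\nu(ds)=\theta\frac{\alpha}{\Gamma(1-\alpha)}s^{-\alpha-1}\mathbf{1}_{\{0<s\le r\}}ds+\zeta(ds),$$ with $\alpha\in(0,1)$, $\theta>0$, $r\in(0,+\infty]$ and $\zeta$ a finite measure on $(0,+\infty)$. Put $L_t=\inf\{s>0:\sigma_s>t\}$, $\Gamma_t=\sigma_{L_t}-t$. For $0<\mathfrak{b}\le r$ write $\nu=\nu_{\mathfrak{b}}+\widetilde\zeta_{\mathfrak{b}}$ with $\nu_{\mathfrak{b}}(ds)=\theta\frac{\alpha}{\Gamma(1-\alpha)}s^{-\alpha-1}\mathbf{1}_{\{0<s\le\mathfrak{b}\}}ds$, $\widetilde\zeta_{\mathfrak{b}}(ds)=\theta\frac{\alpha}{\Gamma(1-\alpha)}s^{-\alpha-1}\mathbf{1}_{\{\mathfrak{b}<s\le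 r\}}ds+\zeta(ds)$, and $\Upsilon_{\mathfrak{b}}=\widetilde\zeta_{\mathfrak{b}}(0,+\infty)$. Let $\sigma^{\mathfrak{b}}$ be the truncated stable subordinator with Lévy measure $\nu_{\mathfrak{b}}$. Procedure P$(t)$ (samples $(L_t,\Gamma_t)$). Case $t\le r$. Start with $(x,v)=(0,0)$, $\mathfrak{b}=t$. Repeat the following until $\mathfrak{b}\le0$: 1. Generate an exponential variable $\mathcal{E}$ with mean $1/\Upsilon_{\mathfrak{b}}$ ($\mathcal{E}=+\infty$ if $\Upsilon_{\mathfrak{b}}=0$). 2. Call subroutine TS to generate $(x',v')$ distributed as the first passage time of $\sigma^{\mathfrak{b}}$ above $\mathfrak{b}$ and the position of $\sigma^{\mathfrak{b}}$ at that time. 3. If $\mathcal{E}>x'$, set $(x,v)\leftarrow(x+x',v+v')$. 4. Otherwise generate $W$ with the law of $\sigma^{\mathfrak{b}}_{\mathcal{E}}$ conditioned on $\sigma^{\mathfrak{b}}_{\mathcal{E}}<\mathfrak{b}$, generate $\mathcal{J}\sim\widetilde\zeta_{\mathfrak{b}}/\Upsilon_{\mathfrak{b}}$, and set $(x,v)\leftarrow(x+\mathcal{E},v+\mathcal{J}+W)$. 5. Set $\mathfrak{b}\leftarrow t-v$. Output $(x,v-t)$. Case $t>r$. Apply the remaining-lifetime-path procedure started from $(0,0)$ on the grid $\frac{i}{k}t$, $i=0,\dots,k$, with $k=\lceil t/r\rceil$, using the case $t\le r$ as the single-time subroutine. Remaining-lifetime-path procedure. Input: state $(x_0,r_0)$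 with $r_0\ge0$ and times $t_0<\dots<t_n$. For $i=1,\dots,n$, with current state $(x,\rho)$: if $\rho>t_i-t_{i-1}$, the new state is $(x,\rho-(t_i-t_{i-1}))$; otherwise call the single-time subroutine to generate $(L',\Gamma')$ with the law of $(L_u,\Gamma_u)$, $u=t_i-t_{i-1}-\rho$, and the new state is $(x+L',\Gamma')$. Cost model. Elementary operations cost one. Sampling from $\zeta/\zeta(0,+\infty)$, hence from $\widetilde\zeta_{\mathfrak{b}}/\Upsilon_{\mathfrak{b}}$, has constant cost. The generation of $W$ uses an existing algorithm (González Cázares, Lin and Mijatović) with expected running time $5$ and finite moments of all orders. Subroutine TS is an existing rejection-sampling algorithm (Dassios, Lim and Qu, Algorithm 4.1). Its running time has finite exponential moments and does not depend on $\mathfrak{b}$. Its expected running time $\mathfrak{C}(\alpha)$ is, up to a constant cost of elementary calculations, bounded by the minimum over $\lambda\in(0,A_0)$, $A_0=(1-\alpha)\alpha^{\alpha/(1-\alpha)}$, of $$C(\lambda)=\frac{\alpha\,\Gamma(2-\alpha)A_0}{\Gamma(1-\alpha)(1-\alpha)(A_0-\lambda)^{2-\alpha}}\,e^{\Gamma(1-\alpha)^{-1/\alpha}\lambda^{1-1/\alpha}\alpha(1-\alpha)^{1/\alpha-1}}.$$ For $r=+\infty$, $\lceil t/r\rceil$ is read as $1$.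
   Formalization: const depends on ζ, the cost of sampling ζ, and a bound T on min(t,r) (resp. each min(t_i−t_{i−1},r)); depending on ζ alone is false, e.g. ζ=δ_1, r=+∞, t→∞. Finite moments hold for all t. Moments of the cost of generating W are assumed bounded uniformly in its parameters. *)

theory Defs
  imports "HOL-Probability.Probability"
begin

section \<open>Subordinators and first passage\<close>

text \<open>
  Everything is indexed by real times, of which only the nonnegative ones matter.  Left limits
  of the paths come for free from monotonicity; being driftless is contained in the form of the
  Laplace exponent.
\<close>

definition levy_measure_subordinator :: "real measure \<Rightarrow> bool" where
  "levy_measure_subordinator \<nu> \<longleftrightarrow>
     sets \<nu> = sets borel \<and> emeasure \<nu> {..0} = 0 \<and> (\<integral>\<^sup>+ s. ennreal (min 1 s) \<partial>\<nu>) < \<infinity>"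

definition driftless_subordinator ::
  "'w measure \<Rightarrow> (real \<Rightarrow> 'w \<Rightarrow> real) \<Rightarrow> real measure \<Rightarrow> bool" where
  "driftless_subordinator M X \<nu> \<longleftrightarrow>
     prob_space M \<and> levy_measure_subordinator \<nu> \<and>
     (\<forall>s\<ge>0. X s \<in> borel_measurable M) \<and>
     (\<forall>\<omega>\<in>space M. X 0 \<omega> = 0 \<and> mono_on {0..} (\<lambda>s. X s \<omega>) \<and>
        (\<forall>s\<ge>0. continuous (at_right s) (\<lambda>u. X u \<omega>))) \<and>
     (\<forall>(n::nat) t. 0 \<le> t 0 \<and> mono t \<longrightarrow>
        prob_space.indep_vars M (\<lambda>_. borel) (\<lambda>i \<omega>. X (t (Suc i)) \<omega> - X (t i) \<omega>) {..<n}) \<and>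
     (\<forall>s t. 0 \<le> s \<and> s \<le> t \<longrightarrow>
        distr M borel (\<lambda>\<omega>. X t \<omega> - X s \<omega>) = distr M borel (X (t - s))) \<and>
     (\<forall>t\<ge>0. \<forall>q\<ge>0. (LINT \<omega>|M. exp (- q * X t \<omega>)) = exp (- t * (LINT s|\<nu>. 1 - exp (- q * s))))"

text \<open>The set below is empty only on a null event for the subordinators considered here.\<close>

definition first_passage_time :: "(real \<Rightarrow> 'w \<Rightarrow> real) \<Rightarrow> real \<Rightarrow> 'w \<Rightarrow> real" where
  "first_passage_time X b \<omega> = Inf {s. 0 < s \<and> b < X s \<omega>}"

section \<open>The decomposition of the Levy measure\<close>

definition stable_density :: "real \<Rightarrow> real \<Rightarrow> real \<Rightarrow> real" where
  "stable_density \<theta> \<alpha> s = \<theta> * (\<alpha> / Gamma (1 - \<alpha>)) * s powr (- \<alpha> - 1)"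

definition nu_trunc :: "real \<Rightarrow> real \<Rightarrow> real \<Rightarrow> real measure" where
  "nu_trunc \<theta> \<alpha> b =
     density lborel (\<lambda>s. ennreal (stable_density \<theta> \<alpha> s) * indicator {0<..b} s)"

text \<open>The sum of the restriction of the stable measure to \<open>(b, r]\<close> and of \<open>\<zeta>\<close>; used for \<open>b > 0\<close>.\<close>

definition zeta_tilde :: "real \<Rightarrow> real \<Rightarrow> ereal \<Rightarrow> real measure \<Rightarrow> real \<Rightarrow> real measure" where
  "zeta_tilde \<theta> \<alpha> r \<zeta> b = measure_of UNIV (sets borel) (\<lambda>A.
     emeasure (density lborel
       (\<lambda>s. ennreal (stable_density \<theta> \<alpha> s) * indicator {s. b < s \<and> ereal s \<le> r} s)) A
     + emeasure \<zeta> A)"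

definition Upsilon :: "real \<Rightarrow> real \<Rightarrow> ereal \<Rightarrow> real measure \<Rightarrow> real \<Rightarrow> real" where
  "Upsilon \<theta> \<alpha> r \<zeta> b = measure (zeta_tilde \<theta> \<alpha> r \<zeta> b) {0<..}"

definition exponential_law :: "real \<Rightarrow> ereal measure" where
  "exponential_law \<Upsilon> =
     (if \<Upsilon> = 0 then return borel \<infinity>
      else distr (density lborel (exponential_density \<Upsilon>)) borel ereal)"

section \<open>The sampling subroutines\<close>

text \<open>
  A randomised routine is represented by the joint law of its result and its running time (last
  component).  Result and running time of one call may be dependent; distinct calls are
  independent because they are composed by the bind of the Giry monad.
  The routine \<open>TS b\<close> returns \<open>((x', v'), cost)\<close> and \<open>WS b e\<close> returns \<open>(W, cost)\<close>.  For each level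
  \<open>b\<close>, the pair \<open>\<Omega> b\<close>, \<open>X b\<close> is the truncated stable subordinator with Levy measure
  \<open>nu_trunc \<theta> \<alpha> b\<close>.
\<close>

definition TS_A0 :: "real \<Rightarrow> real" where
  "TS_A0 \<alpha> = (1 - \<alpha>) * \<alpha> powr (\<alpha> / (1 - \<alpha>))"

definition TS_C :: "real \<Rightarrow> real \<Rightarrow> real" where
  "TS_C \<alpha> l =
     \<alpha> * Gamma (2 - \<alpha>) * TS_A0 \<alpha> /
       (Gamma (1 - \<alpha>) * (1 - \<alpha>) * (TS_A0 \<alpha> - l) powr (2 - \<alpha>)) *
     exp (Gamma (1 - \<alpha>) powr (- 1 / \<alpha>) * l powr (1 - 1 / \<alpha>) * \<alpha> * (1 - \<alpha>) powr (1 / \<alpha> - 1))"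

text \<open>
  \<open>\<CC>\<close> is the expected running time and \<open>K\<close> the constant cost of the elementary calculations
  relating it to \<open>TS_C \<alpha>\<close>.
\<close>

definition TS_sampler ::
  "real \<Rightarrow> ereal \<Rightarrow> (real \<Rightarrow> 'w measure) \<Rightarrow> (real \<Rightarrow> real \<Rightarrow> 'w \<Rightarrow> real) \<Rightarrow>
   (real \<Rightarrow> ((real \<times> real) \<times> real) measure) \<Rightarrow> real \<Rightarrow> real \<Rightarrow> bool" where
  "TS_sampler \<alpha> r \<Omega> X TS \<CC> K \<longleftrightarrow>
     TS \<in> borel \<rightarrow>\<^sub>M prob_algebra borel \<and>
     (\<forall>b. 0 < b \<and> ereal b \<le> r \<longrightarrow>
        distr (TS b) borel fst =
        distr (\<Omega> b) borel (\<lambda>\<omega>. let \<tau> = first_passage_time (X b) b \<omega> in (\<tau>, X b \<tau> \<omega>))) \<and>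
     (\<exists>R. prob_space R \<and> sets R = sets borel \<and> (AE c in R. 0 \<le> c) \<and>
        (\<forall>b. 0 < b \<and> ereal b \<le> r \<longrightarrow> distr (TS b) borel snd = R) \<and>
        (\<exists>l>0. integrable R (\<lambda>c. exp (l * c))) \<and>
        (LINT c|R. c) = \<CC>) \<and>
     (\<forall>l\<in>{0<..<TS_A0 \<alpha>}. \<CC> \<le> K * TS_C \<alpha> l)"

text \<open>The bounds on the running time of \<open>WS\<close> are uniform in the parameters \<open>b\<close> and \<open>e\<close>.\<close>

definition W_sampler ::
  "ereal \<Rightarrow> (real \<Rightarrow> 'w measure) \<Rightarrow> (real \<Rightarrow> real \<Rightarrow> 'w \<Rightarrow> real) \<Rightarrow>
   (real \<Rightarrow> real \<Rightarrow> (real \<times> real) measure) \<Rightarrow> bool" where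
  "W_sampler r \<Omega> X WS \<longleftrightarrow>
     (\<lambda>(b, e). WS b e) \<in> borel \<rightarrow>\<^sub>M prob_algebra borel \<and>
     (\<forall>b e. 0 < b \<and> ereal b \<le> r \<and> 0 < e \<longrightarrow>
        distr (WS b e) borel fst =
          distr (uniform_measure (\<Omega> b) {\<omega> \<in> space (\<Omega> b). X b e \<omega> < b}) borel (X b e) \<and>
        (AE (w, c) in WS b e. 0 \<le> c) \<and>
        (LINT (w, c)|WS b e. c) \<le> 5) \<and>
     (\<forall>p::nat. \<exists>m::real. \<forall>b e. 0 < b \<and> ereal b \<le> r \<and> 0 < e \<longrightarrow>
        (\<integral>\<^sup>+ (w, c). ennreal (c ^ p) \<partial>WS b e) \<le> ennreal m)"

section \<open>The procedures\<close>

text \<open>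
  States are triples whose last component is the running time accumulated so far.

  One passage through the loop body of the procedure with time \<open>t\<close>; the level is always
  \<open>b = t - v\<close>, and a state with \<open>t - v \<le> 0\<close> has left the loop.  Elementary operations per
  passage: generating the exponential variable, the comparison with it, the update of \<open>(x, v)\<close>
  and the update of \<open>b\<close>.  The remaining cost is that of the calls of \<open>TS\<close> and \<open>WS\<close> and the
  constant cost \<open>\<kappa>\<close> of sampling the jump.
\<close>

definition loop_body ::
  "real \<Rightarrow> real \<Rightarrow> ereal \<Rightarrow> real measure \<Rightarrow> real \<Rightarrow>
   (real \<Rightarrow> ((real \<times> real) \<times> real) measure) \<Rightarrow> (real \<Rightarrow> real \<Rightarrow> (real \<times> real) measure) \<Rightarrow>
   real \<Rightarrow> real \<times> real \<times> real \<Rightarrow> (real \<times> real \<times> real) measure" where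
  "loop_body \<theta> \<alpha> r \<zeta> \<kappa> TS WS t = (\<lambda>(x, v, c).
     if t - v \<le> 0 then return borel (x, v, c)
     else let b = t - v in do {
       e \<leftarrow> exponential_law (Upsilon \<theta> \<alpha> r \<zeta> b);
       ((x', v'), c1) \<leftarrow> TS b;
       if ereal x' < e then return borel (x + x', v + v', c + 4 + c1)
       else do {
         (w, c2) \<leftarrow> WS b (real_of_ereal e);
         j \<leftarrow> uniform_measure (zeta_tilde \<theta> \<alpha> r \<zeta> b) {0<..};
         return borel (x + real_of_ereal e, v + j + w, c + 4 + c1 + c2 + \<kappa>)
       }
     })"

text \<open>
  The law of the final state of the loop: the mass of an event is the limit of the probabilities
  that the loop has been left after \<open>n\<close> passages, in a state in that event.  A positive
  probability of looping forever shows up as missing mass.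
\<close>

definition loop_law ::
  "(real \<times> real \<times> real \<Rightarrow> (real \<times> real \<times> real) measure) \<Rightarrow> (real \<times> real \<times> real) set \<Rightarrow>
   real \<times> real \<times> real \<Rightarrow> (real \<times> real \<times> real) measure" where
  "loop_law body H s = measure_of UNIV (sets borel) (\<lambda>A.
     SUP n. emeasure (((\<lambda>\<mu>. \<mu> \<bind> body) ^^ n) (return borel s)) (A \<inter> H))"

text \<open>Two further operations: the test \<open>t \<le> r\<close> and the final subtraction.\<close>

definition procP_le ::
  "real \<Rightarrow> real \<Rightarrow> ereal \<Rightarrow> real measure \<Rightarrow> real \<Rightarrow>
   (real \<Rightarrow> ((real \<times> real) \<times> real) measure) \<Rightarrow> (real \<Rightarrow> real \<Rightarrow> (real \<times> real) measure) \<Rightarrow>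
   real \<Rightarrow> (real \<times> real \<times> real) measure" where
  "procP_le \<theta> \<alpha> r \<zeta> \<kappa> TS WS t = do {
     (x, v, c) \<leftarrow> loop_law (loop_body \<theta> \<alpha> r \<zeta> \<kappa> TS WS t) {(x, v, c). t - v \<le> 0} (0, 0, 0);
     return borel (x, v - t, c + 2)
   }"

text \<open>
  The remaining-lifetime-path procedure with single-time subroutine \<open>sub\<close>, after \<open>n\<close> time
  steps.  Elementary operations per step: the time increment \<open>d\<close>, the comparison, the difference
  of \<open>d\<close> and \<open>\<rho>\<close>, and, if the subroutine is called, the update of \<open>x\<close>.
\<close>

primrec path_proc ::
  "(real \<Rightarrow> (real \<times> real \<times> real) measure) \<Rightarrow> (nat \<Rightarrow> real) \<Rightarrow> real \<times> real \<Rightarrow> nat \<Rightarrow>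
   (real \<times> real \<times> real) measure" where
  "path_proc sub t s 0 = return borel (fst s, snd s, 0)"
| "path_proc sub t s (Suc i) = do {
     (x, \<rho>, c) \<leftarrow> path_proc sub t s i;
     let d = t (Suc i) - t i;
     if d < \<rho> then return borel (x, \<rho> - d, c + 3)
     else do {
       (l, g, c') \<leftarrow> sub (d - \<rho>);
       return borel (x + l, g, c + 4 + c')
     }
   }"

definition ceil_ratio :: "real \<Rightarrow> ereal \<Rightarrow> int" where
  "ceil_ratio t r = (if r = \<infinity> then 1 else \<lceil>t / real_of_ereal r\<rceil>)"

text \<open>For \<open>t > r\<close> the additional operations are the test and the computation of \<open>k\<close> and of the grid.\<close>

definition procP ::
  "real \<Rightarrow> real \<Rightarrow> ereal \<Rightarrow> real measure \<Rightarrow> real \<Rightarrow>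
   (real \<Rightarrow> ((real \<times> real) \<times> real) measure) \<Rightarrow> (real \<Rightarrow> real \<Rightarrow> (real \<times> real) measure) \<Rightarrow>
   real \<Rightarrow> (real \<times> real \<times> real) measure" where
  "procP \<theta> \<alpha> r \<zeta> \<kappa> TS WS t =
     (if ereal t \<le> r then procP_le \<theta> \<alpha> r \<zeta> \<kappa> TS WS t
      else let k = nat (ceil_ratio t r) in do {
        (x, \<rho>, c) \<leftarrow> path_proc (procP_le \<theta> \<alpha> r \<zeta> \<kappa> TS WS) (\<lambda>i. real i / real k * t) (0, 0) k;
        return borel (x, \<rho>, c + 2 + real k)
      })"

definition running_time :: "(real \<times> real \<times> real) measure \<Rightarrow> real measure" where
  "running_time \<mu> = distr \<mu> borel (\<lambda>(x, y, c). c)"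

text \<open>Being a probability measure means that the procedure terminates almost surely.\<close>

definition finite_moments :: "real measure \<Rightarrow> bool" where
  "finite_moments R \<longleftrightarrow> prob_space R \<and> (AE c in R. 0 \<le> c) \<and> (\<forall>p::nat. integrable R (\<lambda>c. c ^ p))"

end

theory Submission
  imports Defs
begin

text \<open>
  If a passage through the loop does not end it, the position grows by a jump smaller than the
  level \<open>b\<close>, and such jumps come from \<open>\<zeta>\<close> alone: their law is dominated by \<open>\<zeta>\<close> normalised, because
  \<open>Upsilon\<close> is at least the mass of \<open>\<zeta>\<close>.  Hence \<open>exp (t - v)\<close>, set to zero once the loop is left,
  contracts in mean by the factor \<open>\<phi> = (\<integral> exp (-s) d\<zeta>) / \<zeta>(0, \<infinity>) < 1\<close> in each passage, uniformly in \<open>\<alpha>\<close>, \<open>\<theta>\<close>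
  and \<open>r\<close>.  Moments are controlled by the submultiplicative weights \<open>(1 + c/K)\<^sup>p\<close> of the running
  time \<open>c\<close>: for large \<open>K\<close> the cost of one passage multiplies them in mean by at most \<open>1 + (1 - \<phi>)/2\<close>,
  so that the product of the weight with \<open>1 + exp (t - v)\<close> is a supermartingale.  For \<open>p = 1\<close> a
  scale \<open>K\<close> proportional to the mean cost of a passage suffices, which gives the linear bound.
\<close>

section \<open>The jump and waiting-time kernels\<close>

text \<open>The cost and the result of a call may be dependent, so the mean of weight times
  \<open>exp (t - v)\<close> does not factor over a whole passage. It factors where it must: the
  contraction comes from the jump alone, which is drawn independently of both sampler costs and has
  the fixed cost \<kappa>. Dropping the nonnegative sample \<open>w\<close> only enlarges the
  exponential, and a passage with \<open>x' < e\<close> overshoots the level, which sends the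
  exponential to 0. Both branches obey one pointwise bound, so their probabilities never have to be
  estimated.

  The price is the starting value \<open>1 + exp t\<close> of the supermartingale. Growth in t is
  genuine: if \<zeta> is a point mass, r is infinite and \<theta> is tiny, the loop climbs to t
  almost entirely by jumps of \<zeta>, so the number of passages is of order t while
  \<open>ceil_ratio\<close> stays 1. Hence the bound \<open>T\<close> in the statement. It restricts
  \<open>min t r\<close> because no single run of the loop has a target beyond that value: longer
  times are cut into pieces of length at most r.\<close>

lemma sets_zeta_tilde [simp, measurable_cong]: "sets (zeta_tilde \<theta> \<alpha> r \<zeta> b) = sets borel"
  using sets.sigma_sets_eq[of borel] by (simp add: zeta_tilde_def)

lemma space_zeta_tilde [simp]: "space (zeta_tilde \<theta> \<alpha> r \<zeta> b) = UNIV"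
  by (simp add: zeta_tilde_def)

lemma stable_density_measurable [measurable]: "stable_density \<theta> \<alpha> \<in> borel_measurable borel"
  unfolding stable_density_def by measurable

text \<open>\<open>measure_of\<close> returns the given set function only once it is known to be
  countably additive; here it is a sum of two measures.\<close>

lemma emeasure_zeta_tilde:
  assumes \<zeta>: "sets \<zeta> = sets borel" and A: "A \<in> sets borel"
  shows "emeasure (zeta_tilde \<theta> \<alpha> r \<zeta> b) A =
    emeasure (density lborel
       (\<lambda>s. ennreal (stable_density \<theta> \<alpha> s) * indicator {s. b < s \<and> ereal s \<le> r} s)) A
     + emeasure \<zeta> A"
    (is "_ = emeasure ?D A + _")
proof -
  have "countably_additive (sets borel) (\<lambda>A. emeasure ?D A + emeasure \<zeta> A)"
  proof (rule countably_additiveI)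
    fix A :: "nat \<Rightarrow> real set"
    assume A: "range A \<subseteq> sets borel" "disjoint_family A"
    show "(\<Sum>i. emeasure ?D (A i) + emeasure \<zeta> (A i)) =
        emeasure ?D (\<Union> (range A)) + emeasure \<zeta> (\<Union> (range A))"
      using A \<zeta> by (simp add: suminf_add[symmetric] suminf_emeasure)
  qed
  then show ?thesis
    unfolding zeta_tilde_def using A sets.sigma_algebra_axioms[of borel]
    by (intro emeasure_measure_of_sigma) (auto simp: positive_def)
qed

text \<open>The antiderivative is a multiple of \<open>s powr - \<alpha>\<close>, which vanishes at
  infinity for positive \<alpha>; the cut at b removes the singularity at 0.\<close>

lemma stable_tail_finite:
  assumes "0 < b" "0 < \<alpha>" "\<alpha> < 1" "0 < \<theta>"
  shows "(\<integral>\<^sup>+s. ennreal (stable_density \<theta> \<alpha> s) * indicator {b..} s \<partial>lborel) < \<infinity>"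
proof -
  define k where "k = \<theta> * (\<alpha> / Gamma (1 - \<alpha>))"
  have k: "k \<ge> 0" unfolding k_def using assms by (intro mult_nonneg_nonneg divide_nonneg_nonneg) auto
  have "((\<lambda>x. x powr - \<alpha>) \<longlongrightarrow> 0) at_top"
    using assms by (intro tendsto_neg_powr filterlim_ident) auto
  then have lim: "((\<lambda>x. - (k / \<alpha>) * x powr - \<alpha>) \<longlongrightarrow> - (k / \<alpha>) * 0) at_top"
    by (intro tendsto_mult tendsto_const)
  have dens: "stable_density \<theta> \<alpha> = (\<lambda>s. k * s powr (- \<alpha> - 1))"
    by (simp add: fun_eq_iff stable_density_def k_def)
  have "(\<integral>\<^sup>+s. ennreal (stable_density \<theta> \<alpha> s) * indicator {b..} s \<partial>lborel)
      = - (k / \<alpha>) * 0 - - (k / \<alpha>) * b powr - \<alpha>"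
    unfolding dens using assms k
    by (intro nn_integral_FTC_atLeast[OF _ _ _ lim])
       (auto intro!: derivative_eq_intros)
  then show ?thesis by simp
qed

lemma emeasure_zeta_tilde_finite:
  assumes "sets \<zeta> = sets borel" "finite_measure \<zeta>" "0 < b" "0 < \<alpha>" "\<alpha> < 1" "0 < \<theta>"
  shows "emeasure (zeta_tilde \<theta> \<alpha> r \<zeta> b) A < \<infinity>"
proof -
  interpret finite_measure \<zeta> by fact
  have m: "{s. b < s \<and> ereal s \<le> r} \<in> sets borel" by measurable
  have "emeasure (zeta_tilde \<theta> \<alpha> r \<zeta> b) A \<le> emeasure (zeta_tilde \<theta> \<alpha> r \<zeta> b) UNIV"
    by (rule emeasure_mono) auto
  also have "\<dots> = (\<integral>\<^sup>+s. ennreal (stable_density \<theta> \<alpha> s) * indicator {s. b < s \<and> ereal s \<le> r} s \<partial>lborel)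
      + emeasure \<zeta> UNIV"
    using m by (simp add: emeasure_zeta_tilde assms emeasure_density)
  also have "\<dots> \<le> (\<integral>\<^sup>+s. ennreal (stable_density \<theta> \<alpha> s) * indicator {b..} s \<partial>lborel) + emeasure \<zeta> UNIV"
    by (intro add_mono nn_integral_mono) (auto split: split_indicator)
  also have "\<dots> < \<infinity>"
    using stable_tail_finite[OF assms(3-6)] emeasure_finite[of UNIV] by (auto simp: less_top[symmetric])
  finally show ?thesis .
qed

text \<open>Written as a condition on the pair of b and s, the integrand is jointly measurable, so
  its integral over s is measurable in b.\<close>

lemma emeasure_zeta_tilde_measurable:
  assumes \<zeta>: "sets \<zeta> = sets borel" and A[measurable]: "A \<in> sets borel"
  shows "(\<lambda>b. emeasure (zeta_tilde \<theta> \<alpha> r \<zeta> b) A) \<in> borel_measurable borel"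
proof -
  have m: "{s. b < s \<and> ereal s \<le> r} \<in> sets borel" for b by measurable
  have "(\<lambda>b. emeasure (zeta_tilde \<theta> \<alpha> r \<zeta> b) A) =
     (\<lambda>b. (\<integral>\<^sup>+s. ennreal (stable_density \<theta> \<alpha> s) * (if b < s \<and> ereal s \<le> r then 1 else 0)
         * indicator A s \<partial>lborel) + emeasure \<zeta> A)"
    using m by (intro ext) (auto simp: emeasure_zeta_tilde \<zeta> emeasure_density
        intro!: disjI2 nn_integral_cong split: split_indicator)
  also have "\<dots> \<in> borel_measurable borel" by measurable
  finally show ?thesis .
qed

definition jump_law :: "real \<Rightarrow> real \<Rightarrow> ereal \<Rightarrow> real measure \<Rightarrow> real \<Rightarrow> real measure" where
  "jump_law \<theta> \<alpha> r \<zeta> b = uniform_measure (zeta_tilde \<theta> \<alpha> r \<zeta> b) {0<..}"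

lemma sets_jump_law [simp, measurable_cong]: "sets (jump_law \<theta> \<alpha> r \<zeta> b) = sets borel"
  by (simp add: jump_law_def)

lemma space_jump_law [simp]: "space (jump_law \<theta> \<alpha> r \<zeta> b) = UNIV"
  by (simp add: jump_law_def)

text \<open>The total mass is a quotient m / m in \<open>ennreal\<close>: 1 for 0 < m < \<infinity>,
  and 0 if m is 0 or \<infinity>. A kernel over all real levels also has to cover those at which
  normalisation fails.\<close>

lemma subprob_jump_law: "subprob_space (jump_law \<theta> \<alpha> r \<zeta> b)"
proof
  show "emeasure (jump_law \<theta> \<alpha> r \<zeta> b) (space (jump_law \<theta> \<alpha> r \<zeta> b)) \<le> 1"
    by (simp add: jump_law_def)
       (metis divide_ennreal_def ennreal_divide_self ennreal_divide_top ennreal_top_neq_one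
          less_top linorder_le_cases mult_zero_left order_refl zero_le)
qed simp

lemma jump_law_kernel:
  assumes "sets \<zeta> = sets borel"
  shows "jump_law \<theta> \<alpha> r \<zeta> \<in> borel \<rightarrow>\<^sub>M subprob_algebra borel"
proof (rule measurable_subprob_algebra)
  fix A :: "real set" assume A: "A \<in> sets borel"
  show "(\<lambda>b. emeasure (jump_law \<theta> \<alpha> r \<zeta> b) A) \<in> borel_measurable borel"
    unfolding jump_law_def using A
    by (simp, intro borel_measurable_divide_ennreal emeasure_zeta_tilde_measurable assms) auto
qed (auto simp: subprob_jump_law)

lemma Upsilon_measurable:
  assumes "sets \<zeta> = sets borel"
  shows "Upsilon \<theta> \<alpha> r \<zeta> \<in> borel_measurable borel"
  unfolding Upsilon_def measure_def
  using emeasure_zeta_tilde_measurable[OF assms] by measurable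

lemma Upsilon_nonneg: "0 \<le> Upsilon \<theta> \<alpha> r \<zeta> b"
  by (simp add: Upsilon_def)

section \<open>The exponential waiting time as a kernel in its rate\<close>

lemma sets_exponential_law [simp, measurable_cong]: "sets (exponential_law U) = sets borel"
  by (simp add: exponential_law_def)

lemma space_exponential_law [simp]: "space (exponential_law U) = UNIV"
  by (simp add: exponential_law_def)

lemma prob_exponential_law: "0 \<le> U \<Longrightarrow> prob_space (exponential_law U)"
  unfolding exponential_law_def
  by (auto intro!: prob_space_return prob_space.prob_space_distr prob_space_exponential_density)

text \<open>The infinite value at rate 0 excludes the jump branch exactly when there is no mass from
  which to draw a jump.\<close>

lemma AE_exponential_law:
  assumes "0 \<le> U"
  shows "AE e in exponential_law U. 0 < e \<and> (U = 0 \<longrightarrow> e = \<infinity>)"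
proof (cases "U = 0")
  case True
  have "AE e in return borel (\<infinity>::ereal). e = \<infinity>"
    by (subst AE_return) auto
  then show ?thesis
    using True unfolding exponential_law_def by (auto elim!: eventually_mono)
next
  case False
  have "AE x in lborel. x \<noteq> (0::real)" by (rule AE_lborel_singleton)
  then have "AE x in density lborel (exponential_density U). 0 < ereal x"
    by (subst AE_density) (auto simp: exponential_density_def elim!: eventually_mono)
  then have "AE e in distr (density lborel (exponential_density U)) borel ereal. 0 < e"
    by (subst AE_distr_iff) auto
  then show ?thesis
    using False unfolding exponential_law_def by auto
qed

text \<open>A negative rate gives no probability density, hence the truncation;
  \<open>Upsilon\<close> is nonnegative and is not changed by it.\<close>

lemma exponential_law_kernel: "(\<lambda>U. exponential_law (max 0 U)) \<in> borel \<rightarrow>\<^sub>M prob_algebra borel"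
proof (rule measurable_prob_algebraI)
  show "(\<lambda>U. exponential_law (max 0 U)) \<in> borel \<rightarrow>\<^sub>M subprob_algebra borel"
  proof (rule measurable_subprob_algebra)
    fix A :: "ereal set" assume A[measurable]: "A \<in> sets borel"
    have [measurable]: "ereal -` A \<in> sets borel"
      using measurable_sets[OF borel_measurable_ereal[OF measurable_ident_sets[OF refl]] A] by simp
    have "emeasure (exponential_law V) A = (if V = 0 then indicator A \<infinity> else
         \<integral>\<^sup>+x. ennreal (if x < 0 then 0 else V * exp (- x * V)) * indicator (ereal -` A) x \<partial>lborel)"
      for V
      unfolding exponential_law_def
      by (simp add: emeasure_distr emeasure_density exponential_density_def)
    then have "(\<lambda>U. emeasure (exponential_law (max 0 U)) A) =
      (\<lambda>U. if max 0 U = 0 then indicator A \<infinity> else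
         \<integral>\<^sup>+x. ennreal (if x < 0 then 0 else max 0 U * exp (- x * max 0 U)) * indicator (ereal -` A) x \<partial>lborel)"
      by (intro ext)
    also have "\<dots> \<in> borel_measurable borel" by measurable
    finally show "(\<lambda>U. emeasure (exponential_law (max 0 U)) A) \<in> borel_measurable borel" .
  qed (auto intro!: prob_space_imp_subprob_space prob_exponential_law)
qed (auto intro!: prob_exponential_law)

text \<open>Joint measurability in time and state is required because the loop is later run up to a
  random time, the increment minus the current remaining lifetime.\<close>

lemma loop_body_kernel:
  assumes \<zeta>: "sets \<zeta> = sets borel"
    and TS: "TS \<in> borel \<rightarrow>\<^sub>M prob_algebra borel"
    and WS: "(\<lambda>(b, e). WS b e) \<in> borel \<rightarrow>\<^sub>M prob_algebra borel"
  shows "(\<lambda>(t, s). loop_body \<theta> \<alpha> r \<zeta> \<kappa> TS WS t s) \<in> borel \<rightarrow>\<^sub>M subprob_algebra borel"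
proof -
  have [measurable]: "jump_law \<theta> \<alpha> r \<zeta> \<in> borel \<rightarrow>\<^sub>M subprob_algebra borel"
    using \<zeta> by (rule jump_law_kernel)
  have E[measurable]: "(\<lambda>U. exponential_law (max 0 U)) \<in> borel \<rightarrow>\<^sub>M subprob_algebra borel"
    by (rule measurable_prob_algebraD[OF exponential_law_kernel])
  have [measurable]: "Upsilon \<theta> \<alpha> r \<zeta> \<in> borel_measurable borel"
    using \<zeta> by (rule Upsilon_measurable)
  have [measurable]: "TS \<in> borel \<rightarrow>\<^sub>M subprob_algebra ((borel \<Otimes>\<^sub>M borel) \<Otimes>\<^sub>M borel)"
    using measurable_prob_algebraD[OF TS] by (simp add: borel_prod)
  have WS': "(\<lambda>x. WS (fst x) (snd x)) \<in> borel \<Otimes>\<^sub>M borel \<rightarrow>\<^sub>M subprob_algebra (borel \<Otimes>\<^sub>M borel)"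
    using measurable_prob_algebraD[OF WS] by (simp add: borel_prod case_prod_beta')
  have [measurable (raw)]: "(\<lambda>x. WS (f x) (g x)) \<in> M \<rightarrow>\<^sub>M subprob_algebra (borel \<Otimes>\<^sub>M borel)"
    if "f \<in> M \<rightarrow>\<^sub>M borel" "g \<in> M \<rightarrow>\<^sub>M borel" for f g and M :: "'b measure"
    using measurable_compose[OF measurable_Pair[OF that] WS'] by simp
  have U: "Upsilon \<theta> \<alpha> r \<zeta> b = max 0 (Upsilon \<theta> \<alpha> r \<zeta> b)" for b
    using Upsilon_nonneg by (simp add: max_def)
  \<comment> \<open>The loop body with tuples replaced by projections and the rate by its
    truncation, so that measurability can be derived structurally over the product
    sigma-algebra.\<close>
  have "(\<lambda>z::real \<times> real \<times> real \<times> real. if fst z - fst (snd (snd z)) \<le> 0 then return borel (snd z) else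
      exponential_law (max 0 (Upsilon \<theta> \<alpha> r \<zeta> (fst z - fst (snd (snd z))))) \<bind> (\<lambda>e.
      TS (fst z - fst (snd (snd z))) \<bind> (\<lambda>y.
        if ereal (fst (fst y)) < e then
          return borel (fst (snd z) + fst (fst y), fst (snd (snd z)) + snd (fst y),
             snd (snd (snd z)) + 4 + snd y)
        else WS (fst z - fst (snd (snd z))) (real_of_ereal e) \<bind> (\<lambda>u.
          jump_law \<theta> \<alpha> r \<zeta> (fst z - fst (snd (snd z))) \<bind> (\<lambda>j.
          return borel (fst (snd z) + real_of_ereal e, fst (snd (snd z)) + j + fst u,
             snd (snd (snd z)) + 4 + snd y + snd u + \<kappa>))))))
    \<in> (borel \<Otimes>\<^sub>M borel \<Otimes>\<^sub>M borel \<Otimes>\<^sub>M borel) \<rightarrow>\<^sub>M subprob_algebra (borel \<Otimes>\<^sub>M borel \<Otimes>\<^sub>M borel)"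
    unfolding borel_prod[symmetric] by measurable
  also have "?this \<longleftrightarrow> ?thesis"
    by (simp only: loop_body_def jump_law_def U[symmetric] case_prod_beta' Let_def borel_prod
        prod.collapse)
  finally show ?thesis .
qed

section \<open>The law of an absorbing loop\<close>

type_synonym state = "real \<times> real \<times> real"

lemma nonneg_pred [measurable]:
  "Measurable.pred (borel :: state measure) (\<lambda>s. 0 \<le> fst (snd s) \<and> 0 \<le> snd (snd s))"
proof -
  have "closed {s :: state. 0 \<le> fst (snd s) \<and> 0 \<le> snd (snd s)}"
    by (intro closed_Collect_conj closed_Collect_le continuous_intros)
  then show ?thesis by (simp add: pred_def borel_closed)
qed

definition loop_iter :: "(state \<Rightarrow> state measure) \<Rightarrow> nat \<Rightarrow> state \<Rightarrow> state measure" where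
  "loop_iter body n s = ((\<lambda>\<mu>. \<mu> \<bind> body) ^^ n) (return borel s)"

lemma loop_iter_0 [simp]: "loop_iter body 0 s = return borel s"
  and loop_iter_Suc [simp]: "loop_iter body (Suc n) s = loop_iter body n s \<bind> body"
  by (simp_all add: loop_iter_def)

lemma loop_iter_kernel:
  assumes K: "(\<lambda>(t, s). K t s) \<in> borel \<rightarrow>\<^sub>M subprob_algebra borel"
  shows "(\<lambda>t::real. loop_iter (K t) n s) \<in> borel \<rightarrow>\<^sub>M subprob_algebra borel"
proof (induction n)
  case (Suc n)
  show ?case
    unfolding loop_iter_Suc
    by (rule measurable_bind[OF Suc]) (use K in \<open>simp add: borel_prod case_prod_beta'\<close>)
qed (auto intro!: measurable_const simp: space_subprob_algebra prob_space_return
       prob_space_imp_subprob_space)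

text \<open>Abstract form of the loop: a kernel that leaves the states of H unchanged. Absorption
  makes the masses inside H increase with the number of passages, and so makes the supremum in
  \<open>loop_law\<close> a measure.\<close>

locale absorbing_loop =
  fixes body :: "state \<Rightarrow> state measure" and H :: "state set"
  assumes body: "body \<in> borel \<rightarrow>\<^sub>M subprob_algebra borel"
    and H: "H \<in> sets borel"
    and absorbing: "\<And>s. s \<in> H \<Longrightarrow> body s = return borel s"
begin

lemma iter_space: "loop_iter body n s \<in> space (subprob_algebra borel)"
proof -
  \<comment> \<open>A dummy real parameter, so that the kernel lemma applies to a fixed
    body.\<close>
  have "(\<lambda>(t::real, s). body s) \<in> borel \<rightarrow>\<^sub>M subprob_algebra borel"
    using measurable_compose[OF measurable_snd body, of "borel :: real measure"]
    by (simp add: borel_prod case_prod_beta')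
  from measurable_space[OF loop_iter_kernel[OF this], of 0] show ?thesis by simp
qed

lemma sets_iter [simp, measurable_cong]: "sets (loop_iter body n s) = sets borel"
  using iter_space[of n s] by (simp add: space_subprob_algebra)

lemma space_iter [simp]: "space (loop_iter body n s) = UNIV"
  using sets_eq_imp_space_eq[OF sets_iter, of n s] by simp

lemma body_iter [measurable]: "body \<in> loop_iter body n s \<rightarrow>\<^sub>M subprob_algebra borel"
  using body by (simp cong: measurable_cong_sets)

text \<open>Mass that has reached H stays where it is, so a further passage can only add to an event
  inside H.\<close>

lemma iter_mono:
  assumes [measurable]: "A \<in> sets borel"
  shows "incseq (\<lambda>n. emeasure (loop_iter body n s) (A \<inter> H))"
proof (rule incseq_SucI)
  fix n
  note H[measurable]
  have "emeasure (loop_iter body n s) (A \<inter> H) = (\<integral>\<^sup>+x. indicator (A \<inter> H) x \<partial>loop_iter body n s)"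
    by (rule nn_integral_indicator[symmetric]) simp
  also have "\<dots> \<le> (\<integral>\<^sup>+x. emeasure (body x) (A \<inter> H) \<partial>loop_iter body n s)"
    by (intro nn_integral_mono) (auto simp: absorbing split: split_indicator)
  also have "\<dots> = emeasure (loop_iter body (Suc n) s) (A \<inter> H)"
    by (simp add: emeasure_bind[OF _ body_iter])
  finally show "emeasure (loop_iter body n s) (A \<inter> H) \<le> emeasure (loop_iter body (Suc n) s) (A \<inter> H)" .
qed

lemma sets_loop_law [simp, measurable_cong]: "sets (loop_law body H s) = sets borel"
  using sets.sigma_sets_eq[of borel] by (simp add: loop_law_def)

lemma space_loop_law [simp]: "space (loop_law body H s) = UNIV"
  by (simp add: loop_law_def)

text \<open>Countable additivity survives the limit because all the sequences increase in n, which
  allows supremum and infinite sum to be exchanged.\<close>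

lemma emeasure_loop_law:
  assumes "A \<in> sets borel"
  shows "emeasure (loop_law body H s) A = (SUP n. emeasure (loop_iter body n s) (A \<inter> H))"
proof -
  have "countably_additive (sets borel) (\<lambda>A. SUP n. emeasure (loop_iter body n s) (A \<inter> H))"
  proof (rule countably_additiveI)
    fix A :: "nat \<Rightarrow> state set"
    assume A: "range A \<subseteq> sets borel" "disjoint_family A"
    have "(\<Sum>i. SUP n. emeasure (loop_iter body n s) (A i \<inter> H)) =
        (SUP n. \<Sum>i. emeasure (loop_iter body n s) (A i \<inter> H))"
      using A by (intro ennreal_suminf_SUP_eq iter_mono) auto
    also have "\<dots> = (SUP n. emeasure (loop_iter body n s) (\<Union> (range (\<lambda>i. A i \<inter> H))))"
      using A H by (intro SUP_cong refl suminf_emeasure) (auto simp: disjoint_family_on_def)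
    also have "\<Union> (range (\<lambda>i. A i \<inter> H)) = \<Union> (range A) \<inter> H" by auto
    finally show "(\<Sum>i. SUP n. emeasure (loop_iter body n s) (A i \<inter> H)) =
        (SUP n. emeasure (loop_iter body n s) (\<Union> (range A) \<inter> H))" .
  qed
  then show ?thesis
    unfolding loop_law_def loop_iter_def[symmetric] using assms sets.sigma_algebra_axioms[of borel]
    by (intro emeasure_measure_of_sigma) (auto simp: positive_def)
qed

text \<open>Extends the formula for events by induction over nonnegative functions. In the additive
  case the suprema add up because both sequences increase in n, again by absorption.\<close>

lemma nn_integral_loop_law:
  assumes "f \<in> borel_measurable borel"
  shows "(\<integral>\<^sup>+x. f x \<partial>loop_law body H s) = (SUP n. \<integral>\<^sup>+x. f x * indicator H x \<partial>loop_iter body n s)"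
proof -
  note H[measurable]
  have inc: "incseq (\<lambda>n. \<integral>\<^sup>+x. f x * indicator H x \<partial>loop_iter body n s)"
    if [measurable]: "f \<in> borel_measurable borel" for f
  proof (rule incseq_SucI)
    fix n
    have "(\<integral>\<^sup>+x. f x * indicator H x \<partial>loop_iter body n s)
        \<le> (\<integral>\<^sup>+x. \<integral>\<^sup>+y. f y * indicator H y \<partial>body x \<partial>loop_iter body n s)"
      by (intro nn_integral_mono) (auto simp: absorbing nn_integral_return split: split_indicator)
    then show "(\<integral>\<^sup>+x. f x * indicator H x \<partial>loop_iter body n s)
        \<le> (\<integral>\<^sup>+x. f x * indicator H x \<partial>loop_iter body (Suc n) s)"
      by (simp add: nn_integral_bind[OF _ body_iter])
  qed
  show "(\<integral>\<^sup>+x. f x \<partial>loop_law body H s) = (SUP n. \<integral>\<^sup>+x. f x * indicator H x \<partial>loop_iter body n s)"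
    using assms
  proof (induction rule: borel_measurable_induct)
    case (cong f g)
    then have "f = g" by (simp add: fun_eq_iff)
    with cong show ?case by simp
  next
    case (set A)
    have "(\<lambda>x. indicator A x * indicator H x :: ennreal) = indicator (A \<inter> H)"
      by (auto split: split_indicator)
    with set show ?case
      by (simp add: emeasure_loop_law)
  next
    case (mult u c)
    then have [measurable]: "u \<in> borel_measurable borel" by simp
    show ?case
      using mult.IH by (simp add: nn_integral_cmult mult.assoc SUP_mult_left_ennreal)
  next
    case (add u v)
    then have [measurable]: "u \<in> borel_measurable borel" "v \<in> borel_measurable borel" by simp_all
    show ?case
      using add.IH by (simp add: nn_integral_add distrib_right ennreal_SUP_add inc)
  next
    case (seq U)
    then have [measurable]: "U i \<in> borel_measurable borel" for i by simp
    have "(\<integral>\<^sup>+x. (SUP i. U i) x \<partial>loop_law body H s) = (SUP i. \<integral>\<^sup>+x. U i x \<partial>loop_law body H s)"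
      unfolding SUP_apply by (intro nn_integral_monotone_convergence_SUP seq) auto
    also have "\<dots> = (SUP i. SUP n. \<integral>\<^sup>+x. U i x * indicator H x \<partial>loop_iter body n s)"
      using seq by simp
    also have "\<dots> = (SUP n. SUP i. \<integral>\<^sup>+x. U i x * indicator H x \<partial>loop_iter body n s)"
      by (rule SUP_commute)
    also have "\<dots> = (SUP n. \<integral>\<^sup>+x. (SUP i. U i x * indicator H x) \<partial>loop_iter body n s)"
      using seq by (intro SUP_cong refl nn_integral_monotone_convergence_SUP[symmetric])
        (auto simp: incseq_def le_fun_def intro!: mult_right_mono)
    finally show ?case
      by (simp only: SUP_mult_right_ennreal SUP_apply)
  qed
qed

lemma nn_integral_loop_law_le:
  assumes "f \<in> borel_measurable borel"
    and "\<And>n. (\<integral>\<^sup>+x. f x * indicator H x \<partial>loop_iter body n s) \<le> B"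
  shows "(\<integral>\<^sup>+x. f x \<partial>loop_law body H s) \<le> B"
  unfolding nn_integral_loop_law[OF assms(1)] by (rule SUP_least) (rule assms(2))

text \<open>The mass of the exceptional event is a supremum of zeros, so it suffices to look at the
  exited states after each finite number of passages.\<close>

lemma AE_loop_law:
  assumes [measurable]: "Measurable.pred borel P"
    and "\<And>n. AE x in loop_iter body n s. x \<in> H \<longrightarrow> P x"
  shows "AE x in loop_law body H s. P x"
proof (rule AE_I)
  note H[measurable]
  have "emeasure (loop_iter body n s) ({x. \<not> P x} \<inter> H) = 0" for n
  proof -
    have "{x. \<not> P x} \<inter> H = {x \<in> space (loop_iter body n s). \<not> (x \<in> H \<longrightarrow> P x)}" by auto
    with AE_E2[OF assms(2)[of n]] show ?thesis by (simp only:)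
  qed
  then show "emeasure (loop_law body H s) {x. \<not> P x} = 0"
    by (subst emeasure_loop_law) simp_all
qed (use assms in auto)

text \<open>After n passages the mass not yet counted is that of the complement of H; almost sure
  termination means that it tends to 0.\<close>

lemma prob_loop_law:
  assumes "\<And>n. prob_space (loop_iter body n s)"
    and lim: "(\<lambda>n. emeasure (loop_iter body n s) (- H)) \<longlonglongrightarrow> 0"
  shows "prob_space (loop_law body H s)"
proof
  note H[measurable]
  have "emeasure (loop_iter body n s) H = 1 - emeasure (loop_iter body n s) (- H)" for n
  proof -
    interpret prob_space "loop_iter body n s" by fact
    have "emeasure (loop_iter body n s) (space (loop_iter body n s) - - H) =
        emeasure (loop_iter body n s) (space (loop_iter body n s)) - emeasure (loop_iter body n s) (- H)"
      using H by (intro emeasure_compl) auto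
    moreover have "UNIV - - H = H" by auto
    ultimately show ?thesis
      using emeasure_space_1 by (simp only: space_iter)
  qed
  moreover have "(\<lambda>n. 1 - emeasure (loop_iter body n s) (- H)) \<longlonglongrightarrow> 1 - 0"
    by (rule tendsto_diff_ennreal[OF tendsto_const lim]) auto
  ultimately have "(\<lambda>n. emeasure (loop_iter body n s) H) \<longlonglongrightarrow> 1"
    by (simp only: ennreal_minus_zero)
  moreover have "(\<lambda>n. emeasure (loop_iter body n s) H) \<longlonglongrightarrow> (SUP n. emeasure (loop_iter body n s) H)"
    using iter_mono[of UNIV s] by (intro LIMSEQ_SUP) simp
  ultimately have "(SUP n. emeasure (loop_iter body n s) H) = 1"
    using LIMSEQ_unique by blast
  then show "emeasure (loop_law body H s) (space (loop_law body H s)) = 1"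
    by (simp add: emeasure_loop_law)
qed

lemma subprob_loop_law: "subprob_space (loop_law body H s)"
proof
  have "emeasure (loop_iter body n s) H \<le> 1" for n
    using iter_space[of n s] by (auto simp: space_subprob_algebra subprob_space.subprob_emeasure_le_1)
  then show "emeasure (loop_law body H s) (space (loop_law body H s)) \<le> 1"
    by (simp add: emeasure_loop_law SUP_le_iff)
qed simp

end

text \<open>The exit set moves with t. Measurability of the mass of \<open>A \<inter> H t\<close> is
  therefore drawn from the measurable set of pairs, for each n, and the supremum over n preserves
  it.\<close>

lemma loop_law_kernel:
  fixes K :: "real \<Rightarrow> state \<Rightarrow> state measure"
  assumes K: "(\<lambda>(t, s). K t s) \<in> borel \<rightarrow>\<^sub>M subprob_algebra borel"
    and H: "{(t, s). s \<in> H t} \<in> sets borel"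
    and abs: "\<And>t s. s \<in> H t \<Longrightarrow> K t s = return borel s"
  shows "(\<lambda>t. loop_law (K t) (H t) s) \<in> borel \<rightarrow>\<^sub>M subprob_algebra borel"
proof -
  have "K t \<in> borel \<rightarrow>\<^sub>M subprob_algebra borel" for t
    using measurable_compose[OF measurable_Pair1'[of t borel borel], of "\<lambda>(t, s). K t s" "subprob_algebra borel"] K
    by (simp add: borel_prod)
  moreover have "H t \<in> sets borel" for t
  proof -
    have "Pair t -` {(t, s). s \<in> H t} \<in> sets borel"
      by (rule sets_Pair1[of _ borel]) (unfold borel_prod, rule H)
    then show ?thesis by (simp add: vimage_def)
  qed
  ultimately have loop: "absorbing_loop (K t) (H t)" for t
    using abs by (unfold_locales) auto
  show ?thesis
  proof (rule measurable_subprob_algebra)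
    fix A :: "state set" assume A: "A \<in> sets borel"
    have "(SIGMA t:space borel. A \<inter> H t) = {(t, s). s \<in> H t} \<inter> UNIV \<times> A" by auto
    also have "\<dots> \<in> sets (borel \<Otimes>\<^sub>M borel)"
      unfolding borel_prod using H A by (intro sets.Int borel_Times) auto
    finally have "(SIGMA t:space borel. A \<inter> H t) \<in> sets (borel \<Otimes>\<^sub>M borel)" .
    then have "(\<lambda>t. emeasure (loop_iter (K t) n s) (A \<inter> H t)) \<in> borel_measurable borel" for n
      by (rule emeasure_measurable_subprob_algebra2[OF _ loop_iter_kernel[OF K]])
    then show "(\<lambda>t. emeasure (loop_law (K t) (H t) s) A) \<in> borel_measurable borel"
      by (simp add: absorbing_loop.emeasure_loop_law[OF loop] A)
  qed (simp_all add: absorbing_loop.subprob_loop_law[OF loop] absorbing_loop.sets_loop_law[OF loop])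
qed

section \<open>Weights and the contraction\<close>

text \<open>One term of the exponential series, all terms being nonnegative.\<close>

lemma power_le_fact_exp:
  fixes x :: real
  assumes "0 \<le> x"
  shows "x ^ p \<le> fact p * exp x"
proof -
  have "(\<Sum>n\<in>{p}. x ^ n /\<^sub>R fact n) \<le> (\<Sum>n. x ^ n /\<^sub>R fact n)"
    using assms by (intro sum_le_suminf summable_exp_generic) auto
  then show ?thesis
    by (simp add: exp_def field_simps)
qed

text \<open>Turns one exponential moment, of whatever small order l, into moments of every order
  p.\<close>

lemma one_plus_power_le_exp:
  assumes l: "0 < l" and c: "0 \<le> (c::real)"
  shows "(1 + c) ^ p \<le> fact p * exp l / l ^ p * exp (l * c)"
proof -
  have "(l * (1 + c)) ^ p \<le> fact p * exp (l * (1 + c))"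
    using assms by (intro power_le_fact_exp) auto
  also have "\<dots> = fact p * exp l * exp (l * c)"
    by (simp add: exp_add[symmetric] algebra_simps)
  finally have "l ^ p * (1 + c) ^ p \<le> fact p * exp l * exp (l * c)"
    by (simp only: power_mult_distrib)
  then show ?thesis
    using l by (simp add: pos_le_divide_eq mult.commute[of _ "l ^ p"])
qed

text \<open>\<open>ennreal\<close> is the positive part, and the positive part is subadditive; hence
  no sign conditions.\<close>

lemma ennreal_add_le: "ennreal (a + b) \<le> ennreal a + ennreal b"
proof -
  have "ennreal (a + b) \<le> ennreal (max 0 a + max 0 b)" by (intro ennreal_leI) simp
  also have "\<dots> = ennreal (max 0 a) + ennreal (max 0 b)" by (rule ennreal_plus) auto
  also have "\<dots> = ennreal a + ennreal b" by (simp add: max_def ennreal_neg)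
  finally show ?thesis .
qed

text \<open>Truncation of \<open>ennreal\<close> at zero makes this submultiplicative on the whole real line.\<close>

definition weight :: "real \<Rightarrow> nat \<Rightarrow> real \<Rightarrow> ennreal" where
  "weight K p c = (1 + ennreal (c / K)) ^ p"

lemma weight_measurable [measurable]: "weight K p \<in> borel_measurable borel"
  unfolding weight_def by measurable

lemma weight_0 [simp]: "weight K 0 c = 1"
  and weight_zero [simp]: "weight K p 0 = 1"
  by (simp_all add: weight_def)

lemma weight_1_eq: "0 < K \<Longrightarrow> weight K 1 c = 1 + ennreal (1 / K) * ennreal c"
  by (cases "0 \<le> c") (simp_all add: weight_def ennreal_mult[symmetric] ennreal_neg divide_nonpos_pos)

lemma weight_eq: "0 \<le> c \<Longrightarrow> 0 < K \<Longrightarrow> weight K p c = ennreal ((1 + c / K) ^ p)"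
proof -
  assume "0 \<le> c" "0 < K"
  then have *: "1 + ennreal (c / K) = ennreal (1 + c / K)"
    by (subst ennreal_plus) auto
  show ?thesis
    unfolding weight_def * using \<open>0 \<le> c\<close> \<open>0 < K\<close> by (intro ennreal_power) auto
qed

lemma weight_ge_1: "1 \<le> weight K p c"
  unfolding weight_def by (rule one_le_power) simp

lemma weight_less_top: "weight K p c < \<infinity>"
  unfolding weight_def by (simp add: power_less_top_ennreal)

lemma weight_add_le: "weight K p (a + b) \<le> weight K p a * weight K p b"
proof -
  have "1 + ennreal ((a + b) / K) \<le> 1 + (ennreal (a / K) + ennreal (b / K))"
    by (intro add_left_mono) (simp add: add_divide_distrib ennreal_add_le)
  also have "\<dots> \<le> (1 + ennreal (a / K)) * (1 + ennreal (b / K))"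
    by (simp add: algebra_simps)
  finally show ?thesis
    unfolding weight_def power_mult_distrib[symmetric] by (intro power_mono) auto
qed

lemma weight_mono: "0 < K \<Longrightarrow> a \<le> b \<Longrightarrow> weight K p a \<le> weight K p b"
  unfolding weight_def by (intro power_mono add_left_mono ennreal_leI divide_right_mono) auto

text \<open>Convexity of the p-th power: c / K lies between 0 and c, and the value there is below
  the chord. The chord bound has \<open>(1 + c) ^ p - 1\<close> in the numerator, and this sharper
  form is what the induction carries.\<close>

lemma power_le_convex:
  fixes c K :: real
  assumes "0 \<le> c" "1 \<le> K"
  shows "(1 + c / K) ^ p \<le> 1 + (1 + c) ^ p / K"
proof -
  have "(1 + c / K) ^ p \<le> 1 + ((1 + c) ^ p - 1) / K"
  proof (induction p)
    case (Suc p)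
    have one: "1 \<le> (1 + c) ^ p" using assms by (simp add: one_le_power)
    have "(1 + c / K) ^ Suc p \<le> (1 + c / K) * (1 + ((1 + c) ^ p - 1) / K)"
      using assms Suc by (simp add: mult_left_mono)
    also have "\<dots> = 1 + (c + ((1 + c) ^ p - 1) + c * ((1 + c) ^ p - 1) / K) / K"
      using assms by (simp add: field_simps)
    also have "\<dots> \<le> 1 + (c + ((1 + c) ^ p - 1) + c * ((1 + c) ^ p - 1)) / K"
    proof -
      have "c * ((1 + c) ^ p - 1) / K \<le> c * ((1 + c) ^ p - 1) / 1"
        using assms one by (intro divide_left_mono) auto
      then show ?thesis using assms by (intro add_left_mono divide_right_mono) auto
    qed
    also have "\<dots> = 1 + ((1 + c) ^ Suc p - 1) / K" by (simp add: algebra_simps)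
    finally show ?case .
  qed simp
  also have "\<dots> \<le> 1 + (1 + c) ^ p / K"
    using assms by (simp add: diff_divide_distrib)
  finally show ?thesis .
qed

text \<open>Brings the mean of the weight as close to 1 as desired: with the moment at scale 1
  fixed, its excess over 1 is of order 1 / K.\<close>

lemma weight_le:
  assumes "1 \<le> K"
  shows "weight K p c \<le> 1 + ennreal (1 / K) * weight 1 p c"
proof -
  have c: "weight L p c = ennreal ((1 + max 0 c / L) ^ p)" if "1 \<le> L" for L
  proof -
    have "ennreal (c / L) = ennreal (max 0 c / L)"
      using that by (simp add: max_def ennreal_neg divide_nonpos_pos)
    then have *: "1 + ennreal (c / L) = ennreal (1 + max 0 c / L)"
      using that by (subst ennreal_plus) auto
    show ?thesis
      unfolding weight_def * using that by (intro ennreal_power) auto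
  qed
  have "(1 + max 0 c / K) ^ p \<le> 1 + 1 / K * (1 + max 0 c / 1) ^ p"
    using power_le_convex[of "max 0 c" K p] assms by simp
  then have "ennreal ((1 + max 0 c / K) ^ p) \<le> ennreal (1 + 1 / K * (1 + max 0 c / 1) ^ p)"
    by (rule ennreal_leI)
  also have "\<dots> = 1 + ennreal (1 / K) * ennreal ((1 + max 0 c / 1) ^ p)"
    using assms by (subst ennreal_plus) (auto simp: ennreal_mult[symmetric])
  finally show ?thesis by (simp add: c assms)
qed

text \<open>At least 1 while the loop runs, so its mean dominates the probability of still running.
  The exponential form makes a jump act as a factor that does not depend on the current
  level.\<close>

definition lyap :: "real \<Rightarrow> real \<Rightarrow> ennreal" where
  "lyap t v = (if v < t then ennreal (exp (t - v)) else 0)"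

lemma lyap_measurable [measurable]: "lyap t \<in> borel_measurable borel"
  unfolding lyap_def by measurable

lemma lyap_ge_1: "v < t \<Longrightarrow> 1 \<le> lyap t v"
  unfolding lyap_def by (simp add: ennreal_le_iff2 flip: ennreal_1)

text \<open>The Laplace transform at 1 of \<zeta> normalised. For \<zeta> = 0 division by zero
  yields 0, which is a legitimate contraction factor: no jump below the level can occur
  then.\<close>

definition contraction :: "real measure \<Rightarrow> real" where
  "contraction \<zeta> = (LINT s|\<zeta>. exp (- s)) / measure \<zeta> UNIV"

context
  fixes \<zeta> :: "real measure"
  assumes \<zeta>: "sets \<zeta> = sets borel" "finite_measure \<zeta>" "emeasure \<zeta> {..0} = 0"
begin

lemma AE_pos: "AE s in \<zeta>. 0 < s"
  using \<zeta> by (intro AE_I[of _ _ "{..0}"]) (auto simp: not_less)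

lemma integrable_exp_minus: "integrable \<zeta> (\<lambda>s. exp (- s))"
proof -
  interpret finite_measure \<zeta> by (rule \<zeta>)
  have [measurable_cong]: "sets \<zeta> = sets borel" by (rule \<zeta>)
  show ?thesis
    by (rule integrable_const_bound[of _ 1]) (use AE_pos in \<open>auto elim: eventually_mono\<close>)
qed

lemma contraction_nonneg: "0 \<le> contraction \<zeta>"
  unfolding contraction_def by (intro divide_nonneg_nonneg integral_nonneg_AE) auto

text \<open>Since \<zeta> charges only positive reals, the integrand is below 1 almost everywhere,
  and the inequality stays strict after integration against a nonzero measure.\<close>

lemma contraction_less_1: "contraction \<zeta> < 1"
proof (cases "measure \<zeta> UNIV = 0")
  case False
  interpret finite_measure \<zeta> by (rule \<zeta>)
  have sp: "space \<zeta> = UNIV" using sets_eq_imp_space_eq[OF \<zeta>(1)] by simp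
  have "(LINT s|\<zeta>. exp (- s)) < (LINT s|\<zeta>. 1)"
  proof (rule integral_less_AE_space[OF integrable_exp_minus])
    show "emeasure \<zeta> (space \<zeta>) \<noteq> 0" using False by (simp add: sp emeasure_eq_measure)
    show "AE s in \<zeta>. exp (- s) < 1" using AE_pos by (auto elim: eventually_mono)
  qed simp
  then show ?thesis
    using False by (simp add: contraction_def sp divide_less_eq_1 zero_less_measure_iff)
qed (simp add: contraction_def)

lemma nn_integral_exp_minus:
  "(\<integral>\<^sup>+s. ennreal (exp (- s)) \<partial>\<zeta>) = ennreal (contraction \<zeta>) * emeasure \<zeta> UNIV"
proof -
  interpret finite_measure \<zeta> by (rule \<zeta>)
  have sp: "space \<zeta> = UNIV" using sets_eq_imp_space_eq[OF \<zeta>(1)] by simp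
  have "(\<integral>\<^sup>+s. ennreal (exp (- s)) \<partial>\<zeta>) = ennreal (LINT s|\<zeta>. exp (- s))"
    by (rule nn_integral_eq_integral[OF integrable_exp_minus]) auto
  also have "(LINT s|\<zeta>. exp (- s)) = contraction \<zeta> * measure \<zeta> UNIV"
  proof (cases "measure \<zeta> UNIV = 0")
    case True
    then have "AE s in \<zeta>. False"
      by (intro AE_I[of _ _ UNIV]) (auto simp: emeasure_eq_measure \<zeta>)
    then have "(LINT s|\<zeta>. exp (- s)) = (LINT s|\<zeta>. 0)"
      using \<zeta>(1) by (intro integral_cong_AE) (auto cong: measurable_cong_sets)
    with True show ?thesis by simp
  qed (simp add: contraction_def)
  finally show ?thesis
    by (simp add: ennreal_mult contraction_nonneg emeasure_eq_measure)
qed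

lemma jump_law_prob:
  assumes "0 < b" "0 < \<alpha>" "\<alpha> < 1" "0 < \<theta>" "Upsilon \<theta> \<alpha> r \<zeta> b \<noteq> 0"
  shows "prob_space (jump_law \<theta> \<alpha> r \<zeta> b)"
  unfolding jump_law_def
proof (rule prob_space_uniform_measure)
  show "emeasure (zeta_tilde \<theta> \<alpha> r \<zeta> b) {0<..} \<noteq> 0"
    using assms by (auto simp: Upsilon_def measure_def)
  show "emeasure (zeta_tilde \<theta> \<alpha> r \<zeta> b) {0<..} \<noteq> \<infinity>"
    using emeasure_zeta_tilde_finite[OF \<zeta>(1,2) assms(1-4), of r "{0<..}"] by simp
qed

lemma AE_jump_law: "AE j in jump_law \<theta> \<alpha> r \<zeta> b. 0 < j"
  unfolding jump_law_def by (rule AE_uniform_measureI) auto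

text \<open>
  Jumps not exceeding \<open>b\<close> come from \<open>\<zeta>\<close> only, and with the total mass of \<open>\<zeta>\<close> in place of
  \<open>Upsilon\<close> their law increases.  This is where the bound becomes independent of the stable part.
\<close>

lemma jump_law_contraction:
  assumes b: "0 < b" and \<alpha>: "0 < \<alpha>" "\<alpha> < 1" "0 < \<theta>" and U: "Upsilon \<theta> \<alpha> r \<zeta> b \<noteq> 0"
  shows "(\<integral>\<^sup>+j. ennreal (exp (- j)) * indicator {..<b} j \<partial>jump_law \<theta> \<alpha> r \<zeta> b) \<le> ennreal (contraction \<zeta>)"
proof -
  let ?Z = "zeta_tilde \<theta> \<alpha> r \<zeta> b"
  interpret finite_measure \<zeta> by (rule \<zeta>)
  have [measurable_cong]: "sets \<zeta> = sets borel" by (rule \<zeta>)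
  have sp: "space \<zeta> = UNIV" using sets_eq_imp_space_eq[OF \<zeta>(1)] by simp
  \<comment> \<open>The stable part of the measure lives on (b, r], so strictly below b only \<zeta>
    is left.\<close>
  have restr: "density ?Z (indicator {..<b}) = density \<zeta> (indicator {..<b})"
  proof (rule measure_eqI)
    fix A assume "A \<in> sets (density ?Z (indicator {..<b}))"
    then have A[measurable]: "A \<in> sets borel" by simp
    have m: "{s. b < s \<and> ereal s \<le> r} \<in> sets borel" by measurable
    have "(\<integral>\<^sup>+s. ennreal (stable_density \<theta> \<alpha> s) * indicator {s. b < s \<and> ereal s \<le> r} s
        * indicator ({..<b} \<inter> A) s \<partial>lborel) = (\<integral>\<^sup>+s. 0 \<partial>(lborel :: real measure))"
      by (intro nn_integral_cong) (auto split: split_indicator)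
    then have "emeasure ?Z ({..<b} \<inter> A) = emeasure \<zeta> ({..<b} \<inter> A)"
      using m by (simp add: emeasure_zeta_tilde \<zeta> emeasure_density)
    moreover have "emeasure (density M (indicator {..<b})) A = emeasure M ({..<b} \<inter> A)"
      if [measurable_cong]: "sets M = sets borel" for M
    proof -
      have "emeasure (density M (indicator {..<b})) A = (\<integral>\<^sup>+x. indicator {..<b} x * indicator A x \<partial>M)"
        by (rule emeasure_density) (auto simp: that)
      also have "\<dots> = (\<integral>\<^sup>+x. indicator ({..<b} \<inter> A) x \<partial>M)"
        by (intro nn_integral_cong) (auto split: split_indicator)
      finally show ?thesis by (simp add: that)
    qed
    ultimately show "emeasure (density ?Z (indicator {..<b})) A = emeasure (density \<zeta> (indicator {..<b})) A"
      using \<zeta> by simp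
  qed (simp add: \<zeta>)
  have pos: "emeasure ?Z {0<..} \<noteq> 0" using U by (auto simp: Upsilon_def measure_def)
  have fin: "emeasure ?Z {0<..} < \<infinity>" by (rule emeasure_zeta_tilde_finite[OF \<zeta>(1,2) b \<alpha>])
  have mass: "emeasure \<zeta> UNIV \<le> emeasure ?Z {0<..}"
  proof -
    have "emeasure \<zeta> UNIV = emeasure \<zeta> {0<..}"
      using AE_pos by (intro emeasure_eq_AE) (auto simp: \<zeta> elim: eventually_mono)
    also have "\<dots> \<le> emeasure ?Z {0<..}" by (simp add: emeasure_zeta_tilde \<zeta>)
    finally show ?thesis .
  qed
  have "(\<integral>\<^sup>+j. ennreal (exp (- j)) * indicator {..<b} j * indicator {0<..} j \<partial>?Z)
      \<le> (\<integral>\<^sup>+j. indicator {..<b} j * ennreal (exp (- j)) \<partial>?Z)"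
    by (intro nn_integral_mono) (auto split: split_indicator)
  also have "\<dots> = (\<integral>\<^sup>+j. ennreal (exp (- j)) \<partial>density ?Z (indicator {..<b}))"
    by (rule nn_integral_density[symmetric]) auto
  also have "\<dots> = (\<integral>\<^sup>+j. indicator {..<b} j * ennreal (exp (- j)) \<partial>\<zeta>)"
    unfolding restr by (rule nn_integral_density) auto
  also have "\<dots> \<le> (\<integral>\<^sup>+s. ennreal (exp (- s)) \<partial>\<zeta>)"
    by (intro nn_integral_mono) (auto split: split_indicator)
  also have "\<dots> \<le> ennreal (contraction \<zeta>) * emeasure ?Z {0<..}"
    unfolding nn_integral_exp_minus by (rule mult_left_mono[OF mass]) simp
  finally have "(\<integral>\<^sup>+j. ennreal (exp (- j)) * indicator {..<b} j * indicator {0<..} j \<partial>?Z)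
      / emeasure ?Z {0<..} \<le> ennreal (contraction \<zeta>) * emeasure ?Z {0<..} / emeasure ?Z {0<..}"
    by (rule divide_right_mono_ennreal)
  also have "\<dots> = ennreal (contraction \<zeta>)"
    using pos fin by (simp add: ennreal_mult_divide_eq)
  finally show ?thesis
    unfolding jump_law_def by (subst nn_integral_uniform_measure) auto
qed

end

section \<open>First passage of subordinators\<close>

text \<open>On the event that the path stays below b, \<open>exp (- q * X n)\<close> is at least
  \<open>exp (- q * b)\<close> at every positive integer n, while its mean decays like
  \<open>exp (- n * \<psi>)\<close> for the positive Laplace exponent \<psi>.\<close>

lemma driftless_subordinator_unbounded:
  assumes X: "driftless_subordinator M X \<nu>" and \<nu>: "\<exists>q\<ge>0. 0 < (LINT s|\<nu>. 1 - exp (- q * s))"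
  shows "AE \<omega> in M. \<exists>s>0. b < X s \<omega>"
proof -
  interpret prob_space M using X by (simp add: driftless_subordinator_def)
  have X_meas[measurable]: "X (real n) \<in> borel_measurable M" for n
    using X by (simp add: driftless_subordinator_def)
  from \<nu> obtain q where q: "0 \<le> q" and \<psi>: "0 < (LINT s|\<nu>. 1 - exp (- q * s))" (is "0 < ?\<psi>")
    by blast
  define B where "B = {\<omega> \<in> space M. \<forall>n::nat. X (real (Suc n)) \<omega> \<le> b}"
  have B[measurable]: "B \<in> sets M" unfolding B_def using X_meas by measurable
  have bound: "measure M B \<le> exp (q * b) * exp (- real (Suc n) * ?\<psi>)" for n
  proof -
    have Xn: "0 \<le> X (real (Suc n)) \<omega>" if "\<omega> \<in> space M" for \<omega>
      using X that unfolding driftless_subordinator_def mono_on_def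
      by (metis atLeast_iff of_nat_0_le_iff order_refl)
    have int: "integrable M (\<lambda>\<omega>. exp (- q * X (real (Suc n)) \<omega>))"
      using q Xn by (intro integrable_const_bound[of _ 1]) (auto simp del: of_nat_Suc)
    have "measure M B = (LINT \<omega>|M. indicator B \<omega>)" by simp
    also have "\<dots> \<le> (LINT \<omega>|M. exp (q * b) * exp (- q * X (real (Suc n)) \<omega>))"
    proof (rule integral_mono)
      show "indicator B \<omega> \<le> exp (q * b) * exp (- q * X (real (Suc n)) \<omega>)" for \<omega>
        using q by (auto simp: B_def exp_add[symmetric] mult_left_mono split: split_indicator)
    qed (use int in \<open>auto intro!: integrable_real_indicator simp: less_top[symmetric]\<close>)
    also have "\<dots> = exp (q * b) * exp (- real (Suc n) * ?\<psi>)"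
      using X q unfolding driftless_subordinator_def by (simp add: algebra_simps)
    finally show ?thesis .
  qed
  have "(\<lambda>n. exp (q * b) * exp (- real (Suc n) * ?\<psi>)) \<longlonglongrightarrow> 0"
  proof -
    have "(\<lambda>n. exp (- ?\<psi>) ^ Suc n) \<longlonglongrightarrow> 0"
      using \<psi> by (intro LIMSEQ_Suc LIMSEQ_power_zero) simp
    moreover have "exp (- ?\<psi>) ^ Suc n = exp (- real (Suc n) * ?\<psi>)" for n
      by (simp only: exp_of_nat_mult[symmetric] mult_minus_left mult_minus_right)
    ultimately have "(\<lambda>n. exp (- real (Suc n) * ?\<psi>)) \<longlonglongrightarrow> 0" by (simp only:)
    then show ?thesis by (rule tendsto_mult_right_zero)
  qed
  then have "measure M B \<le> 0"
    by (rule LIMSEQ_le_const) (use bound in auto)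
  then have "emeasure M B = 0"
    by (simp add: emeasure_eq_measure measure_le_0_iff)
  moreover have "{\<omega> \<in> space M. \<not> (\<exists>s>0. b < X s \<omega>)} \<subseteq> B"
  proof (intro subsetI)
    fix \<omega> assume \<omega>: "\<omega> \<in> {\<omega> \<in> space M. \<not> (\<exists>s>0. b < X s \<omega>)}"
    have "X (real (Suc n)) \<omega> \<le> b" for n
    proof -
      have "0 < real (Suc n)" by simp
      with \<omega> have "\<not> b < X (real (Suc n)) \<omega>" by blast
      then show ?thesis by (simp only: not_less)
    qed
    with \<omega> show "\<omega> \<in> B" by (simp add: B_def)
  qed
  ultimately show ?thesis
    using B by (intro AE_I)
qed

text \<open>By right continuity, a value below b at the infimum would persist on an interval to its
  right, where the set must have a point. The witness s matters: \<open>Inf\<close> of the empty set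
  carries no information.\<close>

lemma at_first_passage_time:
  assumes X: "driftless_subordinator M X \<nu>" and \<omega>: "\<omega> \<in> space M" and s: "0 < s" "b < X s \<omega>"
  shows "b \<le> X (first_passage_time X b \<omega>) \<omega>"
proof (rule ccontr)
  let ?S = "{s. 0 < s \<and> b < X s \<omega>}" and ?\<tau> = "first_passage_time X b \<omega>"
  assume "\<not> b \<le> X ?\<tau> \<omega>"
  then have less: "X ?\<tau> \<omega> < b" by simp
  have ne: "?S \<noteq> {}" and bdd: "bdd_below ?S"
    using s by (auto intro!: bdd_belowI[of _ 0])
  have \<tau>: "0 \<le> ?\<tau>"
    unfolding first_passage_time_def using ne by (rule cInf_greatest) auto
  have "continuous (at_right ?\<tau>) (\<lambda>u. X u \<omega>)"
    using X \<omega> \<tau> by (simp add: driftless_subordinator_def)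
  then have "((\<lambda>u. X u \<omega>) \<longlongrightarrow> X ?\<tau> \<omega>) (at_right ?\<tau>)"
    by (simp add: continuous_within)
  from order_tendstoD(2)[OF this less] obtain u where u: "?\<tau> < u" "\<And>y. ?\<tau> < y \<Longrightarrow> y < u \<Longrightarrow> X y \<omega> < b"
    by (auto simp: eventually_at_right_field)
  from u(1) ne bdd obtain y where y: "y \<in> ?S" "y < u"
    unfolding first_passage_time_def by (auto simp: cInf_less_iff)
  moreover have "?\<tau> \<le> y"
    unfolding first_passage_time_def using y bdd by (auto intro: cInf_lower)
  ultimately show False
    using u(2)[of y] less by (cases "y = ?\<tau>") auto
qed

text \<open>The integrand lies below \<open>min 1 s\<close>, hence is integrable by the Levy
  condition, and it is positive on (0, b]. If the integral vanished, this interval would be Lebesgue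
  null.\<close>

lemma nu_trunc_exponent_pos:
  assumes "0 < b" "0 < \<alpha>" "\<alpha> < 1" "0 < \<theta>" and \<nu>: "levy_measure_subordinator (nu_trunc \<theta> \<alpha> b)"
  shows "0 < (LINT s|nu_trunc \<theta> \<alpha> b. 1 - exp (- 1 * s))"
proof -
  let ?\<nu> = "nu_trunc \<theta> \<alpha> b"
  have sets[measurable_cong, simp]: "sets ?\<nu> = sets borel" and sp[simp]: "space ?\<nu> = UNIV"
    by (simp_all add: nu_trunc_def)
  have dens: "ennreal (stable_density \<theta> \<alpha> s) \<noteq> 0" if "0 < s" for s
  proof -
    have "0 < stable_density \<theta> \<alpha> s"
      using assms that unfolding stable_density_def by (intro mult_pos_pos divide_pos_pos) auto
    then show ?thesis by simp
  qed
  have pos: "AE s in ?\<nu>. 0 < s"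
    unfolding nu_trunc_def by (subst AE_density) (auto split: split_indicator)
  have bd: "norm (1 - exp (- 1 * s)) \<le> min 1 s" if "0 < s" for s :: real
  proof -
    have "1 + - s \<le> exp (- s)" by (rule exp_ge_add_one_self)
    then have "1 - exp (- s) \<le> s" by linarith
    then show ?thesis using that by simp
  qed
  have int: "integrable ?\<nu> (\<lambda>s. 1 - exp (- 1 * s))"
  proof (rule integrableI_bounded)
    have "(\<integral>\<^sup>+ s. ennreal (norm (1 - exp (- 1 * s))) \<partial>?\<nu>) \<le> (\<integral>\<^sup>+ s. ennreal (min 1 s) \<partial>?\<nu>)"
      using pos by (intro nn_integral_mono_AE, eventually_elim) (rule ennreal_leI[OF bd])
    also have "\<dots> < \<infinity>" using \<nu> by (simp add: levy_measure_subordinator_def)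
    finally show "(\<integral>\<^sup>+ s. ennreal (norm (1 - exp (- 1 * s))) \<partial>?\<nu>) < \<infinity>" .
  qed measurable
  have nn: "AE s in ?\<nu>. 0 \<le> 1 - exp (- 1 * s)"
    using pos by (auto elim: eventually_mono)
  have "(LINT s|?\<nu>. 1 - exp (- 1 * s)) \<noteq> 0"
  proof
    assume "(LINT s|?\<nu>. 1 - exp (- 1 * s)) = 0"
    then have "AE s in ?\<nu>. 1 - exp (- 1 * s) = 0"
      by (simp only: integral_nonneg_eq_0_iff_AE[OF int nn])
    with pos have "AE s in ?\<nu>. False" by eventually_elim simp
    then have "AE s in lborel. s \<notin> {0<..b}"
      unfolding nu_trunc_def
      by (subst (asm) AE_density) (auto elim!: eventually_mono simp: dens split: split_indicator)
    then have "emeasure lborel {0<..b} = 0"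
    proof -
      have "{s \<in> space lborel. \<not> s \<notin> {0<..b}} = {0<..b}" by auto
      with AE_E2[OF \<open>AE s in lborel. s \<notin> {0<..b}\<close>] show ?thesis by (simp only:)
    qed
    with \<open>0 < b\<close> show False by simp
  qed
  with integral_nonneg_AE[OF nn] show ?thesis by simp
qed

section \<open>The samplers\<close>

locale samplers =
  fixes \<zeta> :: "real measure" and \<kappa> \<alpha> \<theta> :: real and r :: ereal
    and \<Omega> :: "real \<Rightarrow> 'w measure" and X :: "real \<Rightarrow> real \<Rightarrow> 'w \<Rightarrow> real"
    and TS :: "real \<Rightarrow> ((real \<times> real) \<times> real) measure"
    and WS :: "real \<Rightarrow> real \<Rightarrow> (real \<times> real) measure" and \<CC> K\<^sub>T :: real
  assumes \<zeta>: "sets \<zeta> = sets borel" "finite_measure \<zeta>" "emeasure \<zeta> {..0} = 0"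
    and \<kappa>: "0 \<le> \<kappa>" and \<alpha>: "0 < \<alpha>" "\<alpha> < 1" and \<theta>: "0 < \<theta>"
    and X: "\<And>b. 0 < b \<Longrightarrow> ereal b \<le> r \<Longrightarrow> driftless_subordinator (\<Omega> b) (X b) (nu_trunc \<theta> \<alpha> b)"
    and TS: "TS_sampler \<alpha> r \<Omega> X TS \<CC> K\<^sub>T" and WS: "W_sampler r \<Omega> X WS"
begin

abbreviation (input) body :: "real \<Rightarrow> state \<Rightarrow> state measure" where
  "body t \<equiv> loop_body \<theta> \<alpha> r \<zeta> \<kappa> TS WS t"

lemma TS_kernel: "TS \<in> borel \<rightarrow>\<^sub>M prob_algebra borel"
  using TS by (simp add: TS_sampler_def)

lemma WS_kernel: "(\<lambda>(b, e). WS b e) \<in> borel \<rightarrow>\<^sub>M prob_algebra borel"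
  using WS by (simp add: W_sampler_def)

lemma prob_TS: "prob_space (TS b)" and sets_TS [simp, measurable_cong]: "sets (TS b) = sets borel"
  using measurable_space[OF TS_kernel, of b] by (simp_all add: space_prob_algebra)

lemma prob_WS: "prob_space (WS b e)" and sets_WS [simp, measurable_cong]: "sets (WS b e) = sets borel"
  using measurable_space[OF WS_kernel, of "(b, e)"] by (simp_all add: space_prob_algebra)

lemma space_TS [simp]: "space (TS b) = UNIV" and space_WS [simp]: "space (WS b e) = UNIV"
  using sets_eq_imp_space_eq[OF sets_TS] sets_eq_imp_space_eq[OF sets_WS] by simp_all

text \<open>This makes a passage with \<open>x' < e\<close> the last one. The path is at or above
  the level at its first passage time, and the property reaches the sample through equality in
  law.\<close>

lemma TS_overshoot:
  assumes b: "0 < b" "ereal b \<le> r"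
  shows "AE y in TS b. b \<le> snd (fst y)"
proof -
  note D = X[OF b]
  interpret P: prob_space "\<Omega> b" using D by (simp add: driftless_subordinator_def)
  define f where "f = (\<lambda>\<omega>. let \<tau> = first_passage_time (X b) b \<omega> in (\<tau>, X b \<tau> \<omega>))"
  let ?A = "{q. snd q < b} :: (real \<times> real) set"
  have A: "?A \<in> sets borel"
    by (intro borel_open open_Collect_less continuous_intros)
  have "AE \<omega> in \<Omega> b. \<exists>s>0. b < X b s \<omega>"
    using nu_trunc_exponent_pos[OF b(1) \<alpha> \<theta>] D
    by (intro driftless_subordinator_unbounded[OF D]) (auto simp: driftless_subordinator_def intro!: exI[of _ 1])
  then obtain N where N: "{\<omega> \<in> space (\<Omega> b). \<not> (\<exists>s>0. b < X b s \<omega>)} \<subseteq> N" "emeasure (\<Omega> b) N = 0" "N \<in> sets (\<Omega> b)"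
    by (rule AE_E)
  have "f -` ?A \<inter> space (\<Omega> b) \<subseteq> N"
    using at_first_passage_time[OF D] N(1) by (force simp: f_def Let_def)
  then have "emeasure (\<Omega> b) (f -` ?A \<inter> space (\<Omega> b)) = 0"
    by (rule emeasure_eq_0[OF N(3,2)])
  \<comment> \<open>No measurability of \<open>f\<close> is needed: if \<open>distr\<close> is not built from a measure, it is the zero measure.\<close>
  then have "emeasure (distr (\<Omega> b) borel f) ?A = 0"
    unfolding distr_def emeasure_measure_of_conv by simp
  moreover have "distr (TS b) borel fst = distr (\<Omega> b) borel f"
    using TS b unfolding TS_sampler_def f_def by blast
  ultimately have "emeasure (distr (TS b) borel fst) ?A = 0" by simp
  then have "AE q in distr (TS b) borel fst. \<not> snd q < b"
    using A by (intro AE_I[of _ _ ?A]) auto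
  moreover have "fst \<in> TS b \<rightarrow>\<^sub>M borel"
    by (simp add: measurable_cong_sets[OF sets_TS refl] flip: borel_prod)
  moreover have "{q \<in> space borel. \<not> snd q < b} \<in> sets (borel :: (real \<times> real) measure)"
    using borel_comp[OF A] by (simp add: Collect_neg_eq del: not_less)
  ultimately show ?thesis
    by (subst (asm) AE_distr_iff) auto
qed

lemma snd_TS [measurable]: "snd \<in> borel_measurable (TS b)"
  and fst_TS [measurable]: "fst \<in> borel_measurable (TS b)"
  by (simp_all add: measurable_cong_sets[OF sets_TS refl] flip: borel_prod)

lemma snd_WS [measurable]: "snd \<in> borel_measurable (WS b e)"
  and fst_WS [measurable]: "fst \<in> borel_measurable (WS b e)"
  by (simp_all add: measurable_cong_sets[OF sets_WS refl] flip: borel_prod)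

lemma TS_cost:
  obtains R where "prob_space R" "sets R = sets borel" "AE c in R. 0 \<le> c"
    "\<And>b. 0 < b \<Longrightarrow> ereal b \<le> r \<Longrightarrow> distr (TS b) borel snd = R"
    "\<exists>l>0. integrable R (\<lambda>c. exp (l * c))" "(LINT c|R. c) = \<CC>"
  using TS unfolding TS_sampler_def by blast

lemma nn_integral_TS_cost:
  assumes "f \<in> borel_measurable borel" "distr (TS b) borel snd = R"
  shows "(\<integral>\<^sup>+y. f (snd y) \<partial>TS b) = (\<integral>\<^sup>+c. f c \<partial>R)"
  unfolding assms(2)[symmetric] using assms(1) by (subst nn_integral_distr) auto

lemma TS_cost_nonneg:
  assumes b: "0 < b" "ereal b \<le> r"
  shows "AE y in TS b. 0 \<le> snd y"
proof -
  obtain R where R: "AE c in R. 0 \<le> c" "distr (TS b) borel snd = R"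
    using TS_cost b by metis
  then have "AE c in distr (TS b) borel snd. 0 \<le> c" by (simp only:)
  then show ?thesis by (subst (asm) AE_distr_iff) auto
qed

text \<open>Uniform in b because all levels share one cost law, whose exponential moment dominates
  every power.\<close>

lemma TS_weight: "\<exists>D\<ge>1. \<forall>b. 0 < b \<and> ereal b \<le> r \<longrightarrow> (\<integral>\<^sup>+y. weight 1 p (snd y) \<partial>TS b) \<le> ennreal D"
proof -
  obtain R l where R: "sets R = sets borel" "AE c in R. 0 \<le> c"
    "\<And>b. 0 < b \<Longrightarrow> ereal b \<le> r \<Longrightarrow> distr (TS b) borel snd = R"
    and l: "0 < l" "integrable R (\<lambda>c. exp (l * c))"
    using TS_cost by metis
  have [measurable_cong]: "sets R = sets borel" by (rule R)
  define B where "B = fact p * exp l / l ^ p"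
  define D where "D = max 1 (LINT c|R. B * exp (l * c))"
  have "(\<integral>\<^sup>+c. weight 1 p c \<partial>R) \<le> (\<integral>\<^sup>+c. ennreal (B * exp (l * c)) \<partial>R)"
    using R(2)
  proof (intro nn_integral_mono_AE, eventually_elim)
    case (elim c)
    have "ennreal ((1 + c / 1) ^ p) \<le> ennreal (B * exp (l * c))"
      unfolding div_by_1 B_def by (intro ennreal_leI one_plus_power_le_exp l \<open>0 \<le> c\<close>)
    then show ?case by (simp only: weight_eq[OF \<open>0 \<le> c\<close> zero_less_one])
  qed
  also have "\<dots> = ennreal (LINT c|R. B * exp (l * c))"
    using l by (intro nn_integral_eq_integral) (auto simp: B_def)
  also have "\<dots> \<le> ennreal D" by (intro ennreal_leI) (simp add: D_def)
  finally have "(\<integral>\<^sup>+c. weight 1 p c \<partial>R) \<le> ennreal D" .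
  then show ?thesis
    by (intro exI[of _ D]) (auto simp: D_def nn_integral_TS_cost[OF weight_measurable R(3)])
qed

text \<open>The exponential moment gives integrability, so the integral in the specification is the
  true mean and not the default value 0 of \<open>LINT\<close>.\<close>

lemma TS_mean:
  shows "0 \<le> \<CC>" and "0 < b \<Longrightarrow> ereal b \<le> r \<Longrightarrow> (\<integral>\<^sup>+y. ennreal (snd y) \<partial>TS b) = ennreal \<CC>"
proof -
  obtain R l where R: "sets R = sets borel" "AE c in R. 0 \<le> c"
    "\<And>b. 0 < b \<Longrightarrow> ereal b \<le> r \<Longrightarrow> distr (TS b) borel snd = R"
    and l: "0 < l" "integrable R (\<lambda>c. exp (l * c))" and C: "(LINT c|R. c) = \<CC>"
    using TS_cost by metis
  have [measurable_cong]: "sets R = sets borel" by (rule R)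
  show "0 \<le> \<CC>" using R(2) by (simp add: integral_nonneg_AE flip: C)
  have int: "integrable R (\<lambda>c. c)"
  proof (rule Bochner_Integration.integrable_bound)
    show "integrable R (\<lambda>c. fact 1 * exp l / l ^ 1 * exp (l * c))"
      using l by simp
    show "AE c in R. norm c \<le> norm (fact 1 * exp l / l ^ 1 * exp (l * c))"
      using R(2)
    proof eventually_elim
      case (elim c)
      then show ?case
        using one_plus_power_le_exp[OF l(1) elim, of 1] l(1) by simp
    qed
  qed measurable
  assume b: "0 < b" "ereal b \<le> r"
  have "(\<integral>\<^sup>+y. ennreal (snd y) \<partial>TS b) = (\<integral>\<^sup>+c. ennreal c \<partial>R)"
    using R(3)[OF b] by (rule nn_integral_TS_cost[rotated]) measurable
  also have "\<dots> = ennreal \<CC>"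
    unfolding C[symmetric] using int R(2) by (rule nn_integral_eq_integral)
  finally show "(\<integral>\<^sup>+y. ennreal (snd y) \<partial>TS b) = ennreal \<CC>" .
qed

lemma WS_cost_nonneg:
  assumes b: "0 < b" "ereal b \<le> r" "0 < e"
  shows "AE u in WS b e. 0 \<le> snd u"
  using WS b unfolding W_sampler_def by (auto simp: case_prod_beta')

text \<open>A subordinator starts at 0 and increases; conditioning and equality in law preserve the
  sign.\<close>

lemma WS_nonneg:
  assumes b: "0 < b" "ereal b \<le> r" "0 < e"
  shows "AE u in WS b e. 0 \<le> fst u"
proof -
  note D = X[OF b(1,2)]
  let ?U = "uniform_measure (\<Omega> b) {\<omega> \<in> space (\<Omega> b). X b e \<omega> < b}"
  have Xm[measurable]: "X b e \<in> borel_measurable (\<Omega> b)"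
    using D b by (simp add: driftless_subordinator_def)
  have pos: "0 \<le> X b e \<omega>" if "\<omega> \<in> space (\<Omega> b)" for \<omega>
  proof -
    have "X b 0 \<omega> = 0" "mono_on {0..} (\<lambda>s. X b s \<omega>)"
      using D that by (auto simp: driftless_subordinator_def)
    with b(3) show ?thesis by (metis atLeast_iff less_imp_le mono_onD order_refl)
  qed
  have "AE x in distr ?U borel (X b e). 0 \<le> x"
  proof (subst AE_distr_iff)
    show "X b e \<in> borel_measurable ?U"
      by (simp add: uniform_measure_def)
    show "AE \<omega> in ?U. 0 \<le> X b e \<omega>"
      using pos by (intro AE_uniform_measureI) auto
  qed simp
  also have "distr ?U borel (X b e) = distr (WS b e) borel fst"
    using WS b unfolding W_sampler_def by simp
  finally show ?thesis by (subst (asm) AE_distr_iff) auto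
qed

lemma WS_moment:
  "\<exists>m\<ge>0. \<forall>b e. 0 < b \<and> ereal b \<le> r \<and> 0 < e \<longrightarrow> (\<integral>\<^sup>+u. ennreal (snd u ^ p) \<partial>WS b e) \<le> ennreal m"
proof -
  obtain m where m: "\<forall>b e. 0 < b \<and> ereal b \<le> r \<and> 0 < e \<longrightarrow> (\<integral>\<^sup>+u. ennreal (snd u ^ p) \<partial>WS b e) \<le> ennreal m"
  proof -
    have "\<forall>p::nat. \<exists>m::real. \<forall>b e. 0 < b \<and> ereal b \<le> r \<and> 0 < e \<longrightarrow>
        (\<integral>\<^sup>+u. ennreal (snd u ^ p) \<partial>WS b e) \<le> ennreal m"
      using WS unfolding W_sampler_def by (simp add: case_prod_beta')
    then show thesis using that by blast
  qed
  then show ?thesis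
    by (intro exI[of _ "max 0 m"]) (auto intro: order_trans ennreal_leI simp: max_def ennreal_neg)
qed

text \<open>The bound \<open>1 + c \<le> 2 * max 1 c\<close> reduces the weight to the p-th moment,
  which is uniform in b and e.\<close>

lemma WS_weight:
  "\<exists>D\<ge>1. \<forall>b e. 0 < b \<and> ereal b \<le> r \<and> 0 < e \<longrightarrow> (\<integral>\<^sup>+u. weight 1 p (snd u) \<partial>WS b e) \<le> ennreal D"
proof -
  obtain m where m: "0 \<le> m" "\<And>b e. 0 < b \<Longrightarrow> ereal b \<le> r \<Longrightarrow> 0 < e \<Longrightarrow>
      (\<integral>\<^sup>+u. ennreal (snd u ^ p) \<partial>WS b e) \<le> ennreal m"
    using WS_moment by metis
  have "(\<integral>\<^sup>+u. weight 1 p (snd u) \<partial>WS b e) \<le> ennreal (2 ^ p * (1 + m))"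
    if b: "0 < b" "ereal b \<le> r" "0 < e" for b e
  proof -
    have le: "weight 1 p c \<le> ennreal (2 ^ p) * (1 + ennreal (c ^ p))" if c: "0 \<le> c" for c
    proof -
      have "(1 + c) ^ p \<le> (2 * max 1 c) ^ p" using c by (intro power_mono) auto
      also have "\<dots> \<le> 2 ^ p * (1 + c ^ p)"
        unfolding power_mult_distrib using c by (intro mult_left_mono) (auto simp: max_def)
      finally have "ennreal ((1 + c) ^ p) \<le> ennreal (2 ^ p * (1 + c ^ p))" by (rule ennreal_leI)
      also have "\<dots> = ennreal (2 ^ p) * (1 + ennreal (c ^ p))"
        using c by (subst ennreal_mult) auto
      finally show ?thesis using c by (simp add: weight_eq)
    qed
    have "(\<integral>\<^sup>+u. weight 1 p (snd u) \<partial>WS b e) \<le> (\<integral>\<^sup>+u. ennreal (2 ^ p) * (1 + ennreal (snd u ^ p)) \<partial>WS b e)"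
      using WS_cost_nonneg[OF b] by (intro nn_integral_mono_AE) (auto elim!: eventually_mono intro: le)
    also have "\<dots> = ennreal (2 ^ p) * (1 + (\<integral>\<^sup>+u. ennreal (snd u ^ p) \<partial>WS b e))"
      using prob_space.emeasure_space_1[OF prob_WS, of b e]
      by (simp add: nn_integral_cmult nn_integral_add)
    also have "\<dots> \<le> ennreal (2 ^ p) * (1 + ennreal m)"
      by (intro mult_left_mono add_left_mono m b) auto
    also have "\<dots> = ennreal (2 ^ p * (1 + m))"
      using m(1) by (subst ennreal_mult) auto
    finally show ?thesis .
  qed
  moreover have "1 \<le> 2 ^ p * (1 + m)"
    using m(1) by (metis add_increasing2 mult_ge1_I one_le_numeral one_le_power order_refl)
  ultimately show ?thesis by blast
qed

lemma WS_mean: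
  assumes b: "0 < b" "ereal b \<le> r" "0 < e"
  shows "(\<integral>\<^sup>+u. ennreal (snd u) \<partial>WS b e) \<le> 5"
proof -
  \<comment> \<open>Integrability comes from the first moment bound; without it \<open>LINT\<close>
    could be 0 by default and the bound 5 would say nothing.\<close>
  obtain m where "(\<integral>\<^sup>+u. ennreal (snd u ^ 1) \<partial>WS b e) \<le> ennreal m"
    using WS_moment[of 1] b by blast
  then have "(\<integral>\<^sup>+u. ennreal (snd u) \<partial>WS b e) < \<infinity>"
    by (auto intro: order.strict_trans1)
  moreover note WS_cost_nonneg[OF b]
  ultimately have "integrable (WS b e) snd"
    by (intro integrableI_nonneg) auto
  then have "(\<integral>\<^sup>+u. ennreal (snd u) \<partial>WS b e) = ennreal (LINT u|WS b e. snd u)"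
    using WS_cost_nonneg[OF b] by (rule nn_integral_eq_integral)
  also have "(LINT u|WS b e. snd u) \<le> 5"
    using WS b unfolding W_sampler_def by (simp add: case_prod_beta')
  then have "ennreal (LINT u|WS b e. snd u) \<le> ennreal 5" by (rule ennreal_leI)
  finally show ?thesis by simp
qed

section \<open>The loop body of the samplers as a probability kernel on nonnegative states\<close>

lemma body_kernel: "(\<lambda>(t, s). body t s) \<in> borel \<rightarrow>\<^sub>M subprob_algebra borel"
  by (rule loop_body_kernel[OF \<zeta>(1) TS_kernel WS_kernel])

lemma body_measurable [measurable]: "body t \<in> borel \<rightarrow>\<^sub>M subprob_algebra borel"
  using measurable_compose[OF measurable_Pair1'[of t borel borel], of "\<lambda>(t, s). body t s" "subprob_algebra borel"]
    body_kernel
  by (simp add: borel_prod)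

text \<open>Turns the nested binds into iterated integrals; mass, sign and growth estimates for one
  passage all start from this formula. The functions \<open>k0\<close> to \<open>k3\<close> are the
  continuations after the successive draws.\<close>

lemma nn_integral_loop_body:
  assumes g: "g \<in> borel_measurable borel" and v: "v < t"
  shows "(\<integral>\<^sup>+s. g s \<partial>body t (x, v, c)) =
    (\<integral>\<^sup>+e. \<integral>\<^sup>+y. (if ereal (fst (fst y)) < e then g (x + fst (fst y), v + snd (fst y), c + 4 + snd y)
       else \<integral>\<^sup>+u. \<integral>\<^sup>+j. g (x + real_of_ereal e, v + j + fst u, c + 4 + snd y + snd u + \<kappa>)
         \<partial>jump_law \<theta> \<alpha> r \<zeta> (t - v) \<partial>WS (t - v) (real_of_ereal e))
     \<partial>TS (t - v) \<partial>exponential_law (Upsilon \<theta> \<alpha> r \<zeta> (t - v)))"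
proof -
  let ?S = "borel :: state measure"
  let ?P = "borel \<Otimes>\<^sub>M borel \<Otimes>\<^sub>M borel :: state measure"
  let ?J = "jump_law \<theta> \<alpha> r \<zeta> (t - v)"
  define k3 where "k3 = (\<lambda>e (y :: (real \<times> real) \<times> real) (u :: real \<times> real) j. return ?S
      (x + real_of_ereal e, v + j + fst u, c + 4 + snd y + snd u + \<kappa>) :: state measure)"
  define k2 where "k2 = (\<lambda>(e::ereal) (y::(real \<times> real) \<times> real) (u::real \<times> real). ?J \<bind> k3 e y u)"
  define k1 where "k1 = (\<lambda>e (y::(real \<times> real) \<times> real). if ereal (fst (fst y)) < e
      then return ?S (x + fst (fst y), v + snd (fst y), c + 4 + snd y)
      else WS (t - v) (real_of_ereal e) \<bind> k2 e y)"
  define k0 where "k0 = (\<lambda>e. TS (t - v) \<bind> k1 e)"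
  have [measurable]: "jump_law \<theta> \<alpha> r \<zeta> \<in> borel \<rightarrow>\<^sub>M subprob_algebra borel"
    by (rule jump_law_kernel[OF \<zeta>(1)])
  have [measurable]: "TS \<in> borel \<rightarrow>\<^sub>M subprob_algebra ((borel \<Otimes>\<^sub>M borel) \<Otimes>\<^sub>M borel)"
    using measurable_prob_algebraD[OF TS_kernel] by (simp add: borel_prod)
  have WS': "(\<lambda>x. WS (fst x) (snd x)) \<in> borel \<Otimes>\<^sub>M borel \<rightarrow>\<^sub>M subprob_algebra (borel \<Otimes>\<^sub>M borel)"
    using measurable_prob_algebraD[OF WS_kernel] by (simp add: borel_prod case_prod_beta')
  have [measurable (raw)]: "(\<lambda>x. WS (f x) (g x)) \<in> M \<rightarrow>\<^sub>M subprob_algebra (borel \<Otimes>\<^sub>M borel)"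
    if "f \<in> M \<rightarrow>\<^sub>M borel" "g \<in> M \<rightarrow>\<^sub>M borel" for f g and M :: "'b measure"
    using measurable_compose[OF measurable_Pair[OF that] WS'] by simp
  have m3: "k3 e y u \<in> ?J \<rightarrow>\<^sub>M subprob_algebra ?P" for e y u
    unfolding k3_def borel_prod[symmetric] by measurable
  have m2: "k2 e y \<in> WS (t - v) e' \<rightarrow>\<^sub>M subprob_algebra ?P" for e e' y
    unfolding k2_def k3_def measurable_cong_sets[OF sets_WS refl] borel_prod[symmetric] by measurable
  have m1: "k1 e \<in> TS (t - v) \<rightarrow>\<^sub>M subprob_algebra ?P" for e
    unfolding k1_def k2_def k3_def measurable_cong_sets[OF sets_TS refl] borel_prod[symmetric] by measurable
  have m0: "k0 \<in> exponential_law U \<rightarrow>\<^sub>M subprob_algebra ?P" for U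
    unfolding k0_def k1_def k2_def k3_def measurable_cong_sets[OF sets_exponential_law refl]
      borel_prod[symmetric] by measurable
  have g': "g \<in> borel_measurable ?P"
    using g by (simp add: borel_prod)
  have "body t (x, v, c) = exponential_law (Upsilon \<theta> \<alpha> r \<zeta> (t - v)) \<bind> k0"
    unfolding k0_def k1_def k2_def k3_def
    using v by (simp add: loop_body_def jump_law_def Let_def case_prod_beta' cong del: if_weak_cong)
  then have expand: "(\<integral>\<^sup>+s. g s \<partial>body t (x, v, c)) =
      (\<integral>\<^sup>+e. \<integral>\<^sup>+y. \<integral>\<^sup>+s. g s \<partial>k1 e y \<partial>TS (t - v) \<partial>exponential_law (Upsilon \<theta> \<alpha> r \<zeta> (t - v)))"
    by (simp only: nn_integral_bind[OF g' m0]) (simp add: k0_def nn_integral_bind[OF g' m1])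
  have k1: "(\<integral>\<^sup>+s. g s \<partial>k1 e y) =
      (if ereal (fst (fst y)) < e then g (x + fst (fst y), v + snd (fst y), c + 4 + snd y)
       else \<integral>\<^sup>+u. \<integral>\<^sup>+j. g (x + real_of_ereal e, v + j + fst u, c + 4 + snd y + snd u + \<kappa>)
         \<partial>?J \<partial>WS (t - v) (real_of_ereal e))" for e y
  proof -
    have "(\<integral>\<^sup>+s. g s \<partial>(WS (t - v) (real_of_ereal e) \<bind> k2 e y)) =
        (\<integral>\<^sup>+u. \<integral>\<^sup>+j. \<integral>\<^sup>+s. g s \<partial>k3 e y u j \<partial>?J \<partial>WS (t - v) (real_of_ereal e))"
      by (simp only: nn_integral_bind[OF g' m2]) (simp only: k2_def nn_integral_bind[OF g' m3])
    then show ?thesis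
      using g by (simp add: k1_def k3_def nn_integral_return)
  qed
  show ?thesis unfolding expand k1 ..
qed

lemma sets_body [simp, measurable_cong]: "sets (body t s) = sets borel"
  using measurable_space[OF body_measurable, of s t] by (simp add: space_subprob_algebra)

lemma space_body [simp]: "space (body t s) = UNIV"
  using sets_eq_imp_space_eq[OF sets_body, of t s] by simp

lemma body_absorbing: "t - v \<le> 0 \<Longrightarrow> body t (x, v, c) = return borel (x, v, c)"
  by (simp add: loop_body_def)

text \<open>Only the jump law could lose mass, and it does not: in the jump branch the waiting time
  is almost surely finite only if \<open>Upsilon\<close> is nonzero.\<close>

lemma prob_body: "prob_space (body t s)"
proof (cases s)
  case (fields x v c)
  show ?thesis
  proof (cases "v < t")
    case False
    then show ?thesis by (simp add: fields body_absorbing prob_space_return)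
  next
    case True
    let ?U = "Upsilon \<theta> \<alpha> r \<zeta> (t - v)"
    have "emeasure (body t s) (space (body t s)) = (\<integral>\<^sup>+s'. 1 \<partial>body t s)" by simp
    also have "\<dots> = (\<integral>\<^sup>+e. \<integral>\<^sup>+y. (if ereal (fst (fst y)) < e then 1
       else \<integral>\<^sup>+u. \<integral>\<^sup>+j. 1 \<partial>jump_law \<theta> \<alpha> r \<zeta> (t - v) \<partial>WS (t - v) (real_of_ereal e))
       \<partial>TS (t - v) \<partial>exponential_law ?U)"
      unfolding fields by (rule nn_integral_loop_body[OF _ True]) simp
    also have "\<dots> = (\<integral>\<^sup>+e. \<integral>\<^sup>+y. 1 \<partial>TS (t - v) \<partial>exponential_law ?U)"
    proof (intro nn_integral_cong_AE, use AE_exponential_law[OF Upsilon_nonneg] in eventually_elim)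
      case (elim e)
      have "(\<integral>\<^sup>+u. \<integral>\<^sup>+j. 1 \<partial>jump_law \<theta> \<alpha> r \<zeta> (t - v) \<partial>WS (t - v) (real_of_ereal e)) = 1" if "?U \<noteq> 0"
        using prob_space.emeasure_space_1[OF jump_law_prob[OF \<zeta> _ \<alpha> \<theta> that]]
          prob_space.emeasure_space_1[OF prob_WS] True by simp
      with elim show ?case
        by (intro nn_integral_cong) auto
    qed
    also have "\<dots> = 1"
      using prob_space.emeasure_space_1[OF prob_TS]
        prob_space.emeasure_space_1[OF prob_exponential_law[OF Upsilon_nonneg]] by simp
    finally show ?thesis by (rule prob_spaceI)
  qed
qed

text \<open>A nonnegative position keeps the level t - v at most t, hence at most r, which is the
  range where the samplers are specified.\<close>

lemma AE_body_nonneg: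
  assumes t: "ereal t \<le> r" and s: "0 \<le> fst (snd s)" "0 \<le> snd (snd s)"
  shows "AE s' in body t s. 0 \<le> fst (snd s') \<and> 0 \<le> snd (snd s')"
proof (cases s)
  case (fields x v c)
  show ?thesis
  proof (cases "v < t")
    case False
    then show ?thesis using s
      unfolding fields body_absorbing[OF iffD2[OF diff_le_0_iff_le], OF False[unfolded not_less]]
      by (subst AE_return) auto
  next
    case True
    have b: "0 < t - v" "ereal (t - v) \<le> r"
      using True s order_trans[of "ereal (t - v)" "ereal t" r] t by (auto simp: fields)
    let ?U = "Upsilon \<theta> \<alpha> r \<zeta> (t - v)"
    define Bad :: "state set" where "Bad = {s'. \<not> (0 \<le> fst (snd s') \<and> 0 \<le> snd (snd s'))}"
    have Bad[measurable]: "Bad \<in> sets borel"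
      unfolding Bad_def Collect_neg_eq using nonneg_pred by (intro borel_comp) (simp add: pred_def)
    have "emeasure (body t s) Bad = (\<integral>\<^sup>+s'. indicator Bad s' \<partial>body t s)" by simp
    also have "\<dots> = (\<integral>\<^sup>+e. \<integral>\<^sup>+y. (if ereal (fst (fst y)) < e
       then indicator Bad (x + fst (fst y), v + snd (fst y), c + 4 + snd y)
       else \<integral>\<^sup>+u. \<integral>\<^sup>+j. indicator Bad (x + real_of_ereal e, v + j + fst u, c + 4 + snd y + snd u + \<kappa>)
         \<partial>jump_law \<theta> \<alpha> r \<zeta> (t - v) \<partial>WS (t - v) (real_of_ereal e))
       \<partial>TS (t - v) \<partial>exponential_law ?U)"
      unfolding fields by (rule nn_integral_loop_body[OF _ True]) simp
    also have "\<dots> = (\<integral>\<^sup>+e. \<integral>\<^sup>+y. 0 \<partial>TS (t - v) \<partial>exponential_law ?U)"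
    proof (intro nn_integral_cong_AE, use AE_exponential_law[OF Upsilon_nonneg] in eventually_elim,
        intro nn_integral_cong_AE, use TS_overshoot[OF b] TS_cost_nonneg[OF b] in eventually_elim)
      case (elim e y)
      show ?case
      proof (cases "ereal (fst (fst y)) < e")
        case False
        with elim have e: "0 < real_of_ereal e" by (cases e) auto
        have "(\<integral>\<^sup>+u. \<integral>\<^sup>+j. indicator Bad (x + real_of_ereal e, v + j + fst u, c + 4 + snd y + snd u + \<kappa>)
         \<partial>jump_law \<theta> \<alpha> r \<zeta> (t - v) \<partial>WS (t - v) (real_of_ereal e)) =
         (\<integral>\<^sup>+u. \<integral>\<^sup>+j. 0 \<partial>jump_law \<theta> \<alpha> r \<zeta> (t - v) \<partial>WS (t - v) (real_of_ereal e))"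
        proof (intro nn_integral_cong_AE,
            use WS_nonneg[OF b e] WS_cost_nonneg[OF b e] in eventually_elim,
            intro nn_integral_cong_AE, use AE_jump_law[OF \<zeta>] in eventually_elim)
          case (elim u j)
          with s \<kappa> \<open>0 \<le> snd y\<close> show ?case by (simp add: fields Bad_def)
        qed
        with False show ?thesis by simp
      qed (use elim s b in \<open>auto simp: fields Bad_def\<close>)
    qed
    finally have "emeasure (body t s) Bad = 0" by simp
    then show ?thesis using Bad by (intro AE_I[of _ _ Bad]) (auto simp: Bad_def)
  qed
qed

section \<open>One passage through the loop\<close>

abbreviation (input) \<phi> :: real where "\<phi> \<equiv> contraction \<zeta>"

text \<open>A jump that leaves the loop running is smaller than t - v, which produces the indicator;
  dropping w only increases the exponential.\<close>

lemma lyap_jump_le: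
  assumes "0 \<le> w" "0 \<le> j"
  shows "lyap t (v + j + w) \<le> ennreal (exp (- j)) * indicator {..<t - v} j * lyap t v"
proof (cases "v + j + w < t")
  case True
  have "exp (t - (v + j + w)) \<le> exp (- j) * exp (t - v)"
    using assms by (simp add: exp_add[symmetric])
  then have "ennreal (exp (t - (v + j + w))) \<le> ennreal (exp (- j)) * ennreal (exp (t - v))"
    by (simp add: ennreal_mult[symmetric] ennreal_leI)
  moreover have "j < t - v" "v < t" using True assms by simp_all
  ultimately show ?thesis using True by (simp add: lyap_def)
qed (simp add: lyap_def)

lemma nn_integral_lyap_jump_le:
  assumes v: "v < t" and w: "0 \<le> w" and U: "Upsilon \<theta> \<alpha> r \<zeta> (t - v) \<noteq> 0"
  shows "(\<integral>\<^sup>+j. a + lyap t (v + j + w) \<partial>jump_law \<theta> \<alpha> r \<zeta> (t - v)) \<le> a + ennreal \<phi> * lyap t v"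
proof -
  let ?J = "jump_law \<theta> \<alpha> r \<zeta> (t - v)"
  have b: "0 < t - v" using v by simp
  interpret J: prob_space ?J by (rule jump_law_prob[OF \<zeta> b \<alpha> \<theta> U])
  have "(\<integral>\<^sup>+j. a + lyap t (v + j + w) \<partial>?J)
      \<le> (\<integral>\<^sup>+j. a + ennreal (exp (- j)) * indicator {..<t - v} j * lyap t v \<partial>?J)"
    using AE_jump_law[OF \<zeta>]
    by (intro nn_integral_mono_AE, eventually_elim) (intro add_left_mono lyap_jump_le w less_imp_le)
  also have "\<dots> = a + (\<integral>\<^sup>+j. ennreal (exp (- j)) * indicator {..<t - v} j \<partial>?J) * lyap t v"
    using J.emeasure_space_1 by (simp add: nn_integral_add nn_integral_multc)
  also have "\<dots> \<le> a + ennreal \<phi> * lyap t v"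
    by (intro add_left_mono mult_right_mono jump_law_contraction[OF \<zeta> b \<alpha> \<theta> U]) auto
  finally show ?thesis .
qed

text \<open>Both branches are bounded pointwise in \<open>e\<close> and \<open>y\<close> by the same
  multiple of the weight of the \<open>TS\<close> cost, so the dependence between that cost and
  \<open>x'\<close> does no harm. The summand \<open>a\<close> allows two uses: \<open>a = 1\<close>
  for the moments, and \<open>a = 0\<close> with \<open>p = 0\<close> for geometric decay.\<close>

lemma loop_body_step:
  assumes K: "0 < K" and b: "v < t" "ereal (t - v) \<le> r"
    and A1: "(\<integral>\<^sup>+y. weight K p (snd y) \<partial>TS (t - v)) \<le> A1"
    and A2: "\<And>e. 0 < e \<Longrightarrow> (\<integral>\<^sup>+u. weight K p (snd u) \<partial>WS (t - v) e) \<le> A2" and A2_1: "1 \<le> A2"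
  shows "(\<integral>\<^sup>+s. weight K p (snd (snd s)) * (a + lyap t (fst (snd s))) \<partial>body t (x, v, c))
    \<le> weight K p c * (weight K p (4 + \<kappa>) * A1 * A2) * (a + ennreal \<phi> * lyap t v)"
proof -
  let ?W = "weight K p" and ?U = "Upsilon \<theta> \<alpha> r \<zeta> (t - v)"
  define Q where "Q = a + ennreal \<phi> * lyap t v"
  have b': "0 < t - v" using b by simp
  have g: "(\<lambda>s. ?W (snd (snd s)) * (a + lyap t (fst (snd s)))) \<in> borel_measurable (borel :: state measure)"
    unfolding borel_prod[symmetric] by measurable
  have split: "?W (c + 4 + y + u + \<kappa>) \<le> (?W c * ?W (4 + \<kappa>) * ?W y) * ?W u" for y u
  proof -
    have "?W (c + 4 + y + u + \<kappa>) = ?W ((c + (4 + \<kappa>) + y) + u)" by (simp add: algebra_simps)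
    also have "\<dots> \<le> ?W (c + (4 + \<kappa>) + y) * ?W u" by (rule weight_add_le)
    also have "\<dots> \<le> (?W (c + (4 + \<kappa>)) * ?W y) * ?W u" by (intro mult_right_mono weight_add_le) simp
    also have "\<dots> \<le> (?W c * ?W (4 + \<kappa>) * ?W y) * ?W u" by (intro mult_right_mono weight_add_le) simp_all
    finally show ?thesis .
  qed
  have "(\<integral>\<^sup>+s. ?W (snd (snd s)) * (a + lyap t (fst (snd s))) \<partial>body t (x, v, c)) =
    (\<integral>\<^sup>+e. \<integral>\<^sup>+y. (if ereal (fst (fst y)) < e then ?W (c + 4 + snd y) * (a + lyap t (v + snd (fst y)))
       else \<integral>\<^sup>+u. \<integral>\<^sup>+j. ?W (c + 4 + snd y + snd u + \<kappa>) * (a + lyap t (v + j + fst u))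
         \<partial>jump_law \<theta> \<alpha> r \<zeta> (t - v) \<partial>WS (t - v) (real_of_ereal e))
     \<partial>TS (t - v) \<partial>exponential_law ?U)"
    unfolding nn_integral_loop_body[OF g b(1)] by (simp cong del: if_weak_cong)
  also have "\<dots> \<le> (\<integral>\<^sup>+e. \<integral>\<^sup>+y. (?W c * ?W (4 + \<kappa>) * A2 * Q) * ?W (snd y) \<partial>TS (t - v) \<partial>exponential_law ?U)"
  proof (intro nn_integral_mono_AE, use AE_exponential_law[OF Upsilon_nonneg] in eventually_elim,
      intro nn_integral_mono_AE, use TS_overshoot[OF b' b(2)] in eventually_elim)
    case (elim e y)
    show ?case
    proof (cases "ereal (fst (fst y)) < e")
      case True
      have "?W (c + 4 + snd y) \<le> ?W (c + 4 + snd y + 0 + \<kappa>)"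
        using K \<kappa> by (intro weight_mono) auto
      also have "\<dots> \<le> ?W c * ?W (4 + \<kappa>) * ?W (snd y)" using split[of "snd y" 0] by simp
      finally have "?W (c + 4 + snd y) * (a + lyap t (v + snd (fst y)))
          \<le> (?W c * ?W (4 + \<kappa>) * ?W (snd y)) * (A2 * Q)"
      proof (rule mult_mono)
        \<comment> \<open>The overshoot ends the loop and removes the exponential; the spare factor
          \<open>A2 \<ge> 1\<close> is inserted to match the jump branch.\<close>
        have "lyap t (v + snd (fst y)) = 0" using elim by (simp add: lyap_def)
        then have "a + lyap t (v + snd (fst y)) \<le> Q" by (simp add: Q_def)
        also have "\<dots> \<le> A2 * Q" using mult_right_mono[OF A2_1, of Q] by simp
        finally show "a + lyap t (v + snd (fst y)) \<le> A2 * Q" .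
      qed auto
      then show ?thesis using True by (simp add: mult_ac)
    next
      case False
      \<comment> \<open>The waiting time is at most \<open>x'\<close>, hence finite, so
        \<open>Upsilon\<close> is not 0 and the jump law is a probability.\<close>
      with elim have e: "0 < real_of_ereal e" and U: "?U \<noteq> 0" by (cases e; auto)+
      have "(\<integral>\<^sup>+u. \<integral>\<^sup>+j. ?W (c + 4 + snd y + snd u + \<kappa>) * (a + lyap t (v + j + fst u))
         \<partial>jump_law \<theta> \<alpha> r \<zeta> (t - v) \<partial>WS (t - v) (real_of_ereal e))
         \<le> (\<integral>\<^sup>+u. (?W c * ?W (4 + \<kappa>) * ?W (snd y) * Q) * ?W (snd u) \<partial>WS (t - v) (real_of_ereal e))"
      proof (intro nn_integral_mono_AE, use WS_nonneg[OF b' b(2) e] in eventually_elim)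
        case (elim u)
        \<comment> \<open>The cost is already determined when the jump is drawn, so the weight
          leaves the integral and the contraction acts on the exponential alone.\<close>
        have "(\<integral>\<^sup>+j. ?W (c + 4 + snd y + snd u + \<kappa>) * (a + lyap t (v + j + fst u)) \<partial>jump_law \<theta> \<alpha> r \<zeta> (t - v))
            = ?W (c + 4 + snd y + snd u + \<kappa>) * (\<integral>\<^sup>+j. a + lyap t (v + j + fst u) \<partial>jump_law \<theta> \<alpha> r \<zeta> (t - v))"
          by (rule nn_integral_cmult) measurable
        also have "\<dots> \<le> ((?W c * ?W (4 + \<kappa>) * ?W (snd y)) * ?W (snd u)) * Q"
          unfolding Q_def by (intro mult_mono split nn_integral_lyap_jump_le b elim U) auto
        finally show ?case by (simp add: mult_ac)
      qed
      also have "\<dots> = (?W c * ?W (4 + \<kappa>) * ?W (snd y) * Q) * (\<integral>\<^sup>+u. ?W (snd u) \<partial>WS (t - v) (real_of_ereal e))"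
        by (rule nn_integral_cmult) measurable
      also have "\<dots> \<le> (?W c * ?W (4 + \<kappa>) * ?W (snd y) * Q) * A2"
        by (intro mult_left_mono A2 e) simp
      finally show ?thesis using False by (simp add: mult_ac)
    qed
  qed
  also have "\<dots> = (?W c * ?W (4 + \<kappa>) * A2 * Q) * (\<integral>\<^sup>+y. ?W (snd y) \<partial>TS (t - v))"
    using prob_space.emeasure_space_1[OF prob_exponential_law[OF Upsilon_nonneg]]
    by (simp add: nn_integral_cmult)
  also have "\<dots> \<le> (?W c * ?W (4 + \<kappa>) * A2 * Q) * A1"
    by (intro mult_left_mono A1) simp
  finally show ?thesis unfolding Q_def by (simp add: mult_ac)
qed

text \<open>The factor gained by the weight in one passage may use up half of the gap between \<open>\<phi>\<close> and \<open>1\<close>.\<close>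

definition admissible :: "real \<Rightarrow> nat \<Rightarrow> bool" where
  "admissible K p \<longleftrightarrow> 0 < K \<and> (\<exists>A1 A2. 1 \<le> A2 \<and>
     (\<forall>b. 0 < b \<and> ereal b \<le> r \<longrightarrow> (\<integral>\<^sup>+y. weight K p (snd y) \<partial>TS b) \<le> A1) \<and>
     (\<forall>b e. 0 < b \<and> ereal b \<le> r \<and> 0 < e \<longrightarrow> (\<integral>\<^sup>+u. weight K p (snd u) \<partial>WS b e) \<le> A2) \<and>
     weight K p (4 + \<kappa>) * A1 * A2 \<le> ennreal (1 + (1 - \<phi>) / 2))"

lemma contraction_bounds: "0 \<le> \<phi>" "\<phi> < 1"
  using contraction_nonneg[OF \<zeta>] contraction_less_1[OF \<zeta>] by auto

text \<open>One passage has mean cost at most \<CC> + 9 + \<kappa>: four elementary operations,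
  \<kappa> for the jump, \<CC> for \<open>TS\<close> and 5 for \<open>WS\<close>. The product of the
  three factors is at most the exponential of this sum over K. The choice of K makes the exponent x
  = (1 - \<phi>) / 4, and \<open>exp x \<le> 1 + x + x * x \<le> 1 + 2 * x\<close>.\<close>

lemma admissible_mean:
  "admissible (4 * (\<CC> + 9 + \<kappa>) / (1 - \<phi>)) 1"
proof -
  let ?S = "\<CC> + 9 + \<kappa>"
  define K where "K = 4 * ?S / (1 - \<phi>)"
  have S: "0 < ?S" using TS_mean(1) \<kappa> by simp
  have K: "0 < K" using S contraction_bounds by (simp add: K_def)
  have w: "(\<integral>\<^sup>+y. weight K 1 (f y) \<partial>M) \<le> ennreal (1 + m / K)"
    if "(\<integral>\<^sup>+y. ennreal (f y) \<partial>M) \<le> ennreal m" "0 \<le> m" "prob_space M" and [measurable]: "f \<in> borel_measurable M"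
    for M :: "'b measure" and f m
  proof -
    have "(\<integral>\<^sup>+y. weight K 1 (f y) \<partial>M) = 1 + ennreal (1 / K) * (\<integral>\<^sup>+y. ennreal (f y) \<partial>M)"
      using prob_space.emeasure_space_1[OF that(3)] by (simp add: weight_1_eq[OF K, unfolded One_nat_def] nn_integral_add nn_integral_cmult)
    also have "\<dots> \<le> 1 + ennreal (1 / K) * ennreal m"
      by (intro add_left_mono mult_left_mono that) simp
    also have "\<dots> = ennreal (1 + m / K)"
      using K that(2) by (subst ennreal_plus) (auto simp: ennreal_mult[symmetric])
    finally show ?thesis .
  qed
  have "weight K 1 (4 + \<kappa>) * ennreal (1 + \<CC> / K) * ennreal (1 + 5 / K) \<le> ennreal (1 + (1 - \<phi>) / 2)"
  proof -
    have nn: "0 \<le> (4 + \<kappa>) / K" "0 \<le> \<CC> / K" "0 \<le> 5 / K"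
      using K \<kappa> TS_mean(1) by (simp_all only: divide_nonneg_pos)
    have "(1 + (4 + \<kappa>) / K) * (1 + \<CC> / K) * (1 + 5 / K) \<le> exp ((4 + \<kappa>) / K) * exp (\<CC> / K) * exp (5 / K)"
      using nn by (intro mult_mono exp_ge_add_one_self) auto
    also have "\<dots> = exp (?S / K)"
      by (simp add: exp_add[symmetric] add_divide_distrib)
    also have "?S / K = (1 - \<phi>) / 4"
      using S contraction_bounds by (simp add: K_def field_simps)
    also have "exp ((1 - \<phi>) / 4) \<le> 1 + (1 - \<phi>) / 4 + ((1 - \<phi>) / 4)\<^sup>2"
      using contraction_bounds by (intro exp_bound) auto
    also have "((1 - \<phi>) / 4)\<^sup>2 \<le> (1 - \<phi>) / 4"
      unfolding power2_eq_square using contraction_bounds by (intro mult_left_le) auto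
    finally have le: "(1 + (4 + \<kappa>) / K) * (1 + \<CC> / K) * (1 + 5 / K) \<le> 1 + (1 - \<phi>) / 2" by simp
    have "weight K 1 (4 + \<kappa>) = ennreal (1 + (4 + \<kappa>) / K)"
      using K \<kappa> by (subst weight_eq) auto
    then have "weight K 1 (4 + \<kappa>) * ennreal (1 + \<CC> / K) * ennreal (1 + 5 / K) =
        ennreal ((1 + (4 + \<kappa>) / K) * (1 + \<CC> / K) * (1 + 5 / K))"
      using nn by (simp only: ennreal_mult[symmetric] add_nonneg_nonneg zero_le_one mult_nonneg_nonneg)
    with le show ?thesis by (simp only: ennreal_leI)
  qed
  moreover have "1 \<le> ennreal (1 + 5 / K)"
    using K ennreal_leI[of 1 "1 + 5 / K"] by (simp del: ennreal_plus)
  moreover have "(\<integral>\<^sup>+y. weight K 1 (snd y) \<partial>TS b) \<le> ennreal (1 + \<CC> / K)" if "0 < b \<and> ereal b \<le> r" for b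
    using that TS_mean by (intro w prob_TS) auto
  moreover have "(\<integral>\<^sup>+u. weight K 1 (snd u) \<partial>WS b e) \<le> ennreal (1 + 5 / K)"
    if "0 < b \<and> ereal b \<le> r \<and> 0 < e" for b e
    using that WS_mean[of b e] by (intro w prob_WS) auto
  ultimately show ?thesis
    unfolding admissible_def K_def[symmetric] using K by blast
qed

lemma admissible_exists: "\<exists>K. admissible K p"
proof -
  obtain D1 where D1: "1 \<le> D1" "\<And>b. 0 < b \<Longrightarrow> ereal b \<le> r \<Longrightarrow> (\<integral>\<^sup>+y. weight 1 p (snd y) \<partial>TS b) \<le> ennreal D1"
    using TS_weight by metis
  obtain D2 where D2: "1 \<le> D2" "\<And>b e. 0 < b \<Longrightarrow> ereal b \<le> r \<Longrightarrow> 0 < e \<Longrightarrow>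
      (\<integral>\<^sup>+u. weight 1 p (snd u) \<partial>WS b e) \<le> ennreal D2"
    using WS_weight by metis
  define D where "D = max ((1 + (4 + \<kappa>) / 1) ^ p) (max D1 D2)"
  define \<epsilon> where "\<epsilon> = (1 - \<phi>) / 2"
  \<comment> \<open>Each of the three factors becomes at most \<open>1 + \<epsilon> / 7\<close>,
    whose cube is at most \<open>1 + \<epsilon>\<close>; also \<open>K \<ge> 1\<close>, as the
    convexity bound requires.\<close>
  define K where "K = 7 * D / \<epsilon>"
  have \<epsilon>: "0 < \<epsilon>" "\<epsilon> \<le> 1" using contraction_bounds by (auto simp: \<epsilon>_def)
  have D: "1 \<le> D" using D1 by (simp add: D_def)
  have K: "1 \<le> K" using \<epsilon> D by (simp add: K_def field_simps)
  have x: "D / K = \<epsilon> / 7" using D \<epsilon> by (simp add: K_def)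
  have w: "(\<integral>\<^sup>+y. weight K p (f y) \<partial>M) \<le> ennreal (1 + \<epsilon> / 7)"
    if "(\<integral>\<^sup>+y. weight 1 p (f y) \<partial>M) \<le> ennreal D" "prob_space M" and [measurable]: "f \<in> borel_measurable M"
    for M :: "'b measure" and f
  proof -
    have "(\<integral>\<^sup>+y. weight K p (f y) \<partial>M) \<le> (\<integral>\<^sup>+y. 1 + ennreal (1 / K) * weight 1 p (f y) \<partial>M)"
      by (intro nn_integral_mono weight_le K)
    also have "\<dots> = 1 + ennreal (1 / K) * (\<integral>\<^sup>+y. weight 1 p (f y) \<partial>M)"
      using prob_space.emeasure_space_1[OF that(2)] by (simp add: nn_integral_add nn_integral_cmult)
    also have "\<dots> \<le> 1 + ennreal (1 / K) * ennreal D"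
      by (intro add_left_mono mult_left_mono that) simp
    also have "\<dots> = ennreal (1 + D / K)"
      using K D by (subst ennreal_plus) (auto simp: ennreal_mult[symmetric])
    finally show ?thesis by (simp only: x)
  qed
  \<comment> \<open>The fixed cost is treated as a random cost with a Dirac law, so the same
    estimate covers it.\<close>
  have "(\<integral>\<^sup>+y. weight K p y \<partial>return borel (4 + \<kappa>)) \<le> ennreal (1 + \<epsilon> / 7)"
    using \<kappa> by (intro w prob_space_return)
      (auto simp: nn_integral_return weight_eq D_def intro!: ennreal_leI)
  then have w0: "weight K p (4 + \<kappa>) \<le> ennreal (1 + \<epsilon> / 7)"
    by (simp add: nn_integral_return)
  have "weight K p (4 + \<kappa>) * ennreal (1 + \<epsilon> / 7) * ennreal (1 + \<epsilon> / 7)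
      \<le> ennreal (1 + \<epsilon> / 7) * ennreal (1 + \<epsilon> / 7) * ennreal (1 + \<epsilon> / 7)"
    by (intro mult_right_mono w0) auto
  also have "\<dots> = ennreal ((1 + \<epsilon> / 7) ^ 3)"
    using \<epsilon> by (simp add: ennreal_mult[symmetric] power3_eq_cube del: ennreal_plus)
  also have "(1 + \<epsilon> / 7) ^ 3 \<le> 1 + \<epsilon>"
  proof -
    have "\<epsilon> * \<epsilon> \<le> \<epsilon>" "\<epsilon> * (\<epsilon> * \<epsilon>) \<le> \<epsilon>"
      using \<epsilon> by (auto intro!: mult_left_le mult_le_one)
    moreover have "(1 + \<epsilon> / 7) ^ 3 = 1 + 3 / 7 * \<epsilon> + 3 / 49 * (\<epsilon> * \<epsilon>) + 1 / 343 * (\<epsilon> * (\<epsilon> * \<epsilon>))"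
      by (simp add: power3_eq_cube field_simps)
    ultimately show ?thesis using \<epsilon> by linarith
  qed
  then have "ennreal ((1 + \<epsilon> / 7) ^ 3) \<le> ennreal (1 + \<epsilon>)" by (rule ennreal_leI)
  finally have "weight K p (4 + \<kappa>) * ennreal (1 + \<epsilon> / 7) * ennreal (1 + \<epsilon> / 7) \<le> ennreal (1 + (1 - \<phi>) / 2)"
    by (simp only: \<epsilon>_def)
  moreover have "1 \<le> ennreal (1 + \<epsilon> / 7)"
    using \<epsilon> ennreal_leI[of 1 "1 + \<epsilon> / 7"] by (simp del: ennreal_plus)
  moreover have "(\<integral>\<^sup>+y. weight K p (snd y) \<partial>TS b) \<le> ennreal (1 + \<epsilon> / 7)" if "0 < b \<and> ereal b \<le> r" for b
    using that by (intro w prob_TS order_trans[OF D1(2)]) (auto simp: D_def intro!: ennreal_leI)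
  moreover have "(\<integral>\<^sup>+u. weight K p (snd u) \<partial>WS b e) \<le> ennreal (1 + \<epsilon> / 7)"
    if "0 < b \<and> ereal b \<le> r \<and> 0 < e" for b e
    using that by (intro w prob_WS order_trans[OF D2(2)]) (auto simp: D_def intro!: ennreal_leI)
  moreover have "0 < K" using K by simp
  ultimately show ?thesis
    unfolding admissible_def by blast
qed

section \<open>The loop\<close>

text \<open>With \<epsilon> half the gap, one share \<epsilon> absorbs the growth of the weight on
  the summand 1, the other its growth on the contracted exponential. The first share suffices
  because the exponential is at least 1 while the loop runs.\<close>

lemma body_admissible:
  assumes K: "admissible K p" and s: "fst (snd s) < t" "0 \<le> fst (snd s)" and t: "ereal t \<le> r"
  shows "(\<integral>\<^sup>+s'. weight K p (snd (snd s')) * (1 + lyap t (fst (snd s'))) \<partial>body t s)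
    \<le> weight K p (snd (snd s)) * (1 + lyap t (fst (snd s)))"
proof (cases s)
  case (fields x v c)
  define \<epsilon> where "\<epsilon> = (1 - \<phi>) / 2"
  have \<epsilon>: "0 < \<epsilon>" "\<phi> + 2 * \<epsilon> = 1" using contraction_bounds by (auto simp: \<epsilon>_def diff_divide_distrib)
  have v: "v < t" and b: "0 < t - v" "ereal (t - v) \<le> r"
    using s order_trans[of "ereal (t - v)" "ereal t" r] t by (auto simp: fields)
  obtain A1 A2 where A: "1 \<le> A2" "(\<integral>\<^sup>+y. weight K p (snd y) \<partial>TS (t - v)) \<le> A1"
     "\<And>e. 0 < e \<Longrightarrow> (\<integral>\<^sup>+u. weight K p (snd u) \<partial>WS (t - v) e) \<le> A2"
     "weight K p (4 + \<kappa>) * A1 * A2 \<le> ennreal (1 + \<epsilon>)" and K0: "0 < K"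
    using K b unfolding admissible_def \<epsilon>_def[symmetric] by blast
  define f where "f = exp (t - v)"
  have f: "1 \<le> f" and lf: "lyap t v = ennreal f" using v by (auto simp: f_def lyap_def)
  have "(1 + \<epsilon>) * (1 + \<phi> * f) \<le> 1 + f"
  proof -
    have "\<epsilon> * 1 \<le> \<epsilon> * f" "\<epsilon> * (\<phi> * f) \<le> \<epsilon> * (1 * f)"
      using \<epsilon> f contraction_bounds by (auto intro!: mult_left_mono mult_right_mono)
    moreover have "(\<phi> + 2 * \<epsilon>) * f = f" using \<epsilon> by simp
    ultimately show ?thesis by (simp add: algebra_simps)
  qed
  then have "ennreal ((1 + \<epsilon>) * (1 + \<phi> * f)) \<le> ennreal (1 + f)" by (rule ennreal_leI)
  also have "ennreal ((1 + \<epsilon>) * (1 + \<phi> * f)) = ennreal (1 + \<epsilon>) * (1 + ennreal \<phi> * ennreal f)"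
    using \<epsilon> f contraction_bounds by (subst ennreal_mult) (auto simp: ennreal_mult)
  also have "ennreal (1 + f) = 1 + ennreal f" using f by simp
  finally have le: "ennreal (1 + \<epsilon>) * (1 + ennreal \<phi> * lyap t v) \<le> 1 + lyap t v" by (simp only: lf)
  have "(\<integral>\<^sup>+s'. weight K p (snd (snd s')) * (1 + lyap t (fst (snd s'))) \<partial>body t s)
    \<le> weight K p c * (weight K p (4 + \<kappa>) * A1 * A2) * (1 + ennreal \<phi> * lyap t v)"
    unfolding fields by (rule loop_body_step[OF K0 v b(2) A(2,3,1)])
  also have "\<dots> \<le> weight K p c * ennreal (1 + \<epsilon>) * (1 + ennreal \<phi> * lyap t v)"
    by (intro mult_right_mono mult_left_mono A) auto
  also have "\<dots> \<le> weight K p c * (1 + lyap t v)"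
    unfolding mult.assoc by (intro mult_left_mono le) simp
  finally show ?thesis by (simp add: fields)
qed

text \<open>The passage estimate at p = 0, where every weight is 1 and costs disappear.\<close>

lemma body_lyap_decay:
  assumes s: "fst (snd s) < t" "0 \<le> fst (snd s)" and t: "ereal t \<le> r"
  shows "(\<integral>\<^sup>+s'. lyap t (fst (snd s')) \<partial>body t s) \<le> ennreal \<phi> * lyap t (fst (snd s))"
proof (cases s)
  case (fields x v c)
  have v: "v < t" and b: "ereal (t - v) \<le> r"
    using s order_trans[of "ereal (t - v)" "ereal t" r] t by (auto simp: fields)
  show ?thesis
    unfolding fields
    using loop_body_step[where K = 1 and p = 0 and ?A1.0 = 1 and ?A2.0 = 1 and a = 0 and x = x and c = c,
        OF zero_less_one v b]
      prob_space.emeasure_space_1[OF prob_TS] prob_space.emeasure_space_1[OF prob_WS]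
    by simp
qed

definition exited :: "real \<Rightarrow> state set" where
  "exited t = {s. t \<le> fst (snd s)}"

lemma exited_sets: "{(t, s). s \<in> exited t} \<in> sets borel" "exited t \<in> sets borel"
proof -
  have "closed {z :: real \<times> state. fst z \<le> fst (snd (snd z))}" "closed {z :: state. t \<le> fst (snd z)}"
    by (intro closed_Collect_le continuous_intros)+
  then show "{(t, s). s \<in> exited t} \<in> sets borel" "exited t \<in> sets borel"
    by (auto dest!: borel_closed simp: case_prod_beta' exited_def)
qed

lemma body_exited: "s \<in> exited t \<Longrightarrow> body t s = return borel s"
  using body_absorbing[of t "fst (snd s)" "fst s" "snd (snd s)"] by (simp add: exited_def)

sublocale loop: absorbing_loop "body t" "exited t" for t
  by unfold_locales (auto simp: body_exited exited_sets)

lemma prob_iter: "prob_space (loop_iter (body t) n s)"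
proof (induction n)
  case (Suc n)
  show ?case
    unfolding loop_iter_Suc
    by (rule prob_space.prob_space_bind[OF Suc _ loop.body_iter]) (simp add: prob_body)
qed (simp add: prob_space_return)

lemma AE_iter_nonneg:
  assumes t: "ereal t \<le> r"
  shows "AE s in loop_iter (body t) n (0, 0, 0). 0 \<le> fst (snd s) \<and> 0 \<le> snd (snd s)"
proof (induction n)
  case 0
  then show ?case
    unfolding loop_iter_0 by (subst AE_return) (auto simp: nonneg_pred)
next
  case (Suc n)
  show ?case
    unfolding loop_iter_Suc AE_bind[OF loop.body_iter nonneg_pred]
    using Suc by eventually_elim (blast intro: AE_body_nonneg[OF t])
qed

text \<open>Absorbed states are carried along unchanged, so \<open>G\<close> has to tolerate the
  factor q on them: it does for q = 1, and for q < 1 when \<open>G\<close> vanishes there.\<close>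

lemma iter_bound:
  assumes t: "ereal t \<le> r" and G[measurable]: "G \<in> borel_measurable borel"
    and step: "\<And>s. fst (snd s) < t \<Longrightarrow> 0 \<le> fst (snd s) \<Longrightarrow> (\<integral>\<^sup>+s'. G s' \<partial>body t s) \<le> q * G s"
    and exit: "\<And>s. t \<le> fst (snd s) \<Longrightarrow> G s \<le> q * G s"
  shows "(\<integral>\<^sup>+s. G s \<partial>loop_iter (body t) n (0, 0, 0)) \<le> q ^ n * G (0, 0, 0)"
proof (induction n)
  case 0
  then show ?case by (simp add: nn_integral_return)
next
  case (Suc n)
  have "(\<integral>\<^sup>+s. G s \<partial>loop_iter (body t) (Suc n) (0, 0, 0)) =
      (\<integral>\<^sup>+s. \<integral>\<^sup>+s'. G s' \<partial>body t s \<partial>loop_iter (body t) n (0, 0, 0))"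
    by (simp add: nn_integral_bind[OF G loop.body_iter])
  also have "\<dots> \<le> (\<integral>\<^sup>+s. q * G s \<partial>loop_iter (body t) n (0, 0, 0))"
  proof (intro nn_integral_mono_AE, use AE_iter_nonneg[OF t] in eventually_elim)
    case (elim s)
    show ?case
    proof (cases "fst (snd s) < t")
      case False
      then have "body t s = return borel s"
        by (intro body_exited) (simp add: exited_def)
      with False show ?thesis using exit[of s] by (simp add: nn_integral_return)
    qed (use elim step in auto)
  qed
  also have "\<dots> = q * (\<integral>\<^sup>+s. G s \<partial>loop_iter (body t) n (0, 0, 0))"
    by (simp add: nn_integral_cmult)
  also have "\<dots> \<le> q * (q ^ n * G (0, 0, 0))"
    by (intro mult_left_mono Suc) simp
  finally show ?case by (simp add: mult.assoc)
qed

section \<open>The state in which the loop is left, and Procedure P for t \<le> r\<close>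

definition final :: "real \<Rightarrow> state measure" where
  "final t = loop_law (body t) (exited t) (0, 0, 0)"

lemma sets_final [simp, measurable_cong]: "sets (final t) = sets borel"
  and space_final [simp]: "space (final t) = UNIV"
  by (simp_all add: final_def)

text \<open>Termination: the probability of still running after n passages is at most the mean of
  the exponential, which decays like \<open>\<phi> ^ n\<close>.\<close>

lemma prob_final:
  assumes t: "ereal t \<le> r"
  shows "prob_space (final t)"
  unfolding final_def
proof (rule loop.prob_loop_law[OF prob_iter])
  have m: "(\<lambda>s :: state. lyap t (fst (snd s))) \<in> borel_measurable borel"
    unfolding borel_prod[symmetric] by measurable
  have le: "emeasure (loop_iter (body t) n (0, 0, 0)) (- exited t) \<le> ennreal (\<phi> ^ n) * lyap t 0" for n
  proof -
    have "emeasure (loop_iter (body t) n (0, 0, 0)) (- exited t) =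
        (\<integral>\<^sup>+s. indicator (- exited t) s \<partial>loop_iter (body t) n (0, 0, 0))"
      using exited_sets by simp
    also have "\<dots> \<le> (\<integral>\<^sup>+s. lyap t (fst (snd s)) \<partial>loop_iter (body t) n (0, 0, 0))"
      by (intro nn_integral_mono) (auto intro: lyap_ge_1 simp: exited_def split: split_indicator)
    also have "\<dots> \<le> ennreal \<phi> ^ n * lyap t (fst (snd ((0, 0, 0) :: state)))"
      by (rule iter_bound[where G = "\<lambda>s. lyap t (fst (snd s))", OF t m body_lyap_decay[OF _ _ t]])
        (simp_all add: lyap_def)
    finally show ?thesis using contraction_bounds by (simp add: ennreal_power)
  qed
  have lim: "(\<lambda>n. ennreal (\<phi> ^ n) * lyap t 0) \<longlonglongrightarrow> 0"
  proof -
    have "(\<lambda>n. ennreal (\<phi> ^ n)) \<longlonglongrightarrow> ennreal 0"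
      using contraction_bounds by (intro tendsto_ennrealI LIMSEQ_power_zero) auto
    then have "(\<lambda>n. ennreal (\<phi> ^ n) * lyap t 0) \<longlonglongrightarrow> ennreal 0 * lyap t 0"
      by (intro tendsto_mult_ennreal tendsto_const) (auto simp: lyap_def)
    then show ?thesis by simp
  qed
  show "(\<lambda>n. emeasure (loop_iter (body t) n (0, 0, 0)) (- exited t)) \<longlonglongrightarrow> 0"
    by (rule tendsto_sandwich[OF always_eventually always_eventually tendsto_const lim])
      (intro allI zero_le le)+
qed

lemma AE_final:
  assumes t: "ereal t \<le> r"
  shows "AE s in final t. t \<le> fst (snd s) \<and> 0 \<le> snd (snd s)"
  unfolding final_def
proof (rule loop.AE_loop_law)
  have "closed {s :: state. t \<le> fst (snd s) \<and> 0 \<le> snd (snd s)}"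
    by (intro closed_Collect_conj closed_Collect_le continuous_intros)
  then show "Measurable.pred (borel :: state measure) (\<lambda>s. t \<le> fst (snd s) \<and> 0 \<le> snd (snd s))"
    by (simp add: pred_def borel_closed)
  show "AE s in loop_iter (body t) n (0, 0, 0). s \<in> exited t \<longrightarrow> t \<le> fst (snd s) \<and> 0 \<le> snd (snd s)" for n
    using AE_iter_nonneg[OF t] by eventually_elim (simp add: exited_def)
qed

text \<open>The summand 1 preserves the weight after exit, where the exponential is 0; the right
  side dominates the starting value of the supermartingale.\<close>

lemma final_bound:
  assumes K: "admissible K p" and t: "ereal t \<le> r"
  shows "(\<integral>\<^sup>+s. weight K p (snd (snd s)) \<partial>final t) \<le> 1 + ennreal (exp t)"
  unfolding final_def
proof (rule loop.nn_integral_loop_law_le)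
  have [measurable]: "(\<lambda>s :: state. lyap t (fst (snd s))) \<in> borel_measurable borel"
    "(\<lambda>s :: state. weight K p (snd (snd s))) \<in> borel_measurable borel"
    unfolding borel_prod[symmetric] by measurable
  show "(\<lambda>s :: state. weight K p (snd (snd s))) \<in> borel_measurable borel" by measurable
  have m: "(\<lambda>s :: state. weight K p (snd (snd s)) * (1 + lyap t (fst (snd s)))) \<in> borel_measurable borel"
    unfolding borel_prod[symmetric] by measurable
  fix n
  have "(\<integral>\<^sup>+s. weight K p (snd (snd s)) * indicator (exited t) s \<partial>loop_iter (body t) n (0, 0, 0))
      \<le> (\<integral>\<^sup>+s. weight K p (snd (snd s)) * (1 + lyap t (fst (snd s))) \<partial>loop_iter (body t) n (0, 0, 0))"
    by (intro nn_integral_mono mult_left_mono) (auto split: split_indicator)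
  also have "\<dots> \<le> 1 ^ n * (weight K p (snd (snd ((0, 0, 0) :: state))) * (1 + lyap t (fst (snd ((0, 0, 0) :: state)))))"
  proof (rule iter_bound[where G = "\<lambda>s. weight K p (snd (snd s)) * (1 + lyap t (fst (snd s)))", OF t])
    fix s :: state assume "fst (snd s) < t" "0 \<le> fst (snd s)"
    then show "(\<integral>\<^sup>+s'. weight K p (snd (snd s')) * (1 + lyap t (fst (snd s'))) \<partial>body t s)
        \<le> 1 * (weight K p (snd (snd s)) * (1 + lyap t (fst (snd s))))"
      unfolding mult_1 by (rule body_admissible[OF K _ _ t])
  qed (use m in simp_all)
  also have "\<dots> \<le> 1 + ennreal (exp t)"
    by (simp add: lyap_def)
  finally show "(\<integral>\<^sup>+s. weight K p (snd (snd s)) * indicator (exited t) s \<partial>loop_iter (body t) n (0, 0, 0))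
    \<le> 1 + ennreal (exp t)" .
qed

abbreviation (input) P_le :: "real \<Rightarrow> state measure" where
  "P_le \<equiv> procP_le \<theta> \<alpha> r \<zeta> \<kappa> TS WS"

lemma procP_le_final:
  "P_le t = final t \<bind> (\<lambda>s. return borel (fst s, fst (snd s) - t, snd (snd s) + 2))"
proof -
  have "exited t = {(x, v, c). t - v \<le> 0}" by (auto simp: exited_def)
  then show ?thesis by (simp only: procP_le_def case_prod_beta' final_def)
qed

lemma procP_le_kernel: "P_le \<in> borel \<rightarrow>\<^sub>M subprob_algebra borel"
proof -
  have [measurable]: "final \<in> borel \<rightarrow>\<^sub>M subprob_algebra (borel \<Otimes>\<^sub>M borel \<Otimes>\<^sub>M borel)"
    unfolding borel_prod final_def[abs_def]
    by (rule loop_law_kernel[OF body_kernel exited_sets(1) body_exited])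
  have "(\<lambda>t. final t \<bind> (\<lambda>s. return (borel \<Otimes>\<^sub>M borel \<Otimes>\<^sub>M borel) (fst s, fst (snd s) - t, snd (snd s) + 2)))
      \<in> borel \<rightarrow>\<^sub>M subprob_algebra (borel \<Otimes>\<^sub>M borel \<Otimes>\<^sub>M borel)"
    by measurable
  then show ?thesis
    by (simp add: procP_le_final[abs_def] borel_prod)
qed

lemma shift_measurable [measurable]:
  "(\<lambda>s. (fst s, fst (snd s) - t, snd (snd s) + 2)) \<in> final t \<rightarrow>\<^sub>M borel"
  by (simp add: measurable_cong_sets[OF sets_final refl] flip: borel_prod)

lemma procP_le_distr: "P_le t = distr (final t) borel (\<lambda>s. (fst s, fst (snd s) - t, snd (snd s) + 2))"
  unfolding procP_le_final by (rule bind_return_distr') simp_all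

lemma prob_procP_le: "ereal t \<le> r \<Longrightarrow> prob_space (P_le t)"
  unfolding procP_le_distr by (intro prob_space.prob_space_distr prob_final shift_measurable)

lemma AE_procP_le: "ereal t \<le> r \<Longrightarrow> AE s in P_le t. 0 \<le> fst (snd s) \<and> 0 \<le> snd (snd s)"
  unfolding procP_le_distr
  by (subst AE_distr_iff[OF shift_measurable]) (use nonneg_pred in \<open>auto simp: pred_def dest!: AE_final\<close>)

lemma procP_le_weight:
  assumes K: "admissible K p" and t: "ereal t \<le> r"
  shows "(\<integral>\<^sup>+s. weight K p (snd (snd s)) \<partial>P_le t) \<le> weight K p 2 * (1 + ennreal (exp t))"
proof -
  have m: "(\<lambda>s :: state. weight K p (snd (snd s))) \<in> borel_measurable borel"
    unfolding borel_prod[symmetric] by measurable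
  have "(\<integral>\<^sup>+s. weight K p (snd (snd s)) \<partial>P_le t) = (\<integral>\<^sup>+s. weight K p (snd (snd s) + 2) \<partial>final t)"
    unfolding procP_le_distr using m by (subst nn_integral_distr) simp_all
  also have "\<dots> \<le> (\<integral>\<^sup>+s. weight K p 2 * weight K p (snd (snd s)) \<partial>final t)"
    by (intro nn_integral_mono) (metis add.commute weight_add_le)
  also have "\<dots> = weight K p 2 * (\<integral>\<^sup>+s. weight K p (snd (snd s)) \<partial>final t)"
    using m by (intro nn_integral_cmult) (simp cong: measurable_cong_sets)
  also have "\<dots> \<le> weight K p 2 * (1 + ennreal (exp t))"
    by (intro mult_left_mono final_bound K t) simp
  finally show ?thesis .
qed

lemma procP_le_mean:
  assumes t: "ereal t \<le> r"
  shows "(\<integral>\<^sup>+s. ennreal (snd (snd s)) \<partial>P_le t) \<le> ennreal (2 + 4 * (\<CC> + 9 + \<kappa>) / (1 - \<phi>) * exp t)"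
proof -
  define K where "K = 4 * (\<CC> + 9 + \<kappa>) / (1 - \<phi>)"
  have K: "admissible K 1" unfolding K_def by (rule admissible_mean)
  then have K0: "0 < K" by (simp add: admissible_def)
  interpret prob_space "final t" by (rule prob_final[OF t])
  have m[measurable]: "(\<lambda>s :: state. ennreal (snd (snd s))) \<in> borel_measurable borel"
    unfolding borel_prod[symmetric] by measurable
  have "(\<integral>\<^sup>+s. weight K 1 (snd (snd s)) \<partial>final t) = 1 + ennreal (1 / K) * (\<integral>\<^sup>+s. ennreal (snd (snd s)) \<partial>final t)"
    unfolding weight_1_eq[OF K0] using emeasure_space_1 by (simp add: nn_integral_add nn_integral_cmult)
  with final_bound[OF K t] have "1 + ennreal (1 / K) * (\<integral>\<^sup>+s. ennreal (snd (snd s)) \<partial>final t) \<le> 1 + ennreal (exp t)"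
    by (simp only:)
  \<comment> \<open>The two summands 1 cancel. What remains is linear in K, hence in \<CC>, with the
    factor \<open>exp t\<close> as the only trace of the time.\<close>
  then have "ennreal (1 / K) * (\<integral>\<^sup>+s. ennreal (snd (snd s)) \<partial>final t) \<le> ennreal (exp t)"
    by (simp add: ennreal_add_left_cancel_le)
  then have "ennreal K * (ennreal (1 / K) * (\<integral>\<^sup>+s. ennreal (snd (snd s)) \<partial>final t)) \<le> ennreal K * ennreal (exp t)"
    by (rule mult_left_mono) simp
  also have "ennreal K * (ennreal (1 / K) * (\<integral>\<^sup>+s. ennreal (snd (snd s)) \<partial>final t)) = (\<integral>\<^sup>+s. ennreal (snd (snd s)) \<partial>final t)"
    using K0 by (simp add: mult.assoc[symmetric] ennreal_mult[symmetric])
  finally have final: "(\<integral>\<^sup>+s. ennreal (snd (snd s)) \<partial>final t) \<le> ennreal K * ennreal (exp t)" .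
  have "(\<integral>\<^sup>+s. ennreal (snd (snd s)) \<partial>P_le t) = (\<integral>\<^sup>+s. ennreal (snd (snd s) + 2) \<partial>final t)"
    unfolding procP_le_distr by (subst nn_integral_distr) simp_all
  also have "\<dots> \<le> (\<integral>\<^sup>+s. ennreal (snd (snd s)) + 2 \<partial>final t)"
    by (intro nn_integral_mono) (metis ennreal_add_le ennreal_numeral)
  also have "\<dots> = (\<integral>\<^sup>+s. ennreal (snd (snd s)) \<partial>final t) + 2"
    using emeasure_space_1 by (simp add: nn_integral_add)
  also have "\<dots> \<le> ennreal K * ennreal (exp t) + 2" by (intro add_right_mono final)
  also have "\<dots> = ennreal (2 + K * exp t)"
    using K0 by (simp add: ennreal_mult[symmetric] add.commute)
  finally show ?thesis by (simp only: K_def)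
qed

end

section \<open>The path procedure\<close>

definition path_step :: "(real \<Rightarrow> state measure) \<Rightarrow> real \<Rightarrow> state \<Rightarrow> state measure" where
  "path_step sub d s = (if d < fst (snd s) then return borel (fst s, fst (snd s) - d, snd (snd s) + 3)
     else sub (d - fst (snd s)) \<bind> (\<lambda>s'. return borel (fst s + fst s', fst (snd s'), snd (snd s) + 4 + snd (snd s'))))"

lemma path_proc_step: "path_proc sub t s (Suc i) = path_proc sub t s i \<bind> path_step sub (t (Suc i) - t i)"
  by (simp add: path_step_def[abs_def] case_prod_beta' Let_def cong del: if_weak_cong)

text \<open>Used twice: with the loop procedure as subroutine, for the pieces inside Procedure P,
  and with Procedure P itself.\<close>

locale path_sampler =
  fixes sub :: "real \<Rightarrow> state measure"
  assumes sub: "sub \<in> borel \<rightarrow>\<^sub>M subprob_algebra borel"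
begin

lemma path_step_kernel:
  "(\<lambda>(d, s). path_step sub d s) \<in> borel \<Otimes>\<^sub>M borel \<rightarrow>\<^sub>M subprob_algebra borel"
proof -
  have [measurable]: "sub \<in> borel \<rightarrow>\<^sub>M subprob_algebra (borel \<Otimes>\<^sub>M borel \<Otimes>\<^sub>M borel)"
    using sub by (simp add: borel_prod)
  show ?thesis
    unfolding path_step_def case_prod_beta' borel_prod[symmetric] by measurable
qed

lemma path_step_measurable [measurable]: "path_step sub d \<in> borel \<rightarrow>\<^sub>M subprob_algebra borel"
  using measurable_compose[OF measurable_Pair1'[of d borel borel] path_step_kernel] by simp

text \<open>The grid may depend on a parameter because Procedure P builds it from its argument,
  which is random when the path procedure supplies it.\<close>

lemma path_proc_kernel:
  assumes "\<And>i. (\<lambda>x. T x i) \<in> M \<rightarrow>\<^sub>M borel"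
  shows "(\<lambda>x. path_proc sub (T x) s n) \<in> M \<rightarrow>\<^sub>M subprob_algebra borel"
proof (induction n)
  case 0
  show ?case
    unfolding path_proc.simps
    by (intro measurable_const) (simp add: space_subprob_algebra prob_space_return prob_space_imp_subprob_space)
next
  case (Suc n)
  have "(\<lambda>z. (T (fst z) (Suc n) - T (fst z) n, snd z)) \<in> M \<Otimes>\<^sub>M borel \<rightarrow>\<^sub>M borel \<Otimes>\<^sub>M borel"
    using assms[of n] assms[of "Suc n"] by measurable
  from measurable_compose[OF this path_step_kernel] show ?case
    unfolding path_proc_step by (intro measurable_bind[OF Suc]) simp
qed

lemma path_space: "path_proc sub t s n \<in> space (subprob_algebra borel)"
  using measurable_space[OF path_proc_kernel[of "\<lambda>_. t" borel s n], of "0::real"] by simp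

lemma sets_path [simp, measurable_cong]: "sets (path_proc sub t s n) = sets borel"
  using path_space[of t s n] by (simp add: space_subprob_algebra)

lemma space_path [simp]: "space (path_proc sub t s n) = UNIV"
  using sets_eq_imp_space_eq[OF sets_path, of t s n] by simp

lemma path_step_path: "path_step sub d \<in> path_proc sub t s n \<rightarrow>\<^sub>M subprob_algebra borel"
  using path_step_measurable by (simp cong: measurable_cong_sets)

lemma sets_sub [simp, measurable_cong]: "sets (sub u) = sets borel"
  using measurable_space[OF sub, of u] by (simp add: space_subprob_algebra)

lemma space_sub [simp]: "space (sub u) = UNIV"
  using sets_eq_imp_space_eq[OF sets_sub, of u] by simp

lemma path_step_distr:
  "\<not> d < fst (snd s) \<Longrightarrow> path_step sub d s = distr (sub (d - fst (snd s))) borel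
     (\<lambda>s'. (fst s + fst s', fst (snd s'), snd (snd s) + 4 + snd (snd s')))"
  unfolding path_step_def
  by (simp, rule bind_return_distr') (simp_all add: measurable_cong_sets[OF sets_sub refl] flip: borel_prod)

lemma update_measurable: "(\<lambda>s'. (fst s + fst s', fst (snd s'), snd (snd s) + 4 + snd (snd s'))) \<in> sub u \<rightarrow>\<^sub>M borel"
  for s :: state
  by (simp add: measurable_cong_sets[OF sets_sub refl] flip: borel_prod)

text \<open>The restriction to a range of times is there for the loop procedure, whose properties
  are available up to time r.\<close>

definition valid_upto :: "real \<Rightarrow> bool" where
  "valid_upto d \<longleftrightarrow> (\<forall>u. 0 \<le> u \<and> u \<le> d \<longrightarrow>
     prob_space (sub u) \<and> (AE s in sub u. 0 \<le> fst (snd s) \<and> 0 \<le> snd (snd s)))"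

lemma prob_path_step:
  assumes "valid_upto d" "0 \<le> fst (snd s)"
  shows "prob_space (path_step sub d s)"
proof (cases "d < fst (snd s)")
  case True
  then show ?thesis by (simp add: path_step_def prob_space_return)
next
  case False
  then have "prob_space (sub (d - fst (snd s)))" using assms by (simp add: valid_upto_def)
  then show ?thesis
    unfolding path_step_distr[OF False] by (rule prob_space.prob_space_distr) (rule update_measurable)
qed

lemma AE_path_step:
  assumes "valid_upto d" "0 \<le> fst (snd s) \<and> 0 \<le> snd (snd s)"
  shows "AE s' in path_step sub d s. 0 \<le> fst (snd s') \<and> 0 \<le> snd (snd s')"
proof (cases "d < fst (snd s)")
  case True
  then show ?thesis
    unfolding path_step_def using assms(2)
    by (simp only: if_True, subst AE_return) (simp_all add: nonneg_pred)
next
  case False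
  have "AE s' in sub (d - fst (snd s)). 0 \<le> fst (snd s') \<and> 0 \<le> snd (snd s')"
    using assms False by (simp add: valid_upto_def)
  then have "AE s' in sub (d - fst (snd s)). 0 \<le> fst (snd s') \<and> 0 \<le> snd (snd s) + 4 + snd (snd s')"
    by eventually_elim (use assms in auto)
  then show ?thesis
    unfolding path_step_distr[OF False] using nonneg_pred
    by (subst AE_distr_iff[OF update_measurable]) (simp_all add: pred_def)
qed

text \<open>The sign is part of the induction: a nonnegative remaining lifetime keeps the argument
  of the next call between 0 and the increment.\<close>

lemma path_nonneg_prob:
  assumes "\<And>i. i < n \<Longrightarrow> valid_upto (t (Suc i) - t i)" and "0 \<le> snd s0"
  shows "prob_space (path_proc sub t s0 n) \<and>
    (AE s in path_proc sub t s0 n. 0 \<le> fst (snd s) \<and> 0 \<le> snd (snd s))"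
  using assms(1)
proof (induction n)
  case 0
  have ae: "AE s in return borel (fst s0, snd s0, 0 :: real). 0 \<le> fst (snd s) \<and> 0 \<le> snd (snd s)"
    using assms(2) by (subst AE_return) (simp_all add: nonneg_pred)
  show ?case
    unfolding path_proc.simps by (rule conjI[OF prob_space_return ae]) simp
next
  case (Suc n)
  let ?d = "t (Suc n) - t n"
  have IH: "prob_space (path_proc sub t s0 n)"
    "AE s in path_proc sub t s0 n. 0 \<le> fst (snd s) \<and> 0 \<le> snd (snd s)"
    using Suc by auto
  have d: "valid_upto ?d" using Suc by simp
  have "prob_space (path_proc sub t s0 (Suc n))"
    unfolding path_proc_step
  proof (rule prob_space.prob_space_bind[OF IH(1) _ path_step_path])
    show "AE s in path_proc sub t s0 n. prob_space (path_step sub ?d s)"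
      using IH(2) by eventually_elim (auto intro: prob_path_step[OF d])
  qed
  moreover have "AE s in path_proc sub t s0 (Suc n). 0 \<le> fst (snd s) \<and> 0 \<le> snd (snd s)"
    unfolding path_proc_step AE_bind[OF path_step_path nonneg_pred]
    using IH(2) by eventually_elim (rule AE_path_step[OF d])
  ultimately show ?case by blast
qed

lemma nn_integral_path_step:
  assumes "g \<in> borel_measurable borel"
  shows "(\<integral>\<^sup>+s'. g (snd (snd s')) \<partial>path_step sub d s) = (if d < fst (snd s) then g (snd (snd s) + 3)
     else \<integral>\<^sup>+s'. g (snd (snd s) + 4 + snd (snd s')) \<partial>sub (d - fst (snd s)))"
proof -
  have m: "(\<lambda>s' :: state. g (snd (snd s'))) \<in> borel_measurable borel"
    unfolding borel_prod[symmetric] using assms by measurable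
  show ?thesis
  proof (cases "d < fst (snd s)")
    case True
    then show ?thesis using m by (simp add: path_step_def nn_integral_return)
  next
    case False
    then show ?thesis
      unfolding path_step_distr[OF False] using m
      by (subst nn_integral_distr[OF update_measurable]) simp_all
  qed
qed

text \<open>Submultiplicativity yields one factor per step. A step without a call costs 3 instead of
  4 and is covered by the same factor because \<open>B \<ge> 1\<close>. The bound is exponential in
  n, which is enough for finiteness.\<close>

lemma path_weight:
  assumes valid: "\<And>i. i < n \<Longrightarrow> valid_upto (t (Suc i) - t i)" and s0: "0 \<le> snd s0"
    and B: "1 \<le> B" "\<And>i u. i < n \<Longrightarrow> 0 \<le> u \<Longrightarrow> u \<le> t (Suc i) - t i \<Longrightarrow>
      (\<integral>\<^sup>+s. weight 1 p (snd (snd s)) \<partial>sub u) \<le> B"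
  shows "(\<integral>\<^sup>+s. weight 1 p (snd (snd s)) \<partial>path_proc sub t s0 n) \<le> (weight 1 p 4 * B) ^ n"
  using valid B(2)
proof (induction n)
  case 0
  have "(\<lambda>s :: state. weight 1 p (snd (snd s))) \<in> borel_measurable borel"
    unfolding borel_prod[symmetric] by measurable
  then show ?case by (simp add: nn_integral_return)
next
  case (Suc n)
  let ?W = "weight 1 p" and ?P = "path_proc sub t s0 n" and ?d = "t (Suc n) - t n"
  have m[measurable]: "(\<lambda>s :: state. ?W (snd (snd s))) \<in> borel_measurable borel"
    unfolding borel_prod[symmetric] by measurable
  have "AE s in ?P. 0 \<le> fst (snd s) \<and> 0 \<le> snd (snd s)"
    using path_nonneg_prob[of n t s0] Suc.prems s0 by simp
  then have "(\<integral>\<^sup>+s. ?W (snd (snd s)) \<partial>path_proc sub t s0 (Suc n)) \<le> (\<integral>\<^sup>+s. (?W 4 * B) * ?W (snd (snd s)) \<partial>?P)"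
    unfolding path_proc_step nn_integral_bind[OF m path_step_path] nn_integral_path_step[OF weight_measurable]
  proof (intro nn_integral_mono_AE, eventually_elim)
    case (elim s)
    have 4: "?W (snd (snd s) + 4 + c) \<le> (?W 4 * ?W (snd (snd s))) * ?W c" for c
    proof -
      have "?W (snd (snd s) + 4 + c) \<le> ?W (snd (snd s) + 4) * ?W c" by (rule weight_add_le)
      also have "\<dots> \<le> (?W (snd (snd s)) * ?W 4) * ?W c" by (intro mult_right_mono weight_add_le) simp
      finally show ?thesis by (simp add: mult_ac)
    qed
    show ?case
    proof (cases "?d < fst (snd s)")
      case True
      have "?W (snd (snd s) + 3) \<le> ?W (snd (snd s) + 4 + 0)" by (intro weight_mono) auto
      also have "\<dots> \<le> (?W 4 * ?W (snd (snd s))) * ?W 0" by (rule 4)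
      also have "\<dots> \<le> (?W 4 * ?W (snd (snd s))) * B" using B(1) by (intro mult_left_mono) auto
      finally show ?thesis using True by (simp add: mult_ac)
    next
      case False
      have "(\<integral>\<^sup>+s'. ?W (snd (snd s) + 4 + snd (snd s')) \<partial>sub (?d - fst (snd s)))
          \<le> (\<integral>\<^sup>+s'. (?W 4 * ?W (snd (snd s))) * ?W (snd (snd s')) \<partial>sub (?d - fst (snd s)))"
        by (intro nn_integral_mono 4)
      also have "\<dots> = (?W 4 * ?W (snd (snd s))) * (\<integral>\<^sup>+s'. ?W (snd (snd s')) \<partial>sub (?d - fst (snd s)))"
        by (rule nn_integral_cmult) measurable
      also have "\<dots> \<le> (?W 4 * ?W (snd (snd s))) * B"
        using Suc.prems(2)[of n] elim False by (intro mult_left_mono) auto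
      finally show ?thesis using False by (simp add: mult_ac)
    qed
  qed
  also have "\<dots> = (?W 4 * B) * (\<integral>\<^sup>+s. ?W (snd (snd s)) \<partial>?P)"
    by (rule nn_integral_cmult) measurable
  also have "\<dots> \<le> (?W 4 * B) * (?W 4 * B) ^ n"
    by (rule mult_left_mono[OF Suc.IH[OF Suc.prems(1)[OF less_SucI] Suc.prems(2)[OF less_SucI]]]) simp_all
  finally show ?case by simp
qed

text \<open>Mean costs add up over the steps, so each step keeps its own bound; this is the origin
  of the term 4 n and of the sum of ceilings.\<close>

lemma path_mean:
  assumes valid: "\<And>i. i < n \<Longrightarrow> valid_upto (t (Suc i) - t i)" and s0: "0 \<le> snd s0"
    and B: "\<And>i. 0 \<le> B i" "\<And>i u. i < n \<Longrightarrow> 0 \<le> u \<Longrightarrow> u \<le> t (Suc i) - t i \<Longrightarrow>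
      (\<integral>\<^sup>+s. ennreal (snd (snd s)) \<partial>sub u) \<le> ennreal (B i)"
  shows "(\<integral>\<^sup>+s. ennreal (snd (snd s)) \<partial>path_proc sub t s0 n) \<le> ennreal (4 * real n + (\<Sum>i<n. B i))"
  using valid B(2)
proof (induction n)
  case 0
  have "(\<lambda>s :: state. ennreal (snd (snd s))) \<in> borel_measurable borel"
    unfolding borel_prod[symmetric] by measurable
  then show ?case by (simp add: nn_integral_return)
next
  case (Suc n)
  let ?P = "path_proc sub t s0 n" and ?d = "t (Suc n) - t n"
  have m[measurable]: "(\<lambda>s :: state. ennreal (snd (snd s))) \<in> borel_measurable borel"
    unfolding borel_prod[symmetric] by measurable
  have P: "prob_space ?P" "AE s in ?P. 0 \<le> fst (snd s) \<and> 0 \<le> snd (snd s)"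
    using path_nonneg_prob[of n t s0] Suc.prems s0 by simp_all
  have d: "valid_upto ?d" using Suc.prems by simp
  have "(\<integral>\<^sup>+s. ennreal (snd (snd s)) \<partial>path_proc sub t s0 (Suc n))
      \<le> (\<integral>\<^sup>+s. ennreal (snd (snd s)) + ennreal (4 + B n) \<partial>?P)"
    unfolding path_proc_step nn_integral_bind[OF m path_step_path]
      nn_integral_path_step[OF measurable_ennreal]
  proof (intro nn_integral_mono_AE, use P(2) in eventually_elim)
    case (elim s)
    show ?case
    proof (cases "?d < fst (snd s)")
      case True
      then show ?thesis using elim B(1)[of n] by (simp add: ennreal_leI flip: ennreal_plus)
    next
      case False
      then have S: "prob_space (sub (?d - fst (snd s)))"
        using elim d by (simp add: valid_upto_def)
      have "(\<integral>\<^sup>+s'. ennreal (snd (snd s) + 4 + snd (snd s')) \<partial>sub (?d - fst (snd s)))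
          \<le> (\<integral>\<^sup>+s'. ennreal (snd (snd s) + 4) + ennreal (snd (snd s')) \<partial>sub (?d - fst (snd s)))"
        by (intro nn_integral_mono ennreal_add_le)
      also have "\<dots> = ennreal (snd (snd s) + 4) + (\<integral>\<^sup>+s'. ennreal (snd (snd s')) \<partial>sub (?d - fst (snd s)))"
        using prob_space.emeasure_space_1[OF S] by (simp add: nn_integral_add)
      also have "\<dots> \<le> ennreal (snd (snd s) + 4) + ennreal (B n)"
        using Suc.prems(2)[of n] elim False by (intro add_left_mono) auto
      also have "\<dots> = ennreal (snd (snd s)) + ennreal (4 + B n)"
        using elim B(1)[of n] by (simp add: add.assoc flip: ennreal_plus)
      finally show ?thesis using False by simp
    qed
  qed
  also have "\<dots> = (\<integral>\<^sup>+s. ennreal (snd (snd s)) \<partial>?P) + ennreal (4 + B n)"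
    using prob_space.emeasure_space_1[OF P(1)] by (simp add: nn_integral_add)
  also have "\<dots> \<le> ennreal (4 * real n + (\<Sum>i<n. B i)) + ennreal (4 + B n)"
    by (rule add_right_mono[OF Suc.IH[OF Suc.prems(1)[OF less_SucI] Suc.prems(2)[OF less_SucI]]]) simp_all
  also have "\<dots> = ennreal (4 * real (Suc n) + (\<Sum>i<Suc n. B i))"
    using B(1) by (subst ennreal_plus[symmetric]) (auto intro!: add_nonneg_nonneg sum_nonneg simp: algebra_simps)
  finally show ?case .
qed

end

section \<open>From integrals over states to moments of the running time\<close>

lemma finite_moments_running_time:
  assumes \<mu>: "prob_space \<mu>" "sets \<mu> = sets borel" and nn: "AE s in \<mu>. 0 \<le> snd (snd s)"
    and bound: "\<And>p. (\<integral>\<^sup>+s. weight 1 p (snd (snd s)) \<partial>\<mu>) < \<infinity>"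
  shows "finite_moments (running_time \<mu>)"
proof -
  have m[measurable]: "(\<lambda>s. snd (snd s)) \<in> borel_measurable \<mu>"
    by (simp add: measurable_cong_sets[OF \<mu>(2) refl] flip: borel_prod)
  have rt: "running_time \<mu> = distr \<mu> borel (\<lambda>s. snd (snd s))"
    by (simp add: running_time_def case_prod_beta')
  have "integrable \<mu> (\<lambda>s. snd (snd s) ^ p)" for p
  proof (rule integrableI_nonneg)
    show "AE s in \<mu>. 0 \<le> snd (snd s) ^ p" using nn by eventually_elim simp
    have "(\<integral>\<^sup>+s. ennreal (snd (snd s) ^ p) \<partial>\<mu>) \<le> (\<integral>\<^sup>+s. weight 1 p (snd (snd s)) \<partial>\<mu>)"
      using nn
    proof (intro nn_integral_mono_AE, eventually_elim)
      case (elim s)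
      then show ?case by (simp add: weight_eq ennreal_leI power_mono)
    qed
    also have "\<dots> < \<infinity>" by (rule bound)
    finally show "(\<integral>\<^sup>+s. ennreal (snd (snd s) ^ p) \<partial>\<mu>) < \<infinity>" .
  qed measurable
  then show ?thesis
    unfolding finite_moments_def rt using nn
    by (auto simp: prob_space.prob_space_distr[OF \<mu>(1) m] AE_distr_iff integrable_distr_eq)
qed

lemma integral_running_time_le:
  assumes \<mu>: "sets \<mu> = sets borel" and nn: "AE s in \<mu>. 0 \<le> snd (snd s)"
    and m: "0 \<le> m" "(\<integral>\<^sup>+s. ennreal (snd (snd s)) \<partial>\<mu>) \<le> ennreal m"
  shows "(LINT c|running_time \<mu>. c) \<le> m"
proof -
  have m'[measurable]: "(\<lambda>s. snd (snd s)) \<in> borel_measurable \<mu>"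
    by (simp add: measurable_cong_sets[OF \<mu> refl] flip: borel_prod)
  have "(LINT c|running_time \<mu>. c) = (LINT s|\<mu>. snd (snd s))"
    by (simp add: running_time_def case_prod_beta' integral_distr)
  also have "\<dots> \<le> m"
    using m by (intro integral_real_bounded) auto
  finally show ?thesis .
qed

section \<open>Running times\<close>

text \<open>Returns from the scale K, at which the supermartingale works, to the scale 1 common to
  all steps, at the price of a constant factor.\<close>

lemma weight_1_scale:
  assumes "0 < K"
  shows "weight 1 p c \<le> ennreal (max 1 K) ^ p * weight K p c"
proof -
  have "ennreal c = ennreal K * ennreal (c / K)"
    using assms by (cases "0 \<le> c") (simp_all add: ennreal_mult[symmetric] ennreal_neg divide_nonpos_pos)
  also have "\<dots> \<le> ennreal (max 1 K) * ennreal (c / K)"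
    by (intro mult_right_mono ennreal_leI) auto
  finally have "1 + ennreal (c / 1) \<le> ennreal (max 1 K) * (1 + ennreal (c / K))"
    using ennreal_leI[of 1 "max 1 K"] by (simp add: distrib_left add_mono)
  then show ?thesis
    unfolding weight_def power_mult_distrib[symmetric] by (intro power_mono) auto
qed

lemma ceil_ratio_mono: "s \<le> t \<Longrightarrow> 0 < r \<Longrightarrow> ceil_ratio s r \<le> ceil_ratio t r"
  unfolding ceil_ratio_def by (cases r) (auto intro!: ceiling_mono divide_right_mono)

lemma ceil_ratio_ge_1: "0 < t \<Longrightarrow> 0 < r \<Longrightarrow> 1 \<le> ceil_ratio t r"
  unfolding ceil_ratio_def by (cases r) (auto simp: one_le_ceiling)

text \<open>Rounding up makes k at least t / r, so each piece is at most r long and lies in the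
  range of the loop procedure.\<close>

lemma grid_step_le:
  assumes "0 < r" "r < ereal t"
  shows "0 < nat (ceil_ratio t r)" "t / real (nat (ceil_ratio t r)) \<le> t"
    "ereal (t / real (nat (ceil_ratio t r))) \<le> r"
proof -
  obtain q where r: "r = ereal q" "0 < q" "q < t" using assms by (cases r) auto
  define k where "k = nat \<lceil>t / q\<rceil>"
  have k: "t / q \<le> real k" unfolding k_def by (rule real_nat_ceiling_ge)
  have "0 < t / q" using r by simp
  then have k0: "0 < k" using k by (cases k) auto
  have eq: "nat (ceil_ratio t r) = k" by (simp add: ceil_ratio_def k_def r)
  have "t / real k \<le> q"
    using k k0 r by (simp add: field_simps)
  moreover have "t / real k \<le> t"
    using k0 r by (simp add: divide_le_eq)
  ultimately show "0 < nat (ceil_ratio t r)" "t / real (nat (ceil_ratio t r)) \<le> t"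
    "ereal (t / real (nat (ceil_ratio t r))) \<le> r"
    unfolding eq using k0 r by simp_all
qed

context samplers
begin

sublocale P_le: path_sampler P_le
  by unfold_locales (rule procP_le_kernel)

section \<open>Procedure P for all times, assembled from pieces when t > r\<close>

abbreviation (input) P :: "real \<Rightarrow> state measure" where
  "P \<equiv> procP \<theta> \<alpha> r \<zeta> \<kappa> TS WS"

definition grid :: "real \<Rightarrow> nat \<Rightarrow> nat \<Rightarrow> real" where
  "grid t k i = real i / real k * t"

lemma grid_step: "0 < k \<Longrightarrow> grid t k (Suc i) - grid t k i = t / real k"
  by (simp add: grid_def field_simps)

definition pieces :: "nat \<Rightarrow> real \<Rightarrow> state measure" where
  "pieces k t = path_proc P_le (grid t k) (0, 0) k"

lemma sets_pieces [simp, measurable_cong]: "sets (pieces k t) = sets borel"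
  and space_pieces [simp]: "space (pieces k t) = UNIV"
  by (simp_all add: pieces_def)

lemma procP_eq: "P t = (if ereal t \<le> r then P_le t else
   let k = nat (ceil_ratio t r) in pieces k t \<bind> (\<lambda>s. return borel (fst s, fst (snd s), snd (snd s) + 2 + real k)))"
  by (simp add: procP_def Let_def pieces_def grid_def[abs_def] case_prod_beta')

text \<open>The number of pieces varies with t but takes countably many values and is measurable, so
  measurability for each fixed k suffices.\<close>

lemma procP_kernel: "P \<in> borel \<rightarrow>\<^sub>M subprob_algebra borel"
proof -
  have [measurable]: "P_le \<in> borel \<rightarrow>\<^sub>M subprob_algebra (borel \<Otimes>\<^sub>M borel \<Otimes>\<^sub>M borel)"
    using procP_le_kernel by (simp add: borel_prod)
  have [measurable]: "(\<lambda>t. pieces k t) \<in> borel \<rightarrow>\<^sub>M subprob_algebra (borel \<Otimes>\<^sub>M borel \<Otimes>\<^sub>M borel)" for k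
    unfolding pieces_def borel_prod by (rule P_le.path_proc_kernel) (simp add: grid_def)
  have ceil[measurable]: "(\<lambda>t. nat (ceil_ratio t r)) \<in> borel \<rightarrow>\<^sub>M count_space UNIV"
    unfolding ceil_ratio_def by measurable
  have "(\<lambda>t. pieces k t \<bind> (\<lambda>s. return (borel \<Otimes>\<^sub>M borel \<Otimes>\<^sub>M borel) (fst s, fst (snd s), snd (snd s) + 2 + real k)))
      \<in> borel \<rightarrow>\<^sub>M subprob_algebra (borel \<Otimes>\<^sub>M borel \<Otimes>\<^sub>M borel)" for k
    by measurable
  from measurable_compose_countable[OF this ceil]
  have [measurable]: "(\<lambda>t. pieces (nat (ceil_ratio t r)) t \<bind> (\<lambda>s. return (borel \<Otimes>\<^sub>M borel \<Otimes>\<^sub>M borel)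
       (fst s, fst (snd s), snd (snd s) + 2 + real (nat (ceil_ratio t r)))))
      \<in> borel \<rightarrow>\<^sub>M subprob_algebra (borel \<Otimes>\<^sub>M borel \<Otimes>\<^sub>M borel)" .
  have "(\<lambda>t. if ereal t \<le> r then P_le t else pieces (nat (ceil_ratio t r)) t \<bind> (\<lambda>s. return (borel \<Otimes>\<^sub>M borel \<Otimes>\<^sub>M borel)
       (fst s, fst (snd s), snd (snd s) + 2 + real (nat (ceil_ratio t r)))))
      \<in> borel \<rightarrow>\<^sub>M subprob_algebra (borel \<Otimes>\<^sub>M borel \<Otimes>\<^sub>M borel)"
    by measurable
  then show ?thesis
    unfolding procP_eq[abs_def] Let_def borel_prod .
qed

sublocale P: path_sampler P
  by unfold_locales (rule procP_kernel)

lemma add_cost_measurable: "(\<lambda>s. (fst s, fst (snd s), snd (snd s) + a)) \<in> pieces k t \<rightarrow>\<^sub>M borel"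
  by (simp add: measurable_cong_sets[OF sets_pieces refl] flip: borel_prod)

lemma procP_gt:
  assumes "r < ereal t"
  shows "P t = distr (pieces (nat (ceil_ratio t r)) t) borel
     (\<lambda>s. (fst s, fst (snd s), snd (snd s) + (2 + real (nat (ceil_ratio t r)))))"
proof -
  have "P t = pieces (nat (ceil_ratio t r)) t \<bind>
      (\<lambda>s. return borel (fst s, fst (snd s), snd (snd s) + (2 + real (nat (ceil_ratio t r)))))"
    unfolding procP_eq Let_def using assms by (simp only: not_le[symmetric] if_False add.assoc)
  also have "\<dots> = distr (pieces (nat (ceil_ratio t r)) t) borel
     (\<lambda>s. (fst s, fst (snd s), snd (snd s) + (2 + real (nat (ceil_ratio t r)))))"
    by (rule bind_return_distr'[OF _ add_cost_measurable]) simp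
  finally show ?thesis .
qed

lemma nn_integral_procP_gt:
  assumes t: "r < ereal t" and g: "g \<in> borel_measurable borel"
  shows "(\<integral>\<^sup>+s. g (snd (snd s)) \<partial>P t) =
    (\<integral>\<^sup>+s. g (snd (snd s) + (2 + real (nat (ceil_ratio t r)))) \<partial>pieces (nat (ceil_ratio t r)) t)"
proof -
  have m: "(\<lambda>s' :: state. g (snd (snd s'))) \<in> borel_measurable borel"
    unfolding borel_prod[symmetric] using g by measurable
  show ?thesis
    unfolding procP_gt[OF t] using m by (subst nn_integral_distr[OF add_cost_measurable]) simp_all
qed

lemma P_le_valid:
  assumes "ereal d \<le> r"
  shows "P_le.valid_upto d"
  unfolding P_le.valid_upto_def
proof (intro allI impI)
  fix u assume "0 \<le> u \<and> u \<le> d"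
  then have "ereal u \<le> r" using assms order_trans[of "ereal u" "ereal d" r] by simp
  then show "prob_space (P_le u) \<and> (AE s in P_le u. 0 \<le> fst (snd s) \<and> 0 \<le> snd (snd s))"
    using prob_procP_le AE_procP_le by blast
qed

lemma pieces_valid:
  assumes "0 < r" "r < ereal t"
  shows "P_le.valid_upto (grid t (nat (ceil_ratio t r)) (Suc i) - grid t (nat (ceil_ratio t r)) i)"
  using grid_step_le[OF assms] by (simp add: grid_step P_le_valid)

context
  assumes r: "0 < r"
begin

lemma P_valid: "P.valid_upto d"
  unfolding P.valid_upto_def
proof (intro allI impI)
  fix t assume "0 \<le> t \<and> t \<le> d"
  show "prob_space (P t) \<and> (AE s in P t. 0 \<le> fst (snd s) \<and> 0 \<le> snd (snd s))"
  proof (cases "ereal t \<le> r")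
    case True
    then have "P t = P_le t" by (simp add: procP_eq)
    with prob_procP_le[OF True] AE_procP_le[OF True] show ?thesis by (simp only: simp_thms)
  next
    case False
    then have t: "r < ereal t" by simp
    let ?k = "nat (ceil_ratio t r)"
    have *: "prob_space (pieces ?k t)" "AE s in pieces ?k t. 0 \<le> fst (snd s) \<and> 0 \<le> snd (snd s)"
      unfolding pieces_def using P_le.path_nonneg_prob[where t = "grid t ?k" and ?s0.0 = "(0, 0)", OF pieces_valid[OF r t], of ?k]
      by simp_all
    have "AE s in pieces ?k t. 0 \<le> fst (snd s) \<and> 0 \<le> snd (snd s) + (2 + real ?k)"
      using *(2) by eventually_elim simp
    then have "AE s in P t. 0 \<le> fst (snd s) \<and> 0 \<le> snd (snd s)"
      unfolding procP_gt[OF t] using nonneg_pred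
      by (subst AE_distr_iff[OF add_cost_measurable]) (simp_all add: pred_def)
    then show ?thesis
      using prob_space.prob_space_distr[OF *(1) add_cost_measurable] by (simp add: procP_gt[OF t])
  qed
qed

lemma P_le_weight:
  "\<exists>B\<ge>1. B < \<infinity> \<and> (\<forall>u. u \<le> d \<and> ereal u \<le> r \<longrightarrow> (\<integral>\<^sup>+s. weight 1 p (snd (snd s)) \<partial>P_le u) \<le> B)"
proof -
  obtain K where K: "admissible K p" using admissible_exists by blast
  then have K0: "0 < K" by (simp add: admissible_def)
  define B where "B = max 1 (ennreal (max 1 K) ^ p * (weight K p 2 * (1 + ennreal (exp d))))"
  have "(\<integral>\<^sup>+s. weight 1 p (snd (snd s)) \<partial>P_le u) \<le> B" if u: "u \<le> d" "ereal u \<le> r" for u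
  proof -
    have m: "(\<lambda>s :: state. weight K p (snd (snd s))) \<in> borel_measurable (P_le u)"
      unfolding measurable_cong_sets[OF P_le.sets_sub refl] borel_prod[symmetric] by measurable
    have "(\<integral>\<^sup>+s. weight 1 p (snd (snd s)) \<partial>P_le u)
        \<le> (\<integral>\<^sup>+s. ennreal (max 1 K) ^ p * weight K p (snd (snd s)) \<partial>P_le u)"
      by (intro nn_integral_mono weight_1_scale K0)
    also have "\<dots> = ennreal (max 1 K) ^ p * (\<integral>\<^sup>+s. weight K p (snd (snd s)) \<partial>P_le u)"
      by (rule nn_integral_cmult[OF m])
    also have "\<dots> \<le> ennreal (max 1 K) ^ p * (weight K p 2 * (1 + ennreal (exp u)))"
      by (intro mult_left_mono procP_le_weight K u) simp
    also have "\<dots> \<le> ennreal (max 1 K) ^ p * (weight K p 2 * (1 + ennreal (exp d)))"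
      using u by (intro mult_left_mono add_left_mono ennreal_leI) auto
    finally show ?thesis by (simp add: B_def le_max_iff_disj)
  qed
  moreover have "B < \<infinity>"
    using weight_less_top[of K p 2]
    by (simp add: B_def ennreal_mult_less_top power_less_top_ennreal)
  ultimately show ?thesis
    by (intro exI[of _ B]) (auto simp: B_def)
qed

text \<open>Uniform over all u up to d, since a call inside the path procedure may use any part of
  the increment. The bound \<open>B'\<close> adds the cases of one run and of several pieces, whose
  number is at most that for d.\<close>

lemma P_weight:
  "\<exists>B\<ge>1. B < \<infinity> \<and> (\<forall>u. 0 \<le> u \<and> u \<le> d \<longrightarrow> (\<integral>\<^sup>+s. weight 1 p (snd (snd s)) \<partial>P u) \<le> B)"
proof -
  obtain B where B: "1 \<le> B" "B < \<infinity>"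
    "\<And>u. u \<le> d \<Longrightarrow> ereal u \<le> r \<Longrightarrow> (\<integral>\<^sup>+s. weight 1 p (snd (snd s)) \<partial>P_le u) \<le> B"
    using P_le_weight[of d p] by blast
  define N where "N = nat (ceil_ratio d r)"
  define W where "W = weight 1 p"
  define B' where "B' = B + W (2 + real N) * (W 4 * B) ^ N"
  have "(\<integral>\<^sup>+s. W (snd (snd s)) \<partial>P u) \<le> B'" if u: "0 \<le> u" "u \<le> d" for u
  proof (cases "ereal u \<le> r")
    case True
    then have "(\<integral>\<^sup>+s. W (snd (snd s)) \<partial>P u) \<le> B"
      using B(3) u by (simp add: procP_eq W_def)
    then show ?thesis by (simp add: B'_def add_increasing2)
  next
    case False
    then have t: "r < ereal u" by simp
    let ?k = "nat (ceil_ratio u r)"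
    note k = grid_step_le[OF r t]
    have kN: "?k \<le> N" unfolding N_def by (intro nat_mono ceil_ratio_mono u r)
    have m: "(\<lambda>s :: state. W (snd (snd s))) \<in> borel_measurable (pieces ?k u)"
      unfolding measurable_cong_sets[OF sets_pieces refl] borel_prod[symmetric] W_def by measurable
    have W4: "1 \<le> W 4 * B"
      using mult_mono[of 1 "W 4" 1 B] weight_ge_1[of 1 p 4] B(1) by (simp add: W_def)
    have "(\<integral>\<^sup>+s. W (snd (snd s)) \<partial>P u) = (\<integral>\<^sup>+s. W (snd (snd s) + (2 + real ?k)) \<partial>pieces ?k u)"
      unfolding W_def by (rule nn_integral_procP_gt[OF t weight_measurable])
    also have "\<dots> \<le> (\<integral>\<^sup>+s. W (2 + real ?k) * W (snd (snd s)) \<partial>pieces ?k u)"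
      unfolding W_def by (intro nn_integral_mono) (subst mult.commute, rule weight_add_le)
    also have "\<dots> = W (2 + real ?k) * (\<integral>\<^sup>+s. W (snd (snd s)) \<partial>pieces ?k u)"
      by (rule nn_integral_cmult[OF m])
    also have "(\<integral>\<^sup>+s. W (snd (snd s)) \<partial>pieces ?k u) \<le> (W 4 * B) ^ ?k"
      unfolding pieces_def W_def
    proof (rule P_le.path_weight[where t = "grid u ?k", OF pieces_valid[OF r t] _ B(1)])
      fix i v assume "v \<le> grid u ?k (Suc i) - grid u ?k i"
      then have v: "v \<le> u / real ?k" using k by (simp add: grid_step)
      show "(\<integral>\<^sup>+s. weight 1 p (snd (snd s)) \<partial>P_le v) \<le> B"
        using v k u order_trans[of "ereal v" "ereal (u / real ?k)" r] by (intro B(3)) auto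
    qed simp
    also have "W (2 + real ?k) * (W 4 * B) ^ ?k \<le> W (2 + real N) * (W 4 * B) ^ N"
      unfolding W_def using kN W4[unfolded W_def]
      by (intro mult_mono weight_mono power_increasing) auto
    also have "\<dots> \<le> B'" by (simp add: B'_def)
    finally show ?thesis by (simp add: mult_left_mono)
  qed
  moreover have "B' < \<infinity>"
    using B(2) weight_less_top[of 1 p]
    by (simp add: B'_def W_def ennreal_mult_less_top power_less_top_ennreal)
  moreover have "1 \<le> B'" using B(1) by (simp add: B'_def add_increasing2)
  ultimately show ?thesis unfolding W_def by blast
qed

section \<open>The linear bound for the mean and its constant\<close>

context
  fixes T C0 :: real
  assumes T: "0 < T" and C0: "C0 = 1 + (1 + \<kappa>) * (4 * exp T / (1 - \<phi>))"
begin

text \<open>As \<CC> + 9 is at least 1, \<kappa> can be split off as a factor 1 + \<kappa>. The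
  leading 1 of \<open>C0\<close> supplies a further \<CC> + 9, of which 2 pays for the two
  operations outside the loop and 7 is kept in reserve.\<close>

lemma mean_constant: "9 + 4 * (\<CC> + 9 + \<kappa>) / (1 - \<phi>) * exp T \<le> (\<CC> + 9) * C0"
proof -
  have E: "0 \<le> 4 * exp T / (1 - \<phi>)" using contraction_bounds by simp
  have "\<CC> + 9 + \<kappa> \<le> (\<CC> + 9) * (1 + \<kappa>)"
    using TS_mean(1) \<kappa> mult_right_mono[of 1 "\<CC> + 9" \<kappa>] by (simp add: algebra_simps)
  from mult_right_mono[OF this E]
  have "(\<CC> + 9 + \<kappa>) * (4 * exp T / (1 - \<phi>)) \<le> (\<CC> + 9) * ((1 + \<kappa>) * (4 * exp T / (1 - \<phi>)))"
    by (simp only: mult.assoc)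
  then have "9 + (\<CC> + 9 + \<kappa>) * (4 * exp T / (1 - \<phi>))
      \<le> (\<CC> + 9) + (\<CC> + 9) * ((1 + \<kappa>) * (4 * exp T / (1 - \<phi>)))"
    using TS_mean(1) by (intro add_mono) auto
  moreover have "(\<CC> + 9) * C0 = (\<CC> + 9) + (\<CC> + 9) * ((1 + \<kappa>) * (4 * exp T / (1 - \<phi>)))"
    unfolding C0 distrib_left mult_1_right ..
  moreover have "4 * (\<CC> + 9 + \<kappa>) / (1 - \<phi>) * exp T = (\<CC> + 9 + \<kappa>) * (4 * exp T / (1 - \<phi>))"
    by simp
  ultimately show ?thesis by (simp only:)
qed

text \<open>
  The slack of \<open>7\<close> pays for the elementary operations when \<open>k \<ge> 1\<close> pieces are joined:
  \<open>4 k + (2 + k) \<le> 7 k\<close>.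
\<close>

lemma P_le_mean:
  assumes "u \<le> T" "ereal u \<le> r"
  shows "(\<integral>\<^sup>+s. ennreal (snd (snd s)) \<partial>P_le u) \<le> ennreal ((\<CC> + 9) * C0 - 7)"
proof -
  have "4 * (\<CC> + 9 + \<kappa>) / (1 - \<phi>) * exp u \<le> 4 * (\<CC> + 9 + \<kappa>) / (1 - \<phi>) * exp T"
    using assms(1) TS_mean(1) \<kappa> contraction_bounds by (intro mult_left_mono divide_nonneg_nonneg) auto
  with mean_constant have "2 + 4 * (\<CC> + 9 + \<kappa>) / (1 - \<phi>) * exp u \<le> (\<CC> + 9) * C0 - 7" by linarith
  then show ?thesis
    by (rule order_trans[OF procP_le_mean[OF assms(2)] ennreal_leI])
qed

lemma const_ge_7: "7 \<le> (\<CC> + 9) * C0"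
proof -
  have "0 \<le> 4 * (\<CC> + 9 + \<kappa>) / (1 - \<phi>) * exp T"
    using TS_mean(1) \<kappa> contraction_bounds by (intro mult_nonneg_nonneg divide_nonneg_nonneg) auto
  with mean_constant show ?thesis by linarith
qed

text \<open>The ceiling is taken at the whole increment d. A call with u = 0 can occur, when the
  remaining lifetime equals the increment, and it still costs something although its own ceiling is
  0.\<close>

lemma P_mean:
  assumes u: "0 \<le> u" "u \<le> d" "0 < d" and d: "min (ereal d) r \<le> ereal T"
  shows "(\<integral>\<^sup>+s. ennreal (snd (snd s)) \<partial>P u) \<le> ennreal (of_int (ceil_ratio d r) * ((\<CC> + 9) * C0))"
proof (cases "ereal u \<le> r")
  case True
  have "ereal u \<le> min (ereal d) r" using True u by simp
  then have uT: "u \<le> T" using d order_trans[of "ereal u" "min (ereal d) r" "ereal T"] by simp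
  have "1 * ((\<CC> + 9) * C0) \<le> of_int (ceil_ratio d r) * ((\<CC> + 9) * C0)"
    using ceil_ratio_ge_1[OF u(3) r] const_ge_7 by (intro mult_right_mono) auto
  then have "(\<CC> + 9) * C0 - 7 \<le> of_int (ceil_ratio d r) * ((\<CC> + 9) * C0)" by simp
  then have "ennreal ((\<CC> + 9) * C0 - 7) \<le> ennreal (of_int (ceil_ratio d r) * ((\<CC> + 9) * C0))"
    by (rule ennreal_leI)
  with P_le_mean[OF uT True] show ?thesis
    using True by (simp add: procP_eq)
next
  case False
  then have t: "r < ereal u" by simp
  let ?k = "nat (ceil_ratio u r)" and ?B = "(\<CC> + 9) * C0 - 7"
  note k = grid_step_le[OF r t]
  \<comment> \<open>With r < u \<le> d the bound on the minimum is a bound on r, which limits the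
    length of every piece by \<open>T\<close>.\<close>
  have rT: "r \<le> ereal T"
  proof -
    have "r < ereal d" using t u by (metis ereal_less_eq(3) order.strict_trans2)
    then show ?thesis using d by (simp add: min_def split: if_splits)
  qed
  have B0: "0 \<le> ?B" using const_ge_7 by simp
  interpret prob_space "pieces ?k u"
    unfolding pieces_def using P_le.path_nonneg_prob[where t = "grid u ?k" and ?s0.0 = "(0, 0)", OF pieces_valid[OF r t], of ?k]
    by simp
  have m: "(\<lambda>s :: state. ennreal (snd (snd s))) \<in> borel_measurable (pieces ?k u)"
    unfolding measurable_cong_sets[OF sets_pieces refl] borel_prod[symmetric] by measurable
  have "(\<integral>\<^sup>+s. ennreal (snd (snd s)) \<partial>P u) = (\<integral>\<^sup>+s. ennreal (snd (snd s) + (2 + real ?k)) \<partial>pieces ?k u)"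
    by (rule nn_integral_procP_gt[OF t measurable_ennreal])
  also have "\<dots> \<le> (\<integral>\<^sup>+s. ennreal (snd (snd s)) + ennreal (2 + real ?k) \<partial>pieces ?k u)"
    by (intro nn_integral_mono ennreal_add_le)
  also have "\<dots> = (\<integral>\<^sup>+s. ennreal (snd (snd s)) \<partial>pieces ?k u) + ennreal (2 + real ?k)"
    using emeasure_space_1 m by (simp add: nn_integral_add)
  also have "(\<integral>\<^sup>+s. ennreal (snd (snd s)) \<partial>pieces ?k u) \<le> ennreal (4 * real ?k + (\<Sum>i<?k. ?B))"
    unfolding pieces_def
  proof (rule P_le.path_mean[where t = "grid u ?k", OF pieces_valid[OF r t] _ B0])
    fix i v assume "v \<le> grid u ?k (Suc i) - grid u ?k i"
    then have "v \<le> u / real ?k" using k by (simp add: grid_step)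
    then have v: "ereal v \<le> r" using k order_trans[of "ereal v" "ereal (u / real ?k)" r] by simp
    then have "v \<le> T" using rT order_trans[of "ereal v" r "ereal T"] by simp
    then show "(\<integral>\<^sup>+s. ennreal (snd (snd s)) \<partial>P_le v) \<le> ennreal ?B" using v by (rule P_le_mean)
  qed simp
  also have "ennreal (4 * real ?k + (\<Sum>i<?k. ?B)) + ennreal (2 + real ?k)
      = ennreal (4 * real ?k + (\<Sum>i<?k. ?B) + (2 + real ?k))"
    using B0 by (intro ennreal_plus[symmetric]) (auto intro: add_nonneg_nonneg)
  also have "\<dots> \<le> ennreal (of_int (ceil_ratio d r) * ((\<CC> + 9) * C0))"
  proof (rule ennreal_leI)
    have k1: "1 \<le> real ?k" using k(1) by linarith
    have "4 * real ?k + (\<Sum>i<?k. ?B) + (2 + real ?k) \<le> real ?k * ((\<CC> + 9) * C0)"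
      using k1 by (simp add: algebra_simps)
    also have "\<dots> \<le> of_int (ceil_ratio d r) * ((\<CC> + 9) * C0)"
      using ceil_ratio_mono[OF u(2) r] k(1) const_ge_7 by (intro mult_right_mono) auto
    finally show "4 * real ?k + (\<Sum>i<?k. ?B) + (2 + real ?k) \<le> of_int (ceil_ratio d r) * ((\<CC> + 9) * C0)" .
  qed
  finally show ?thesis by (simp add: add_right_mono)
qed

lemma procP_running_time:
  assumes t: "0 < t"
  shows "finite_moments (running_time (P t))"
    and "min (ereal t) r \<le> ereal T \<Longrightarrow>
      (LINT c|running_time (P t). c) \<le> of_int (ceil_ratio t r) * (\<CC> + 9) * C0"
proof -
  have P: "prob_space (P t)" "AE s in P t. 0 \<le> snd (snd s)"
    using P_valid[of t] t unfolding P.valid_upto_def by (auto elim: eventually_mono)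
  show "finite_moments (running_time (P t))"
  proof (rule finite_moments_running_time[OF P(1) P.sets_sub P(2)])
    fix p
    obtain B where "B < \<infinity>" "\<And>u. 0 \<le> u \<Longrightarrow> u \<le> t \<Longrightarrow> (\<integral>\<^sup>+s. weight 1 p (snd (snd s)) \<partial>P u) \<le> B"
      using P_weight[of t p] by blast
    with t show "(\<integral>\<^sup>+s. weight 1 p (snd (snd s)) \<partial>P t) < \<infinity>"
      by (meson less_imp_le order_refl order.strict_trans1)
  qed
  assume T': "min (ereal t) r \<le> ereal T"
  have "(LINT c|running_time (P t). c) \<le> of_int (ceil_ratio t r) * ((\<CC> + 9) * C0)"
    using t const_ge_7 ceil_ratio_ge_1[OF t r]
    by (intro integral_running_time_le[OF P.sets_sub P(2)] P_mean T') auto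
  then show "(LINT c|running_time (P t). c) \<le> of_int (ceil_ratio t r) * (\<CC> + 9) * C0"
    by (simp add: mult.assoc)
qed

lemma path_running_time:
  assumes r0: "0 \<le> r0" and t: "\<And>i. i < n \<Longrightarrow> t i < t (Suc i)"
  shows "finite_moments (running_time (path_proc P t (x0, r0) n))"
    and "(\<And>i. i < n \<Longrightarrow> min (ereal (t (Suc i) - t i)) r \<le> ereal T) \<Longrightarrow>
      (LINT c|running_time (path_proc P t (x0, r0) n). c) \<le>
        4 * real n + C0 * (\<CC> + 9) * (\<Sum>i=1..n. of_int (ceil_ratio (t i - t (i - 1)) r))"
proof -
  let ?M = "path_proc P t (x0, r0) n"
  have M: "prob_space ?M" "AE s in ?M. 0 \<le> snd (snd s)"
    using P.path_nonneg_prob[where t = t and ?s0.0 = "(x0, r0)", OF P_valid, of n] r0 by (auto elim: eventually_mono)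
  show "finite_moments (running_time ?M)"
  proof (rule finite_moments_running_time[OF M(1) P.sets_path M(2)])
    fix p
    \<comment> \<open>A common upper bound of all increments, so that one bound for the subroutine
      serves every step.\<close>
    define d where "d = (\<Sum>i<n. t (Suc i) - t i)"
    have d: "t (Suc i) - t i \<le> d" if "i < n" for i
      unfolding d_def using that t by (intro member_le_sum) (auto intro: less_imp_le)
    obtain B where B: "1 \<le> B" "B < \<infinity>" "\<And>u. 0 \<le> u \<Longrightarrow> u \<le> d \<Longrightarrow> (\<integral>\<^sup>+s. weight 1 p (snd (snd s)) \<partial>P u) \<le> B"
      using P_weight[of d p] by blast
    have "(\<integral>\<^sup>+s. weight 1 p (snd (snd s)) \<partial>?M) \<le> (weight 1 p 4 * B) ^ n"
    proof (rule P.path_weight[where t = t, OF P_valid _ B(1)])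
      fix i u assume "i < n" "0 \<le> u" "u \<le> t (Suc i) - t i"
      then show "(\<integral>\<^sup>+s. weight 1 p (snd (snd s)) \<partial>P u) \<le> B" using d[of i] by (intro B(3)) auto
    qed (simp add: r0)
    also have "\<dots> < \<infinity>"
      using B(2) weight_less_top[of 1 p 4] by (simp add: ennreal_mult_less_top power_less_top_ennreal)
    finally show "(\<integral>\<^sup>+s. weight 1 p (snd (snd s)) \<partial>?M) < \<infinity>" .
  qed
  assume T': "\<And>i. i < n \<Longrightarrow> min (ereal (t (Suc i) - t i)) r \<le> ereal T"
  \<comment> \<open>The value 0 beyond n makes the bounds nonnegative for every index, also where
    the times need not increase.\<close>
  define B where "B i = (if i < n then of_int (ceil_ratio (t (Suc i) - t i) r) * ((\<CC> + 9) * C0) else 0)" for i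
  have B0: "0 \<le> B i" for i
  proof (cases "i < n")
    case True
    then have "1 \<le> ceil_ratio (t (Suc i) - t i) r" using t[of i] by (intro ceil_ratio_ge_1 r) simp
    then have "0 \<le> (of_int (ceil_ratio (t (Suc i) - t i) r) :: real) * ((\<CC> + 9) * C0)"
      using const_ge_7 by (intro mult_nonneg_nonneg[of _ "(\<CC> + 9) * C0"]) auto
    then show ?thesis using True by (simp only: B_def if_True)
  qed (simp add: B_def)
  have sum: "4 * real n + C0 * (\<CC> + 9) * (\<Sum>i=1..n. of_int (ceil_ratio (t i - t (i - 1)) r)) =
      4 * real n + (\<Sum>i<n. B i)"
  proof -
    have "(\<Sum>i=1..n. of_int (ceil_ratio (t i - t (i - 1)) r)) =
        (\<Sum>i<n. of_int (ceil_ratio (t (Suc i) - t i) r) :: real)"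
      by (simp add: sum.atLeast1_atMost_eq)
    then show ?thesis
      by (simp add: B_def sum_distrib_left sum_distrib_right mult_ac)
  qed
  show "(LINT c|running_time ?M. c) \<le>
        4 * real n + C0 * (\<CC> + 9) * (\<Sum>i=1..n. of_int (ceil_ratio (t i - t (i - 1)) r))"
    unfolding sum
  proof (rule integral_running_time_le[OF P.sets_path M(2)])
    show "0 \<le> 4 * real n + (\<Sum>i<n. B i)" by (intro add_nonneg_nonneg sum_nonneg B0) auto
    show "(\<integral>\<^sup>+s. ennreal (snd (snd s)) \<partial>?M) \<le> ennreal (4 * real n + (\<Sum>i<n. B i))"
    proof (rule P.path_mean[where t = t, OF P_valid _ B0])
      fix i u assume "i < n" "0 \<le> u" "u \<le> t (Suc i) - t i"
      then show "(\<integral>\<^sup>+s. ennreal (snd (snd s)) \<partial>P u) \<le> ennreal (B i)"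
        using t[of i] T'[of i] by (simp add: B_def P_mean)
    qed (simp add: r0)
  qed
qed

end

end

end

theorem corollary3p4:
  fixes \<zeta> :: "real measure" and \<kappa> T :: real
  assumes "sets \<zeta> = sets borel" and "finite_measure \<zeta>" and "emeasure \<zeta> {..0} = 0"
    and "0 \<le> \<kappa>" and "0 < T"
  shows "\<exists>const>0. \<forall>(\<alpha>::real) (\<theta>::real) (r::ereal) (\<Omega> :: real \<Rightarrow> 'w measure) X TS WS \<CC> K.
     0 < \<alpha> \<and> \<alpha> < 1 \<and> 0 < \<theta> \<and> 0 < r \<and>
     (\<forall>b. 0 < b \<and> ereal b \<le> r \<longrightarrow> driftless_subordinator (\<Omega> b) (X b) (nu_trunc \<theta> \<alpha> b)) \<and>
     TS_sampler \<alpha> r \<Omega> X TS \<CC> K \<and> W_sampler r \<Omega> X WS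
     \<longrightarrow>
     (\<forall>t>0.
        let R = running_time (procP \<theta> \<alpha> r \<zeta> \<kappa> TS WS t) in
        finite_moments R \<and>
        (min (ereal t) r \<le> ereal T \<longrightarrow>
           (LINT c|R. c) \<le> of_int (ceil_ratio t r) * (\<CC> + 9) * const)) \<and>
     (\<forall>(n::nat) (t :: nat \<Rightarrow> real) x0 r0. 0 \<le> r0 \<and> (\<forall>i<n. t i < t (Suc i)) \<longrightarrow>
        (let R = running_time (path_proc (procP \<theta> \<alpha> r \<zeta> \<kappa> TS WS) t (x0, r0) n) in
        finite_moments R \<and>
        ((\<forall>i<n. min (ereal (t (Suc i) - t i)) r \<le> ereal T) \<longrightarrow>
           (LINT c|R. c) \<le> 4 * real n +
             const * (\<CC> + 9) * (\<Sum>i=1..n. of_int (ceil_ratio (t i - t (i - 1)) r)))))"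
proof -
  \<comment> \<open>Fixed before \<alpha>, \<theta>, r and the samplers are introduced; \<zeta>
    enters only through its contraction factor.\<close>
  define C0 where "C0 = 1 + (1 + \<kappa>) * (4 * exp T / (1 - contraction \<zeta>))"
  have "0 \<le> (1 + \<kappa>) * (4 * exp T / (1 - contraction \<zeta>))"
    using assms(4) contraction_less_1[OF assms(1-3)] by (intro mult_nonneg_nonneg divide_nonneg_nonneg) auto
  then have "0 < C0" by (simp add: C0_def)
  then show ?thesis
  proof (intro exI[of _ C0] conjI, assumption, unfold Let_def, intro allI impI)
    fix \<alpha> \<theta> :: real and r :: ereal and \<Omega> :: "real \<Rightarrow> 'w measure" and X TS WS \<CC> K
    assume A: "0 < \<alpha> \<and> \<alpha> < 1 \<and> 0 < \<theta> \<and> 0 < r \<and>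
       (\<forall>b. 0 < b \<and> ereal b \<le> r \<longrightarrow> driftless_subordinator (\<Omega> b) (X b) (nu_trunc \<theta> \<alpha> b)) \<and>
       TS_sampler \<alpha> r \<Omega> X TS \<CC> K \<and> W_sampler r \<Omega> X WS"
    then have r: "0 < r" by blast
    have S: "samplers \<zeta> \<kappa> \<alpha> \<theta> r \<Omega> X TS WS \<CC> K"
      by (intro samplers.intro assms) (use A in blast)+
    note single = samplers.procP_running_time[OF S r assms(5) C0_def]
    note path = samplers.path_running_time[OF S r assms(5) C0_def]
    show "(\<forall>t>0. finite_moments (running_time (procP \<theta> \<alpha> r \<zeta> \<kappa> TS WS t)) \<and>
        (min (ereal t) r \<le> ereal T \<longrightarrow>
           (LINT c|running_time (procP \<theta> \<alpha> r \<zeta> \<kappa> TS WS t). c) \<le> of_int (ceil_ratio t r) * (\<CC> + 9) * C0)) \<and>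
     (\<forall>(n::nat) (t :: nat \<Rightarrow> real) x0 r0. 0 \<le> r0 \<and> (\<forall>i<n. t i < t (Suc i)) \<longrightarrow>
        finite_moments (running_time (path_proc (procP \<theta> \<alpha> r \<zeta> \<kappa> TS WS) t (x0, r0) n)) \<and>
        ((\<forall>i<n. min (ereal (t (Suc i) - t i)) r \<le> ereal T) \<longrightarrow>
           (LINT c|running_time (path_proc (procP \<theta> \<alpha> r \<zeta> \<kappa> TS WS) t (x0, r0) n). c) \<le> 4 * real n +
             C0 * (\<CC> + 9) * (\<Sum>i=1..n. of_int (ceil_ratio (t i - t (i - 1)) r))))"
    proof (intro conjI allI impI)
      fix n and t :: "nat \<Rightarrow> real" and x0 r0 :: real assume "0 \<le> r0 \<and> (\<forall>i<n. t i < t (Suc i))"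
      then have nt: "0 \<le> r0" "\<And>i. i < n \<Longrightarrow> t i < t (Suc i)" by blast+
      show "finite_moments (running_time (path_proc (procP \<theta> \<alpha> r \<zeta> \<kappa> TS WS) t (x0, r0) n))"
        by (rule path(1)) (rule nt, assumption?)+
      assume "\<forall>i<n. min (ereal (t (Suc i) - t i)) r \<le> ereal T"
      then show "(LINT c|running_time (path_proc (procP \<theta> \<alpha> r \<zeta> \<kappa> TS WS) t (x0, r0) n). c) \<le> 4 * real n +
             C0 * (\<CC> + 9) * (\<Sum>i=1..n. of_int (ceil_ratio (t i - t (i - 1)) r))"
        by (intro path(2)) (use nt in blast)+
    qed (rule single; assumption)+
  qed
qed

end
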